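(* Let $N\ge1$, $d>0$, $p>1$, and consider the Cauchy problem $$\partial_tu+(-\Delta)^{\frac d2}u=|u|^p\ \text{ in }\mathbb{R}^N\times(0,\infty),\qquad u(\cdot,0)=\phi\ \text{ in }\mathbb{R}^N,$$ with $\phi$ locally integrable on $\mathbb{R}^N$ (solutions being understood as in the context). Set $r_0:=\dfrac{N(p-1)}{d}$. (i) Let $r_0<1$. Then there exists $\gamma>0$ such that for every $\phi$ there is a constant $C>0$, independent of $T$, with the following property: if $$\sup_{x\in\mathbb{R}^N}\frac1{|B(x,T^{1/d})|}\int_{B(x,T^{1/d})}|\phi(y)|\,dy\le\gamma T^{-\frac{N}{dr_0}}$$ for some $T\in(0,\infty)$, then the problem possesses a solution $u$ in $\mathbb{R}^N\times[0,T)$ such that $|u(x,t)|\le Ct^{-\frac Nd}$ for $(x,t)\in\mathbb{R}^N\times(0,T)$. (ii) Let $r_0>1$. Then, for any $q>1$, there exists $\gamma>0$ such that for every $\phi$ there is a constant $C>0$, independent of $T$, with the following property: if $$\sup_{x\in\mathbb{R}^N}\sup_{0<\sigma<T^{1/d}}\sigma^{\frac N{r_0}}\left(\frac1{|B(x,\sigma)|}\int_{B(x,\sigma)}|\phi(y)|^q\,dy\right)^{\frac1q}\le\gamma$$ for some $T\in(0,\infty]$, then the problem possesses a solution $u$ in $\mathbb{R}^N\times[0,T)$ such that $|u(x,t)|\le Ct^{-\frac N{dr_0}}$ for $(x,t)\in\mathbb{R}^N\times(0,T)$. (iii) Let $r_0=1$ and $\beta>0$, and set $\Phi(s):=s[\log(e+s)]^\beta$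 and $\rho(s):=s^{-N}[\log(e+s^{-1})]^{-\frac Nd}$. Then there exists $\gamma>0$ such that for every $\phi$ there is a constant $C>0$, independent of $T$, with the following property: if $$\sup_{x\in\mathbb{R}^N}\Phi^{-1}\left(\frac1{|B(x,\sigma)|}\int_{B(x,\sigma)}\Phi\bigl(T^{\frac Nd}|\phi(y)|\bigr)\,dy\right)\le\gamma\rho\bigl(\sigma T^{-\frac1d}\bigr),\qquad 0<\sigma<T^{\frac1d},$$ for some $T\in(0,\infty)$, then the problem possesses a solution $u$ in $\mathbb{R}^N\times[0,T)$ such that $|u(x,t)|\le Ct^{-\frac Nd}\left|\log\frac t{2T}\right|^{-\frac Nd}$ for $(x,t)\in\mathbb{R}^N\times(0,T)$.
   Context: $B(x,\sigma)$ is the open ball of centre $x$ and radius $\sigma$; $T^{1/d}=\infty$ if $T=\infty$; $\Phi^{-1}$ is the inverse of the increasing bijection $\Phi:[0,\infty)\to[0,\infty)$. Let $G_d(x,t)=(2\pi)^{-N}\int_{\mathbb{R}^N}e^{ix\cdot\xi}e^{-t|\xi|^d}\,d\xi$ be the fundamental solution of $\partial_tu+(-\Delta)^{d/2}u=0$ in $\mathbb{R}^N\times(0,\infty)$. For $0<T\le\infty$, a solution of the Cauchy problem in $\mathbb{R}^N\times[0,T)$ is a function $u$ that is bounded and continuous on $\mathbb{R}^N\times(\tau,T)$ for every $\tau\in(0,T)$ and satisfies $$u(x,t)=\int_{\mathbb{R}^N}G_d(x-y,t)\phi(y)\,dy+\int_0^t\int_{\mathbb{R}^N}G_d(x-y,t-s)|u(y,s)|^p\,dy\,ds$$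 for all $(x,t)\in\mathbb{R}^N\times(0,T)$. *)

theory Defs
  imports "HOL-Analysis.Analysis"
begin

text \<open>The integral below is real because its integrand is conjugated by the reflection of
  \<open>\<xi>\<close>; taking \<open>Re\<close> only changes the type.\<close>

definition G :: "real \<Rightarrow> real ^ 'n \<Rightarrow> real \<Rightarrow> real" where
  "G d x t = (1 / (2 * pi) ^ CARD('n)) *
     Re (LINT \<xi>|lebesgue. exp (\<i> * complex_of_real (x \<bullet> \<xi>)) *
                            complex_of_real (exp (- t * norm \<xi> powr d)))"

definition locally_integrable :: "(real ^ 'n \<Rightarrow> real) \<Rightarrow> bool" where
  "locally_integrable \<phi> \<longleftrightarrow> (\<forall>K. compact K \<longrightarrow> \<phi> absolutely_integrable_on K)"

text \<open>Times \<open>T \<in> (0,\<infinity>]\<close> have type \<^typ>\<open>ennreal\<close>. Since the Bochner integral of a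
  non-integrable function is \<open>0\<close> by convention, the existence of the integrals in the integral
  equation is required explicitly.\<close>

definition is_solution ::
  "real \<Rightarrow> real \<Rightarrow> (real ^ 'n \<Rightarrow> real) \<Rightarrow> ennreal \<Rightarrow> (real ^ 'n \<Rightarrow> real \<Rightarrow> real) \<Rightarrow> bool" where
  "is_solution d p \<phi> T u \<longleftrightarrow>
     (\<forall>\<tau>>0. ennreal \<tau> < T \<longrightarrow>
        (let D = (UNIV :: (real ^ 'n) set) \<times> {t. \<tau> < t \<and> ennreal t < T} in
           bounded ((\<lambda>(x, t). u x t) ` D) \<and> continuous_on D (\<lambda>(x, t). u x t))) \<and>
     (\<forall>x. \<forall>t>0. ennreal t < T \<longrightarrow>
        integrable lebesgue (\<lambda>y. G d (x - y) t * \<phi> y) \<and>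
        (\<forall>s\<in>{0<..<t}. integrable lebesgue (\<lambda>y. G d (x - y) (t - s) * \<bar>u y s\<bar> powr p)) \<and>
        set_integrable lebesgue {0<..<t}
          (\<lambda>s. LINT y|lebesgue. G d (x - y) (t - s) * \<bar>u y s\<bar> powr p) \<and>
        u x t = (LINT y|lebesgue. G d (x - y) t * \<phi> y) +
          (LINT s:{0<..<t}|lebesgue. LINT y|lebesgue. G d (x - y) (t - s) * \<bar>u y s\<bar> powr p))"

text \<open>Means are taken in \<open>[0,\<infinity>]\<close>, as the powers \<open>\<bar>\<phi>\<bar>\<^sup>q\<close> and \<open>\<Phi>(\<bar>\<phi>\<bar>)\<close> of a locally integrable
  function need not be locally integrable.\<close>

definition ball_mean :: "(real ^ 'n \<Rightarrow> real) \<Rightarrow> real ^ 'n \<Rightarrow> real \<Rightarrow> ennreal" where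
  "ball_mean f x \<sigma> =
     (\<integral>\<^sup>+y \<in> ball x \<sigma>. ennreal (f y) \<partial>lebesgue) / emeasure lebesgue (ball x \<sigma>)"

text \<open>Extension of an increasing unbounded function \<open>f : [0,\<infinity>) \<rightarrow> [0,\<infinity>)\<close> to \<open>[0,\<infinity>]\<close> by
  \<open>f(\<infinity>) = \<infinity>\<close>.\<close>

definition extend_top :: "(real \<Rightarrow> real) \<Rightarrow> ennreal \<Rightarrow> ennreal" where
  "extend_top f z = (if z = \<infinity> then \<infinity> else ennreal (f (enn2real z)))"

definition Phi :: "real \<Rightarrow> real \<Rightarrow> real" where
  "Phi \<beta> s = s * ln (exp 1 + s) powr \<beta>"

definition Phi_inv :: "real \<Rightarrow> real \<Rightarrow> real" where
  "Phi_inv \<beta> = the_inv_into {0..} (Phi \<beta>)"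

definition rho :: "real \<Rightarrow> real \<Rightarrow> real \<Rightarrow> real" where
  "rho N d s = s powr (- N) * ln (exp 1 + 1 / s) powr (- N / d)"

end

theory Submission
  imports Defs "HOL-Complex_Analysis.Complex_Analysis"
begin

text \<open>The kernel \<open>G\<^sub>d\<close>, which changes sign for large \<open>d\<close>, is dominated by a multiple of the positive kernel
  \<open>K(x,t) = t (t\<^sup>1\<^sup>/\<^sup>d + \<bar>x\<bar>)\<^sup>-\<^sup>N\<^sup>-\<^sup>d\<close>: translating the Fourier integral by \<open>h = \<pi> x / \<bar>x\<bar>\<^sup>2\<close> changes its
  sign, so \<open>2\<^sup>m \<bar>G\<^sub>d(x,t)\<bar>\<close> is at most the integral of the modulus of the \<open>m\<close>-th difference of
  \<open>exp (- t \<bar>\<xi>\<bar>\<^sup>d)\<close> with step \<open>h\<close>, which Cauchy's inequality bounds by a multiple of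
  \<open>t \<bar>h\<bar>\<^sup>N\<^sup>+\<^sup>d\<close> once \<open>m > N + d\<close>. The kernel \<open>K\<close> satisfies the semigroup inequality
  \<open>K(t - s) * K(s) \<le> C K(t)\<close>. For \<open>\<Phi>(w) = w h(w)\<close> with \<open>h\<close> nondecreasing put \<open>Z = K(t) * \<Phi>(\<bar>\<phi>\<bar>)\<close> and
  \<open>W = \<Phi>\<^sup>-\<^sup>1(Z)\<close>. If \<open>W \<le> m(t)\<close>, then \<open>W\<^sup>p = Z W\<^sup>p\<^sup>-\<^sup>1 / h(W) \<le> Z \<eta>(s)\<close>, where \<open>\<eta>(s)\<close> is the supremum of
  \<open>w\<^sup>p\<^sup>-\<^sup>1 / h(w)\<close> over \<open>w \<le> m(s)\<close>, and the Duhamel integral of \<open>W\<^sup>p\<close> is at most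
  \<open>C Z(t) \<integral>\<^sub>0\<^sup>t \<eta> ds \<le> C W h(m(t)) \<integral>\<^sub>0\<^sup>t \<eta> ds\<close>. As soon as \<open>h(m(t)) \<integral>\<^sub>0\<^sup>t \<eta> ds\<close> is small, Picard iteration
  contracts with respect to the weight \<open>W\<close>. The hypotheses on ball means give \<open>Z \<le> \<Phi>(m(t))\<close>, and the three
  cases are \<open>h = 1\<close>, \<open>h(w) = w\<^sup>q\<^sup>-\<^sup>1\<close> and \<open>h(w) = [log (e + T\<^sup>N\<^sup>/\<^sup>d w)]\<^sup>\<beta>\<close>.\<close>

section \<open>The majorant kernel\<close>

text \<open>\<open>G d\<close> may change sign and \<open>kern\<close> is not a probability kernel,
  so neither a comparison principle nor Jensen's inequality is at hand. Jensen is replaced by the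
  splitting |\<phi>| \<le> w + \<Phi>(|\<phi>|) / h(w), valid for every w > 0 because h is
  nondecreasing; with w = W it bounds the linear part by a multiple of W. Comparison gives way to
  contraction, where smallness absorbs all constants. The semigroup inequality is applied to Z only,
  which is linear in \<Phi>(|\<phi>|); the nonlinear W enters through W^p \<le> \<eta> Z. The choice
  of h is a balance: \<eta> has to be integrable at time 0, and h(m(t)) times its integral has to
  stay bounded. For h = 1 and m(s) of order s^(-N/d), \<eta> is of order s^(-r0), integrable when r0
  < 1. For m(s) of order s^(-1/(p-1)), h = 1 would give s^(-1); a power h lowers the exponent below
  1, and by scaling the product becomes constant in t. At r0 = 1 the logarithms in m and h turn
  \<eta> into the derivative of a negative power of a logarithm.\<close>

lemma nn_integral_lborel_affine:
  fixes f :: "'a::euclidean_space \<Rightarrow> ennreal"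
  assumes [measurable]: "f \<in> borel_measurable borel" and c: "c \<noteq> 0"
  shows "(\<integral>\<^sup>+x. f x \<partial>lborel) = ennreal (\<bar>c\<bar> ^ DIM('a)) * (\<integral>\<^sup>+x. f (t + c *\<^sub>R x) \<partial>lborel)"
  by (subst lborel_affine[OF c, of t])
     (simp add: nn_integral_density nn_integral_distr nn_integral_cmult)

lemma nn_integral_lborel_shift:
  fixes f :: "'a::euclidean_space \<Rightarrow> ennreal"
  assumes "f \<in> borel_measurable borel"
  shows "(\<integral>\<^sup>+x. f (t + x) \<partial>lborel) = (\<integral>\<^sup>+x. f x \<partial>lborel)"
  using nn_integral_lborel_affine[OF assms, of 1 t] by simp

lemma nn_integral_lborel_reflect:
  fixes f :: "'a::euclidean_space \<Rightarrow> ennreal"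
  assumes "f \<in> borel_measurable borel"
  shows "(\<integral>\<^sup>+x. f (t - x) \<partial>lborel) = (\<integral>\<^sup>+x. f x \<partial>lborel)"
  using nn_integral_lborel_affine[OF assms, of "-1" t] by simp

text \<open>Covering by dyadic balls: on the shell of index j the integrand is at most a multiple of
  \<open>(2 powr - a) ^ j\<close>, while the ball has volume of order \<open>2 ^ (j * N)\<close>, N
  being the dimension; the geometric series has ratio \<open>2 powr (N - a)\<close>, less than
  1.\<close>

lemma nn_integral_powr_norm_finite:
  assumes a: "a > real DIM('a::euclidean_space)"
  shows "(\<integral>\<^sup>+x. ennreal ((1 + norm (x::'a)) powr - a) \<partial>lborel) < \<infinity>"
proof -
  let ?N = "DIM('a)"
  define b where "b j = 2 powr a * (2 powr - a) ^ j" for j :: nat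
  have "ennreal ((1 + norm x) powr - a) \<le> (\<Sum>j. ennreal (b j) * indicator (ball 0 (2 ^ j)) x)" for x :: 'a
  proof -
    have "\<exists>j. norm x < 2 ^ j"
      using real_arch_pow[of 2 "norm x"] by auto
    \<comment> \<open>Minimality of \<open>j\<close> yields the lower bound
      \<open>2 powr (real j - 1)\<close> for \<open>1 + norm x\<close>; for \<open>j = 0\<close> it
      is \<open>1 / 2\<close> and trivial.\<close>
    define j where "j = (LEAST j. norm x < 2 ^ j)"
    have j: "norm x < 2 ^ j"
      unfolding j_def by (rule LeastI_ex) fact
    have "2 powr (real j - 1) \<le> 1 + norm x"
    proof (cases j)
      case 0
      then show ?thesis by (simp add: powr_minus add_increasing2)
    next
      case (Suc i)
      have "\<not> norm x < 2 ^ i"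
        using not_less_Least[of i "\<lambda>j. norm x < 2 ^ j"] Suc j_def by simp
      then show ?thesis using Suc by (simp add: powr_realpow)
    qed
    then have "(1 + norm x) powr - a \<le> (2 powr (real j - 1)) powr - a"
      using a by (intro powr_mono2') auto
    also have "\<dots> = b j"
      unfolding b_def by (simp add: powr_powr powr_add[symmetric] powr_realpow[symmetric] algebra_simps)
    finally have "ennreal ((1 + norm x) powr - a) \<le> ennreal (b j) * indicator (ball 0 (2 ^ j)) x"
      using j by (simp add: ennreal_leI)
    also have "\<dots> \<le> (\<Sum>j. ennreal (b j) * indicator (ball 0 (2 ^ j)) x)"
    proof -
      have "(\<Sum>j\<in>{j}. f j) \<le> suminf f" for f :: "nat \<Rightarrow> ennreal"
        by (intro sum_le_suminf) auto
      then have "f j \<le> suminf f" for f :: "nat \<Rightarrow> ennreal" by simp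
      then show ?thesis .
    qed
    finally show ?thesis .
  qed
  then have "(\<integral>\<^sup>+x. ennreal ((1 + norm (x::'a)) powr - a) \<partial>lborel)
      \<le> (\<integral>\<^sup>+x. (\<Sum>j. ennreal (b j) * indicator (ball 0 (2 ^ j)) (x::'a)) \<partial>lborel)"
    by (intro nn_integral_mono) auto
  also have "\<dots> = (\<Sum>j. \<integral>\<^sup>+x. ennreal (b j) * indicator (ball 0 (2 ^ j)) (x::'a) \<partial>lborel)"
    proof (rule nn_integral_suminf)
    show "(\<lambda>x::'a. ennreal (b j) * indicator (ball 0 (2 ^ j)) x) \<in> borel_measurable lborel" for j
      by (simp add: borel_measurable_indicator borel_measurable_times_ennreal)
  qed
  also have "\<dots> = (\<Sum>j. ennreal (b j * (unit_ball_vol ?N * (2 ^ j) ^ ?N)))"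
    by (intro suminf_cong, subst nn_integral_cmult_indicator) (simp_all add: emeasure_ball ennreal_mult' b_def)
  also have "\<dots> < \<infinity>"
  proof -
    have eq: "b j * (unit_ball_vol ?N * (2 ^ j) ^ ?N) = 2 powr a * unit_ball_vol ?N * (2 powr (?N - a)) ^ j" for j
      by (simp add: b_def powr_diff powr_minus powr_realpow field_simps power_mult[symmetric] mult.commute)
    have "2 powr (?N - a) < 2 powr 0" using a by (intro powr_less_mono) auto
    then have "summable (\<lambda>j. b j * (unit_ball_vol ?N * (2 ^ j) ^ ?N))"
      unfolding eq by (intro summable_mult summable_geometric) auto
    then show ?thesis
      by (subst suminf_ennreal2) (auto simp: b_def)
  qed
  finally show ?thesis .
qed

text \<open>Up to constants the minimum of \<open>t powr (- N / d)\<close> and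
  \<open>t * norm x powr - (N + d)\<close>, N being the dimension: the profile of the fractional
  heat kernel for 0 < d < 2. The polynomial tail reflects that the symbol |\<xi>|^d is in general
  not smooth at the origin.\<close>

definition kern :: "real \<Rightarrow> 'a::euclidean_space \<Rightarrow> real \<Rightarrow> real" where
  "kern d x t = t * (t powr (1 / d) + norm x) powr - (real DIM('a) + d)"

lemma kern_nonneg: "t \<ge> 0 \<Longrightarrow> kern d x t \<ge> 0"
  by (simp add: kern_def)

lemma kern_pos:
  assumes "t > 0" shows "kern d x t > 0"
proof -
  have "t powr (1 / d) + norm x > 0" using assms by (simp add: add_pos_nonneg)
  then show ?thesis using assms by (simp add: kern_def)
qed

lemma kern_measurable [measurable (raw)]:
  fixes f :: "'b \<Rightarrow> 'a::euclidean_space"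
  assumes [measurable]: "f \<in> borel_measurable M" "g \<in> borel_measurable M"
  shows "(\<lambda>x. kern d (f x) (g x)) \<in> borel_measurable M"
  unfolding kern_def by measurable

lemma kern_scale:
  fixes x :: "'a::euclidean_space"
  assumes "d > 0" "t > 0"
  shows "kern d (t powr (1 / d) *\<^sub>R x) t = t powr (- real DIM('a) / d) * kern d x 1"
proof -
  have "kern d (t powr (1 / d) *\<^sub>R x) t = t * (t powr (1 / d) * (1 + norm x)) powr - (real DIM('a) + d)"
    by (simp add: kern_def algebra_simps)
  also have "\<dots> = t powr (1 + - (real DIM('a) + d) / d) * (1 + norm x) powr - (real DIM('a) + d)"
    using assms by (simp add: powr_mult powr_powr powr_add)
  also have "1 + - (real DIM('a) + d) / d = - real DIM('a) / d"
    using assms by (simp add: field_simps)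
  finally show ?thesis by (simp add: kern_def)
qed

definition kern_mass :: "real \<Rightarrow> 'a::euclidean_space itself \<Rightarrow> real" where
  "kern_mass d _ = enn2real (\<integral>\<^sup>+x. ennreal (kern d (x::'a) 1) \<partial>lborel)"

lemma kern_mass_nonneg: "kern_mass d TYPE('a::euclidean_space) \<ge> 0"
  by (simp add: kern_mass_def)

text \<open>Self-similarity makes the mass independent of \<open>t\<close>; it is finite because the
  decay exponent N + d exceeds the dimension.\<close>

lemma nn_integral_kern:
  assumes "d > 0" "t > 0"
  shows "(\<integral>\<^sup>+x. ennreal (kern d (x::'a::euclidean_space) t) \<partial>lborel) = ennreal (kern_mass d TYPE('a))"
proof -
  have fin: "(\<integral>\<^sup>+x. ennreal (kern d (x::'a) 1) \<partial>lborel) < \<infinity>"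
    using nn_integral_powr_norm_finite[where 'a='a and a="real DIM('a) + d"] assms
    by (simp add: kern_def)
  have "(\<integral>\<^sup>+x. ennreal (kern d (x::'a) t) \<partial>lborel)
      = ennreal ((t powr (1 / d)) ^ DIM('a)) * (\<integral>\<^sup>+x. ennreal (kern d (t powr (1 / d) *\<^sub>R (x::'a)) t) \<partial>lborel)"
    using nn_integral_lborel_affine[of "\<lambda>x::'a. ennreal (kern d x t)" "t powr (1 / d)" 0] assms by simp
  also have "\<dots> = ennreal ((t powr (1 / d)) ^ DIM('a)) * (ennreal (t powr (- real DIM('a) / d)) * (\<integral>\<^sup>+x. ennreal (kern d (x::'a) 1) \<partial>lborel))"
    using assms by (simp add: kern_scale ennreal_mult' nn_integral_cmult)
  also have "\<dots> = (\<integral>\<^sup>+x. ennreal (kern d (x::'a) 1) \<partial>lborel)"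
  proof -
    have "(t powr (1 / d)) ^ DIM('a) * t powr (- real DIM('a) / d) = t powr (real DIM('a) / d + - real DIM('a) / d)"
      using assms by (simp only: powr_add powr_realpow[symmetric] powr_powr) (simp add: powr_powr powr_realpow[symmetric])
    also have "\<dots> = 1" using assms by simp
    finally have eq: "(t powr (1 / d)) ^ DIM('a) * t powr (- real DIM('a) / d) = 1" .
    have "ennreal ((t powr (1 / d)) ^ DIM('a)) * (ennreal (t powr (- real DIM('a) / d)) * I)
        = ennreal ((t powr (1 / d)) ^ DIM('a) * t powr (- real DIM('a) / d)) * I" for I
      by (subst ennreal_mult') (auto simp: mult.assoc)
    then show ?thesis unfolding eq by simp
  qed
  finally show ?thesis using fin by (simp add: kern_mass_def)
qed

lemma nn_integral_kern_diff:
  assumes "d > 0" "t > 0"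
  shows "(\<integral>\<^sup>+y. ennreal (kern d (x - y :: 'a::euclidean_space) t) \<partial>lborel) = ennreal (kern_mass d TYPE('a))"
  using nn_integral_lborel_reflect[of "\<lambda>y::'a. ennreal (kern d y t)" x] nn_integral_kern[OF assms, where 'a='a]
  by simp

lemma powr_minus_mult_leD:
  fixes a b u v :: real
  assumes "b > 0" "b powr - a * u \<le> v"
  shows "u \<le> b powr a * v"
  using assms by (simp add: powr_minus field_simps)

text \<open>A shift by at most \<open>t powr (1 / d)\<close> in space and a factor 2 in time change
  the base \<open>t powr (1 / d) + norm x\<close> by a bounded factor only. This serves both for
  averaging over balls and for integrable majorants in the continuity proofs.\<close>

lemma kern_harnack:
  fixes x x' :: "'a::euclidean_space"
  assumes d: "d > 0" and t: "t > 0" and t': "t \<le> 2 * t'" "t' \<le> 2 * t"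
    and x: "norm (x - x') \<le> t powr (1 / d)"
  shows "kern d x t \<le> 2 * (2 powr (1 / d) + 1) powr (real DIM('a) + d) * kern d x' t'"
proof -
  let ?c = "2 powr (1 / d) + 1" and ?a = "real DIM('a) + d"

  have c: "?c > 0" by (simp add: add_nonneg_pos)
  have "t' > 0" using t t' by simp
  have "t' powr (1 / d) \<le> (2 * t) powr (1 / d)"
    using t' \<open>t' > 0\<close> d by (intro powr_mono2) auto
  then have "t' powr (1 / d) \<le> 2 powr (1 / d) * t powr (1 / d)"
    using t by (simp add: powr_mult)
  moreover have "norm x' \<le> norm x + norm (x - x')" by norm
  moreover have "0 \<le> 2 powr (1 / d) * norm x" by simp
  ultimately have le: "t' powr (1 / d) + norm x' \<le> ?c * (t powr (1 / d) + norm x)"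
    using x unfolding distrib_left distrib_right mult_1 by linarith
  have pos: "t' powr (1 / d) + norm x' > 0" "t powr (1 / d) + norm x > 0"
    using \<open>t' > 0\<close> t by (simp_all add: add_pos_nonneg)
  have "(?c * (t powr (1 / d) + norm x)) powr - ?a \<le> (t' powr (1 / d) + norm x') powr - ?a"
    using le pos d by (intro powr_mono2') auto
  then have "?c powr - ?a * (t powr (1 / d) + norm x) powr - ?a \<le> (t' powr (1 / d) + norm x') powr - ?a"
    using c pos by (simp add: powr_mult)
  then have "(t powr (1 / d) + norm x) powr - ?a \<le> ?c powr ?a * (t' powr (1 / d) + norm x') powr - ?a"
    by (rule powr_minus_mult_leD[OF c])
  then have "kern d x t \<le> t * (?c powr ?a * (t' powr (1 / d) + norm x') powr - ?a)"
    unfolding kern_def using t by (intro mult_left_mono) auto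
  also have "\<dots> \<le> (2 * t') * (?c powr ?a * (t' powr (1 / d) + norm x') powr - ?a)"
    using t' by (intro mult_right_mono) auto
  finally show ?thesis by (simp add: kern_def algebra_simps)
qed

text \<open>The bases are compared through the decreasing power; \<open>r \<le> t\<close> takes care
  of the factor in front.\<close>

lemma kern_compare:
  fixes x y :: "'a::euclidean_space"
  assumes d: "d > 0" and r: "0 < r" "r \<le> t" and \<theta>: "\<theta> > 0"
    and le: "\<theta> * (t powr (1 / d) + norm x) \<le> r powr (1 / d) + norm y"
  shows "kern d y r \<le> \<theta> powr - (real DIM('a) + d) * kern d x t"
proof -
  let ?a = "real DIM('a) + d"
  have pos: "t powr (1 / d) + norm x > 0"
    using r by (simp add: add_pos_nonneg)
  have "(r powr (1 / d) + norm y) powr - ?a \<le> (\<theta> * (t powr (1 / d) + norm x)) powr - ?a"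
    using le pos \<theta> d by (intro powr_mono2') auto
  also have "\<dots> = \<theta> powr - ?a * (t powr (1 / d) + norm x) powr - ?a"
    using pos \<theta> by (simp add: powr_mult)
  finally have "kern d y r \<le> r * (\<theta> powr - ?a * (t powr (1 / d) + norm x) powr - ?a)"
    unfolding kern_def using r by (intro mult_left_mono) auto
  also have "\<dots> \<le> t * (\<theta> powr - ?a * (t powr (1 / d) + norm x) powr - ?a)"
    using r by (intro mult_right_mono) auto
  finally show ?thesis by (simp add: kern_def algebra_simps)
qed

abbreviation kern_conv :: "real \<Rightarrow> ('a::euclidean_space \<Rightarrow> ennreal) \<Rightarrow> 'a \<Rightarrow> real \<Rightarrow> ennreal" where
  "kern_conv d f x t \<equiv> \<integral>\<^sup>+y. ennreal (kern d (x - y) t) * f y \<partial>lborel"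

lemma kern_convolution_le:
  assumes d: "d > 0"
  obtains C where "C > 0"
    "\<And>(x::'a::euclidean_space) t s. 0 < s \<Longrightarrow> s < t \<Longrightarrow>
      kern_conv d (\<lambda>y. ennreal (kern d y s)) x (t - s) \<le> ennreal (C * kern d x t)"
proof
  let ?a = "real DIM('a) + d" and ?\<kappa> = "kern_mass d TYPE('a)"
  \<comment> \<open>The factor \<open>2 powr - (1 / d)\<close> pays for a time that is only half of
    \<open>t\<close>, the factor \<open>1 / 4\<close> for a distance that is only half of
    \<open>norm x\<close> together with \<open>t powr (1 / d) \<le> norm x\<close>.\<close>
  define \<theta> where "\<theta> = 2 powr - (1 / d) / 4"
  define c where "c = \<theta> powr - ?a"
  define C where "C = 2 * c * ?\<kappa> + 1"
  have \<kappa>: "?\<kappa> \<ge> 0" and c: "c \<ge> 0"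
    by (simp_all add: kern_mass_nonneg c_def)
  then show "C > 0" by (simp add: C_def add_nonneg_pos)
  fix x :: 'a and t s :: real
  assume s: "0 < s" "s < t"
  have \<theta>: "\<theta> > 0" "\<theta> \<le> 1 / 4"
    using powr_mono[of "- (1 / d)" 0 2] d by (simp_all add: \<theta>_def)
  have quarter: "(a + b) / 4 \<le> c" if "b \<le> 2 * c" "a \<le> b" for a b c :: real
    using that by simp
  have far: "kern d y r \<le> c * kern d x t"
    if "0 < r" "r \<le> t" "norm x \<le> 2 * norm y" "t powr (1 / d) \<le> norm x" for y :: 'a and r
    unfolding c_def
  proof (rule kern_compare[OF d that(1,2) \<theta>(1)])
    have "\<theta> * (t powr (1 / d) + norm x) \<le> (1 / 4) * (t powr (1 / d) + norm x)"
      using \<theta> by (intro mult_right_mono) auto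
    also have "\<dots> = (t powr (1 / d) + norm x) / 4" by simp
    also have "\<dots> \<le> norm y" using that(3,4) by (intro quarter)
    also have "\<dots> \<le> r powr (1 / d) + norm y" by simp
    finally show "\<theta> * (t powr (1 / d) + norm x) \<le> r powr (1 / d) + norm y" .
  qed
  have near: "kern d y r \<le> c * kern d x t"
    if "0 < r" "r \<le> t" "t \<le> 2 * r" "norm x \<le> t powr (1 / d)" for y :: 'a and r
    unfolding c_def
  proof (rule kern_compare[OF d that(1,2) \<theta>(1)])
    have "t powr (1 / d) \<le> (2 * r) powr (1 / d)" using that d by (intro powr_mono2) auto
    then have "2 powr - (1 / d) * t powr (1 / d) \<le> r powr (1 / d)"
      using that by (simp add: powr_mult powr_minus field_simps)
    moreover have "\<theta> * norm x \<le> \<theta> * t powr (1 / d)"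
      using that \<theta> by (intro mult_left_mono) auto
    ultimately show "\<theta> * (t powr (1 / d) + norm x) \<le> r powr (1 / d) + norm y"
      using powr_ge_zero[of r "1 / d"] norm_ge_zero[of y] unfolding \<theta>_def distrib_left times_divide_eq_left
      by linarith
  qed
  \<comment> \<open>one of \<open>y\<close>, \<open>x - y\<close> carries half of the distance, and one of \<open>s\<close>, \<open>t - s\<close> half of the time\<close>
  have "kern d (x - y) (t - s) \<le> c * kern d x t \<or> kern d y s \<le> c * kern d x t" for y
  proof (cases "norm x \<le> t powr (1 / d)")
    case True
    then show ?thesis using near[of s y] near[of "t - s" "x - y"] s by force
  next
    case False
    have "norm x \<le> norm y + norm (x - y)" by norm
    then show ?thesis using far[of s y] far[of "t - s" "x - y"] s False by force
  qed
  \<comment> \<open>If one of two nonnegative factors is at most M, their product is at most M times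
    their sum; the sum integrates to twice the mass.\<close>
  then have "kern d (x - y) (t - s) * kern d y s \<le> c * kern d x t * (kern d (x - y) (t - s) + kern d y s)" for y
    using s c by (smt (verit, best) kern_nonneg mult.commute mult_left_mono mult_nonneg_nonneg distrib_left)
  then have "kern_conv d (\<lambda>y. ennreal (kern d y s)) x (t - s)
      \<le> (\<integral>\<^sup>+y. ennreal (c * kern d x t) * (ennreal (kern d (x - y) (t - s)) + ennreal (kern d y s)) \<partial>lborel)"
    using s c by (intro nn_integral_mono)
      (simp add: ennreal_mult'[symmetric] ennreal_plus[symmetric] kern_nonneg ennreal_leI del: ennreal_plus)
  also have "\<dots> = ennreal (c * kern d x t) * (ennreal ?\<kappa> + ennreal ?\<kappa>)"
    using s d by (simp add: nn_integral_cmult nn_integral_add nn_integral_kern_diff nn_integral_kern)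
  also have "\<dots> = ennreal (2 * c * ?\<kappa> * kern d x t)"
    using s c \<kappa> by (simp add: ennreal_mult'[symmetric] ennreal_plus[symmetric] kern_nonneg del: ennreal_plus)
  also have "\<dots> \<le> ennreal (C * kern d x t)"
    using s by (intro ennreal_leI mult_right_mono) (auto simp: C_def kern_nonneg)
  finally show "kern_conv d (\<lambda>y. ennreal (kern d y s)) x (t - s) \<le> ennreal (C * kern d x t)" .
qed

text \<open>By Harnack's inequality the kernel is dominated by its own averages over balls of radius
  \<open>t\<^sup>1\<^sup>/\<^sup>d\<close>; then Tonelli's theorem applies.\<close>

lemma kern_average_le:
  assumes d: "d > 0"
  obtains C where "C > 0"
    "\<And>(f :: 'a::euclidean_space \<Rightarrow> ennreal) x t B. f \<in> borel_measurable borel \<Longrightarrow> t > 0 \<Longrightarrow>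
      (\<And>z. (\<integral>\<^sup>+y\<in>ball z (t powr (1 / d)). f y \<partial>lborel) / emeasure lborel (ball z (t powr (1 / d))) \<le> B) \<Longrightarrow>
      kern_conv d f x t \<le> ennreal C * B"
proof
  let ?a = "real DIM('a) + d" and ?\<kappa> = "kern_mass d TYPE('a)"
  define c where "c = 2 * (2 powr (1 / d) + 1) powr ?a"
  have "2 powr (1 / d) + 1 > 0" by (simp add: add_nonneg_pos)
  then have c: "c > 0" by (simp add: c_def)
  show "c * ?\<kappa> + 1 > 0" using c kern_mass_nonneg[of d, where 'a='a] by (simp add: add_nonneg_pos)
  fix f :: "'a \<Rightarrow> ennreal" and x t B
  assume [measurable]: "f \<in> borel_measurable borel" and t: "t > 0"
    and B: "\<And>z. (\<integral>\<^sup>+y\<in>ball z (t powr (1 / d)). f y \<partial>lborel) / emeasure lborel (ball z (t powr (1 / d))) \<le> B"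
  let ?r = "t powr (1 / d)"
  define v where "v = emeasure lborel (ball (0::'a) ?r)"
  have v: "emeasure lborel (ball z ?r) = v" for z :: 'a
    using t by (simp add: v_def emeasure_ball)
  have v0: "v \<noteq> 0" "v \<noteq> \<infinity>"
    using t less_imp_neq[OF unit_ball_vol_pos[of "real DIM('a)"]] by (simp_all add: v_def emeasure_ball)
  \<comment> \<open>The relation of being closer than the radius, as one measurable set of pairs:
    its sections in either variable are balls, which is what the exchange of integrals
    needs.\<close>
  define D where "D = {p :: 'a \<times> 'a. dist (fst p) (snd p) < ?r}"
  have [measurable]: "D \<in> sets (borel \<Otimes>\<^sub>M borel)"
    unfolding D_def borel_prod by (intro borel_open open_Collect_less continuous_intros)
  have D: "indicator (ball z ?r) y = (indicator D (z, y) :: ennreal)" for z y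
    by (auto simp: D_def indicator_def)
  have "v * kern_conv d f x t
     = (\<integral>\<^sup>+y. (\<integral>\<^sup>+z. ennreal (kern d (x - y) t) * f y * indicator D (z, y) \<partial>lborel) \<partial>lborel)"
  proof -
    have "(\<integral>\<^sup>+z. indicator D (z, y) \<partial>lborel) = v" for y :: 'a
    proof -
      have "(\<integral>\<^sup>+z. indicator D (z, y) \<partial>lborel) = (\<integral>\<^sup>+z. indicator (ball y ?r) z \<partial>lborel)"
        by (intro nn_integral_cong) (auto simp: indicator_def D_def dist_commute)
      then show ?thesis using v[of y] by simp
    qed
    then have "(\<integral>\<^sup>+z. c * indicator D (z, y) \<partial>lborel) = c * v" for c and y :: 'a
      by (subst nn_integral_cmult) auto
    then show ?thesis
      by (subst nn_integral_cmult[symmetric]) (simp_all add: mult.commute[of v])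
  qed
  also have "\<dots> \<le> (\<integral>\<^sup>+y. (\<integral>\<^sup>+z. ennreal (c * kern d (x - z) t) * (f y * indicator D (z, y)) \<partial>lborel) \<partial>lborel)"
    using kern_harnack[OF d t, of t "x - y" "x - z" for y z] t unfolding c_def
    by (intro nn_integral_mono) (auto simp: indicator_def D_def dist_norm mult.assoc[symmetric] intro!: mult_right_mono ennreal_leI)
  also have "\<dots> = (\<integral>\<^sup>+z. (\<integral>\<^sup>+y. ennreal (c * kern d (x - z) t) * (f y * indicator D (z, y)) \<partial>lborel) \<partial>lborel)"
    by (rule lborel_pair.Fubini') measurable
  also have "\<dots> = (\<integral>\<^sup>+z. ennreal (c * kern d (x - z) t) * (\<integral>\<^sup>+y\<in>ball z ?r. f y \<partial>lborel) \<partial>lborel)"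
    by (simp add: nn_integral_cmult D)
  also have "\<dots> \<le> (\<integral>\<^sup>+z. ennreal (c * kern d (x - z) t) * (B * v) \<partial>lborel)"
  proof (intro nn_integral_mono mult_left_mono)
    fix z :: 'a
    show "(\<integral>\<^sup>+y\<in>ball z ?r. f y \<partial>lborel) \<le> B * v"
    proof -
      have "(\<integral>\<^sup>+y\<in>ball z ?r. f y \<partial>lborel) = (\<integral>\<^sup>+y\<in>ball z ?r. f y \<partial>lborel) / v * v"
        using v0 ennreal_divide_self[of v] by (simp add: ennreal_divide_times top.not_eq_extremum)
      also have "\<dots> \<le> B * v"
        using B[of z] unfolding v by (rule mult_right_mono) simp
      finally show ?thesis .
    qed
  qed simp
  also have "\<dots> = v * (ennreal (c * ?\<kappa>) * B)"
    using c d t by (simp add: ennreal_mult' kern_nonneg nn_integral_multc nn_integral_cmult nn_integral_kern_diff)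
      (simp add: algebra_simps)
  finally have "kern_conv d f x t \<le> ennreal (c * ?\<kappa>) * B"
    using v0 by (simp add: ennreal_mult_le_mult_iff)
  also have "\<dots> \<le> ennreal (c * ?\<kappa> + 1) * B"
    by (intro mult_right_mono ennreal_leI) auto
  finally show "kern_conv d f x t \<le> ennreal (c * ?\<kappa> + 1) * B" .
qed

section \<open>Decay of the fundamental solution\<close>

lemma norm_exp_minus_one_le:
  fixes z :: complex
  assumes "Re z \<le> 0"
  shows "norm (exp z - 1) \<le> norm z"
proof -
  \<comment> \<open>On the left half-plane, a convex set, the derivative of \<open>exp\<close> has
    modulus at most 1.\<close>
  have "norm (exp z - exp 0) \<le> 1 * norm (z - 0)"
  proof (rule field_differentiable_bound)
    show "convex {z. Re z \<le> 0}" by (rule convex_halfspace_Re_le)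
    show "(exp has_field_derivative exp w) (at w within {z. Re z \<le> 0})" for w :: complex
      by (auto intro: DERIV_exp has_field_derivative_at_within)
  qed (use assms in auto)
  then show ?thesis by simp
qed

text \<open>Polymorphic so that the same operator acts with step \<open>h\<close> in space and with
  step 1 on the complex plane.\<close>

definition fwd_diff :: "'a::ab_group_add \<Rightarrow> ('a \<Rightarrow> 'b::ab_group_add) \<Rightarrow> 'a \<Rightarrow> 'b" where
  "fwd_diff h f x = f (x + h) - f x"

lemma fwd_diff_Suc: "(fwd_diff h ^^ Suc m) f x = (fwd_diff h ^^ m) f (x + h) - (fwd_diff h ^^ m) f x"
  unfolding funpow.simps o_apply by (rule fwd_diff_def)

lemma norm_fwd_diff_le:
  fixes f :: "'a::real_vector \<Rightarrow> 'b::real_normed_vector"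
  assumes "\<And>j. j \<le> m \<Longrightarrow> norm (f (x + real j *\<^sub>R h)) \<le> B"
  shows "norm ((fwd_diff h ^^ m) f x) \<le> 2 ^ m * B"
  using assms
proof (induction m arbitrary: x)
  case 0
  then show ?case using 0[of 0] by simp
next
  case (Suc m)
  have "norm ((fwd_diff h ^^ m) f (x + h)) \<le> 2 ^ m * B"
  proof (rule Suc.IH)
    show "norm (f (x + h + real j *\<^sub>R h)) \<le> B" if "j \<le> m" for j
      using Suc.prems[of "Suc j"] that by (simp add: algebra_simps)
  qed
  moreover have "norm ((fwd_diff h ^^ m) f x) \<le> 2 ^ m * B"
    using Suc by simp
  moreover have "norm ((fwd_diff h ^^ m) f (x + h) - (fwd_diff h ^^ m) f x)
      \<le> norm ((fwd_diff h ^^ m) f (x + h)) + norm ((fwd_diff h ^^ m) f x)"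
    by (rule norm_triangle_ineq4)
  ultimately show ?case unfolding fwd_diff_Suc by simp
qed

text \<open>This permits replacing the exponential by
  \<open>exp (- t * norm \<xi> powr d) - 1\<close>, of size at most
  \<open>t * norm \<xi> powr d\<close>; the factor \<open>t\<close> of the kernel bound originates
  here.\<close>

lemma fwd_diff_add_const:
  fixes f :: "'a::ab_group_add \<Rightarrow> 'b::ab_group_add"
  assumes "m > 0"
  shows "(fwd_diff h ^^ m) (\<lambda>x. f x + c) = (fwd_diff h ^^ m) f"
proof -
  obtain k where "m = Suc k" using assms by (cases m) auto
  then show ?thesis
    by (simp only: funpow_Suc_right o_apply) (auto simp: fwd_diff_def[abs_def])
qed

text \<open>A difference with step 1 is at most the supremum of the derivative, and Cauchy's
  inequality on circles of radius \<rho> gains a factor 1/\<rho>. Each difference costs \<rho> of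
  the disc for these circles and, as \<rho> \<ge> 1, at most another \<rho> for the step
  itself.\<close>

lemma fwd_diff_holomorphic_bound:
  fixes f :: "complex \<Rightarrow> complex"
  assumes f: "f holomorphic_on ball 0 R" and B: "\<And>z. z \<in> ball 0 R \<Longrightarrow> norm (f z) \<le> B"
    and \<rho>: "\<rho> \<ge> 1"
  shows "(fwd_diff 1 ^^ m) f holomorphic_on ball 0 (R - 2 * real m * \<rho>)
    \<and> (\<forall>z\<in>ball 0 (R - 2 * real m * \<rho>). norm ((fwd_diff 1 ^^ m) f z) \<le> B / \<rho> ^ m)"
proof (induction m)
  case 0
  then show ?case using f B by simp
next
  case (Suc m)
  define g where "g = (fwd_diff 1 ^^ m) f"
  define S where "S = R - 2 * real m * \<rho>"
  have g: "g holomorphic_on ball 0 S" and gB: "\<And>z. z \<in> ball 0 S \<Longrightarrow> norm (g z) \<le> B / \<rho> ^ m"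
    using Suc by (auto simp: g_def S_def)
  have S': "R - 2 * real (Suc m) * \<rho> = S - 2 * \<rho>"
    by (simp add: S_def algebra_simps)
  have "(fwd_diff 1 ^^ Suc m) f = (\<lambda>z. g (z + 1) - g z)"
    unfolding g_def by (rule ext) (rule fwd_diff_Suc)
  moreover have "(\<lambda>z. g (z + 1) - g z) holomorphic_on ball 0 (S - 2 * \<rho>)"
  proof (intro holomorphic_on_diff)
    have "norm (z + 1) < S" if "norm z < S - 2 * \<rho>" for z :: complex
      using that \<rho> norm_triangle_ineq[of z 1] by simp
    then show "(\<lambda>z. g (z + 1)) holomorphic_on ball 0 (S - 2 * \<rho>)"
      by (intro holomorphic_on_compose_gen[of "\<lambda>z. z + 1" _ g "ball 0 S", unfolded o_def] g holomorphic_intros)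
        auto
    show "g holomorphic_on ball 0 (S - 2 * \<rho>)"
      by (rule holomorphic_on_subset[OF g]) (use \<rho> in auto)
  qed
  moreover have "norm (g (z + 1) - g z) \<le> B / \<rho> ^ Suc m" if z: "z \<in> ball 0 (S - 2 * \<rho>)" for z
  proof -
    have "norm (g (z + 1) - g z) \<le> (B / \<rho> ^ m / \<rho>) * norm (z + 1 - z)"
    proof (rule field_differentiable_bound[of "ball 0 (S - \<rho>)"])
      show "z + 1 \<in> ball 0 (S - \<rho>)" "z \<in> ball 0 (S - \<rho>)"
        using z \<rho> norm_triangle_ineq[of z 1] by auto
      fix w :: complex
      assume w: "w \<in> ball 0 (S - \<rho>)"
      have "w \<in> ball 0 S" using w \<rho> by auto
      then show "(g has_field_derivative deriv g w) (at w within ball 0 (S - \<rho>))"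
        using g by (metis DERIV_subset holomorphic_derivI open_ball subset_UNIV)
      have sub: "cball w \<rho> \<subseteq> ball 0 S"
      proof
        fix u assume "u \<in> cball w \<rho>"
        then show "u \<in> ball 0 S"
          using w norm_triangle_ineq[of w "u - w"] by (auto simp: dist_norm norm_minus_commute)
      qed
      have "norm ((deriv ^^ 1) g w) \<le> fact 1 * (B / \<rho> ^ m) / \<rho> ^ 1"
      proof (rule Cauchy_inequality)
        show "continuous_on (cball w \<rho>) g"
          by (rule holomorphic_on_imp_continuous_on[OF holomorphic_on_subset[OF g sub]])
        show "g holomorphic_on ball w \<rho>"
          by (rule holomorphic_on_subset[OF g]) (use sub in auto)
        show "norm (g u) \<le> B / \<rho> ^ m" if "norm (w - u) = \<rho>" for u
          using sub that by (intro gB) (auto simp: dist_norm)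
      qed (use \<rho> in auto)
      then show "norm (deriv g w) \<le> B / \<rho> ^ m / \<rho>" by simp
    qed (simp)
    then show ?thesis by (simp add: field_simps)
  qed
  ultimately show ?case unfolding S' by auto
qed

text \<open>A difference of order \<open>m\<close> at 0 sees only the values at 0, ..., m, so
  agreement at these integers carries a bound for the holomorphic function over to the real
  one.\<close>

lemma fwd_diff_line:
  fixes f :: "'a::real_vector \<Rightarrow> real" and g :: "complex \<Rightarrow> complex"
  assumes "\<And>j. j \<le> m \<Longrightarrow> g (of_nat j) = complex_of_real (f (x + real j *\<^sub>R h))"
  shows "(fwd_diff 1 ^^ m) g 0 = complex_of_real ((fwd_diff h ^^ m) f x)"
proof -
  have "(fwd_diff 1 ^^ k) g (of_nat j) = complex_of_real ((fwd_diff h ^^ k) f (x + real j *\<^sub>R h))"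
    if "j + k \<le> m" for j k
    using that
  proof (induction k arbitrary: j)
    case 0
    then show ?case using assms[of j] by simp
  next
    case (Suc k)
    have "(fwd_diff 1 ^^ k) g (of_nat (Suc j)) = complex_of_real ((fwd_diff h ^^ k) f (x + real (Suc j) *\<^sub>R h))"
      by (rule Suc.IH) (use Suc.prems in simp)
    moreover have "(fwd_diff 1 ^^ k) g (of_nat j) = complex_of_real ((fwd_diff h ^^ k) f (x + real j *\<^sub>R h))"
      by (rule Suc.IH) (use Suc.prems in simp)
    ultimately show ?case
      unfolding fwd_diff_Suc by (simp add: algebra_simps)
  qed
  from this[of 0 m] show ?thesis by simp
qed

text \<open>Away from the origin \<open>s \<mapsto> exp (- t \<bar>\<xi> + s h\<bar>\<^sup>d)\<close> extends holomorphically to a complex disc of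
  radius comparable to \<open>\<bar>\<xi>\<bar> / \<bar>h\<bar>\<close>, and iterated differences are controlled by Cauchy's
  inequality.\<close>

lemma fwd_diff_exp_powr_far:
  fixes \<xi> h :: "'a::euclidean_space"
  assumes d: "d > 0" and t: "t > 0" and h: "h \<noteq> 0" and m: "m > 0"
  defines "L \<equiv> (2 * real m + 1) * (3 * d + 6)"
  assumes far: "L * norm h \<le> norm \<xi>"
  shows "\<bar>(fwd_diff h ^^ m) (\<lambda>\<xi>. exp (- t * norm \<xi> powr d)) \<xi>\<bar>
     \<le> 3 * t * norm \<xi> powr d * (L * norm h / norm \<xi>) ^ m"
proof -
  define f where "f = (\<lambda>\<xi>::'a. exp (- t * norm \<xi> powr d) - 1)"
  \<comment> \<open>On the disc of radius \<open>R\<close> one gets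
    \<open>norm (w z) \<le> 1 / (d + 2)\<close>. This is below 1/2, so that the principal logarithm
    of \<open>1 + w z\<close> exists and has modulus at most \<open>2 * norm (w z)\<close>, and
    small enough for \<open>(d / 2) * Ln (1 + w z)\<close> to have modulus at most 1.\<close>
  define R where "R = norm \<xi> / norm h / (3 * d + 6)"
  \<comment> \<open>The \<open>m\<close> differences shrink the disc by \<open>2 * \<rho>\<close>
    each; the remaining radius \<open>\<rho>\<close> keeps 0 inside. The assumption
    \<open>far\<close> says precisely that \<open>\<rho> \<ge> 1\<close>.\<close>
  define \<rho> where "\<rho> = R / (2 * real m + 1)"
  have L: "L > 0" using d by (simp add: L_def add_pos_pos)
  have \<xi>: "norm \<xi> > 0" using far L h by (smt (verit) mult_pos_pos zero_less_norm_iff)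
  have nh: "norm h > 0" using h by simp
  have \<rho>L: "\<rho> = norm \<xi> / (L * norm h)"
    by (simp add: \<rho>_def R_def L_def mult.commute)
  have \<rho>: "\<rho> \<ge> 1"
    unfolding \<rho>L using far L nh by (subst le_divide_eq_1_pos) auto
  have R: "R = (2 * real m + 1) * \<rho>" by (simp add: \<rho>_def)
  \<comment> \<open>For real z the square of \<open>norm (\<xi> + z *\<^sub>R h)\<close> is the
    square of \<open>norm \<xi>\<close> times 1 + w(z). Hence \<open>g\<close> continues the
    exponential minus 1 along the line, the power being taken through the principal
    logarithm.\<close>
  define w where "w z = (2 * z * of_real (\<xi> \<bullet> h) + z\<^sup>2 * of_real ((norm h)\<^sup>2)) / of_real ((norm \<xi>)\<^sup>2)" for z :: complex
  define g where "g z = exp (- of_real (t * norm \<xi> powr d) * exp (of_real (d / 2) * Ln (1 + w z))) - 1" for z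
  have w: "norm (w z) \<le> 3 / (3 * d + 6)" if "z \<in> ball 0 R" for z
  proof -
    define q where "q = norm z * norm h / norm \<xi>"
    have "q \<le> R * norm h / norm \<xi>"
      unfolding q_def using that by (intro divide_right_mono mult_right_mono) auto
    also have "\<dots> = 1 / (3 * d + 6)"
      using \<xi> nh by (simp add: R_def)
    finally have q: "0 \<le> q" "q \<le> 1 / (3 * d + 6)"
      by (auto simp: q_def)
    have "q * q \<le> 1 * q" using q d by (intro mult_right_mono order_trans[OF q(2)]) auto
    have "norm (2 * z * of_real (\<xi> \<bullet> h) + z\<^sup>2 * of_real ((norm h)\<^sup>2))
      \<le> 2 * norm z * \<bar>\<xi> \<bullet> h\<bar> + (norm z)\<^sup>2 * (norm h)\<^sup>2"
      by (rule order_trans[OF norm_triangle_ineq]) (simp add: norm_mult norm_power)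
    also have "\<dots> \<le> 2 * norm z * (norm \<xi> * norm h) + (norm z)\<^sup>2 * (norm h)\<^sup>2"
      by (intro add_mono mult_left_mono Cauchy_Schwarz_ineq2) auto
    also have "\<dots> = (2 * q + q * q) * (norm \<xi>)\<^sup>2"
      using \<xi> by (simp add: q_def field_simps power2_eq_square)
    also have "\<dots> \<le> (3 * q) * (norm \<xi>)\<^sup>2"
      using \<open>q * q \<le> 1 * q\<close> by (intro mult_right_mono) auto
    finally have "norm (w z) \<le> 3 * q"
      using \<xi> by (simp add: w_def norm_divide norm_power field_simps)
    then show ?thesis using q by simp
  qed
  have w12: "norm (w z) < 1 / 2" if "z \<in> ball 0 R" for z
    by (rule order.strict_trans1[OF w[OF that]]) (use d in \<open>simp add: field_simps\<close>)
  have nonpos: "1 + w z \<notin> \<real>\<^sub>\<le>\<^sub>0" if "z \<in> ball 0 R" for z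
  proof -
    have "Re (1 + w z) > 0" using w12[OF that] abs_Re_le_cmod[of "w z"] by simp
    then show ?thesis by (auto simp: complex_nonpos_Reals_iff)
  qed
  have hol: "g holomorphic_on ball 0 R"
    unfolding g_def w_def using nonpos \<xi> unfolding w_def by (intro holomorphic_intros) auto
  have B: "norm (g z) \<le> 3 * t * norm \<xi> powr d" if z: "z \<in> ball 0 R" for z
  proof -
    define v where "v = of_real (d / 2) * Ln (1 + w z)"
    have "norm v \<le> (d / 2) * (2 * norm (w z))"
      unfolding v_def norm_mult using norm_Ln_le[OF w12[OF z]] d by (intro mult_mono) auto
    also have "\<dots> \<le> d * (3 / (3 * d + 6))" using mult_left_mono[OF w[OF z], of d] d by simp
    also have "\<dots> \<le> 1" using d by (simp add: field_simps)
    finally have v: "norm v \<le> 1" .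
    \<comment> \<open>Modulus at most 1, below \<pi>/2, keeps \<open>exp v\<close> in the right
      half-plane, so the argument of the outer exponential lies in the left one.\<close>
    have "cos (Im v) \<ge> 0"
      using abs_Im_le_cmod[of v] v pi_gt3 by (intro cos_ge_zero) linarith+
    then have "Re (exp v) \<ge> 0" by (simp add: Re_exp)
    then have "norm (g z) \<le> norm (- of_real (t * norm \<xi> powr d) * exp v)"
      unfolding g_def v_def[symmetric] using t by (intro norm_exp_minus_one_le) simp
    also have "\<dots> = t * norm \<xi> powr d * exp (Re v)"
      using t by (simp add: norm_mult abs_mult)
    also have "exp (Re v) \<le> exp 1" using complex_Re_le_cmod[of v] v by simp
    also have "exp 1 \<le> (3::real)" using exp_le by simp
    finally show ?thesis using t by (simp add: mult_ac mult_right_mono)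
  qed
  have "norm ((fwd_diff 1 ^^ m) g 0) \<le> 3 * t * norm \<xi> powr d / \<rho> ^ m"
    using fwd_diff_holomorphic_bound[OF hol B \<rho>, of m] \<rho> by (auto simp: R algebra_simps)
  also have "(fwd_diff 1 ^^ m) g 0 = complex_of_real ((fwd_diff h ^^ m) f \<xi>)"
  proof (rule fwd_diff_line)
    fix j assume "j \<le> m"
    then have "real j < (2 * real m + 1) * 1" by simp
    also have "\<dots> \<le> R" unfolding R by (intro mult_left_mono \<rho>) simp
    finally have "real j < R" .
    then have jR: "(of_nat j :: complex) \<in> ball 0 R" by simp
    define y where "y = (norm (\<xi> + real j *\<^sub>R h))\<^sup>2 / (norm \<xi>)\<^sup>2"
    have wy: "1 + w (of_nat j) = of_real y"
    proof -
      have "(norm (\<xi> + real j *\<^sub>R h))\<^sup>2 = (norm \<xi>)\<^sup>2 + (2 * real j * (\<xi> \<bullet> h) + (real j)\<^sup>2 * (norm h)\<^sup>2)"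
        unfolding power2_norm_eq_inner
        by (simp add: inner_add_left inner_add_right inner_commute power2_eq_square algebra_simps)
      then have "y = 1 + (2 * real j * (\<xi> \<bullet> h) + (real j)\<^sup>2 * (norm h)\<^sup>2) / (norm \<xi>)\<^sup>2"
        using \<xi> by (simp add: y_def add_divide_distrib)
      then show ?thesis by (simp add: w_def)
    qed
    have "y \<ge> 0" by (simp add: y_def)
    moreover have "y \<noteq> 0" using nonpos[OF jR] unfolding wy by auto
    ultimately have y: "y > 0" by simp
    have pos: "norm (\<xi> + real j *\<^sub>R h) > 0" using y unfolding y_def by (auto simp: zero_less_divide_iff)
    have "exp (d / 2 * ln y) = (norm (\<xi> + real j *\<^sub>R h) / norm \<xi>) powr d"
    proof -
      have "ln y = 2 * ln (norm (\<xi> + real j *\<^sub>R h) / norm \<xi>)"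
        using pos \<xi> unfolding y_def power_divide[symmetric] by (subst ln_realpow) auto
      then show ?thesis using pos \<xi> by (simp add: powr_def)
    qed
    then have "norm \<xi> powr d * exp (d / 2 * ln y) = norm (\<xi> + real j *\<^sub>R h) powr d"
      using pos \<xi> by (simp add: powr_divide)
    then have eq: "t * norm \<xi> powr d * exp (d / 2 * ln y) = t * norm (\<xi> + real j *\<^sub>R h) powr d"
      by simp
    have "g (of_nat j) = of_real (exp (- (t * norm \<xi> powr d * exp (d / 2 * ln y))) - 1)"
      unfolding g_def wy Ln_of_real[OF y] by (simp only: of_real_mult[symmetric] exp_of_real of_real_minus[symmetric] mult_minus_left of_real_diff of_real_1)
    then show "g (of_nat j) = complex_of_real (f (\<xi> + real j *\<^sub>R h))"
      unfolding eq by (simp add: f_def)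
  qed
  finally have "\<bar>(fwd_diff h ^^ m) f \<xi>\<bar> \<le> 3 * t * norm \<xi> powr d / \<rho> ^ m" by simp
  also have "(fwd_diff h ^^ m) f = (fwd_diff h ^^ m) (\<lambda>\<xi>. exp (- t * norm \<xi> powr d))"
    using fwd_diff_add_const[OF m, of h "\<lambda>\<xi>. exp (- t * norm \<xi> powr d)" "-1"] by (simp add: f_def)
  also have "3 * t * norm \<xi> powr d / \<rho> ^ m = 3 * t * norm \<xi> powr d * (L * norm h / norm \<xi>) ^ m"
    by (simp add: \<rho>L power_divide)
  finally show ?thesis .
qed

section \<open>Integral bounds for the symbol and its differences\<close>

lemma exp_powr_le_decay:
  fixes a d :: real
  assumes d: "d > 0" and a: "a > 0"
  obtains C where "C > 0" "\<And>y. y \<ge> 0 \<Longrightarrow> exp (- (y powr d)) \<le> C * (1 + y) powr - a"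
proof -
  \<comment> \<open>A single term of the exponential series, of degree \<open>k\<close> in
    \<open>y powr d\<close>, outgrows \<open>y powr a\<close>.\<close>
  obtain k :: nat where k: "a / d \<le> real k" using real_arch_simple by blast
  then have kd: "a \<le> d * real k" using d by (simp add: field_simps)
  define C where "C = 2 powr a * fact k"
  have "exp (- (y powr d)) \<le> C * (1 + y) powr - a" if y: "y \<ge> 0" for y
  proof -
    have "(1 + y) powr a \<le> C * exp (y powr d)"
    proof (cases "y \<le> 1")
      case True
      have "(1 + y) powr a \<le> 2 powr a" using True y a by (intro powr_mono2) auto
      also have "\<dots> \<le> C" unfolding C_def by (simp add: fact_ge_1)
      also have "\<dots> \<le> C * exp (y powr d)" by (simp add: C_def)
      finally show ?thesis .
    next
      case False
      have "(1 + y) powr a \<le> (2 * y) powr a" using False a by (intro powr_mono2) auto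
      also have "\<dots> = 2 powr a * y powr a" using False by (simp add: powr_mult)
      also have "\<dots> \<le> 2 powr a * (fact k * exp (y powr d))"
      proof (rule mult_left_mono)
        have "y powr a \<le> y powr (d * real k)" using False kd by (intro powr_mono) auto
        also have "\<dots> = (y powr d) ^ k" using False by (simp add: powr_powr[symmetric] powr_realpow)
        also have "\<dots> \<le> fact k * exp (y powr d)"
        proof -
          have "(y powr d) ^ k /\<^sub>R fact k \<le> exp (y powr d)"
            using sum_le_suminf[OF summable_exp_generic[of "y powr d"], of "{k}"] by (simp add: exp_def)
          then show ?thesis by (simp add: field_simps)
        qed
        finally show "y powr a \<le> fact k * exp (y powr d)" .
      qed simp
      finally show ?thesis by (simp add: C_def)
    qed
    then show ?thesis using y by (simp add: exp_minus powr_minus field_simps)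
  qed
  moreover have "C > 0" by (simp add: C_def)
  ultimately show ?thesis using that by blast
qed

text \<open>Domination by \<open>kern\<close> at time 1, evaluated at
  \<open>t powr (1 / d) *\<^sub>R \<xi>\<close>, reduces the integral to the known mass; the
  substitution produces the power of \<open>t\<close>. The 1 added to the constant makes it
  positive, since \<open>kern_mass\<close> is only known to be nonnegative.\<close>

lemma nn_integral_exp_powr_le:
  assumes d: "d > 0"
  obtains C where "C > 0" "\<And>t. t > 0 \<Longrightarrow>
    (\<integral>\<^sup>+\<xi>. ennreal (exp (- t * norm (\<xi> :: 'a::euclidean_space) powr d)) \<partial>lborel)
      \<le> ennreal (C * t powr (- real DIM('a) / d))"
proof -
  let ?a = "real DIM('a) + d"
  obtain C where C: "C > 0" "\<And>y. y \<ge> 0 \<Longrightarrow> exp (- (y powr d)) \<le> C * (1 + y) powr - ?a"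
    using exp_powr_le_decay[OF d, of ?a] d by (metis add_nonneg_pos of_nat_0_le_iff)
  have "(\<integral>\<^sup>+\<xi>. ennreal (exp (- t * norm (\<xi> :: 'a) powr d)) \<partial>lborel)
      \<le> ennreal ((C * kern_mass d TYPE('a) + 1) * t powr (- real DIM('a) / d))" if t: "t > 0" for t
  proof -
    have "exp (- t * norm \<xi> powr d) \<le> C * kern d (t powr (1 / d) *\<^sub>R \<xi>) 1" for \<xi> :: 'a
    proof -
      have "exp (- ((t powr (1 / d) * norm \<xi>) powr d)) \<le> C * (1 + t powr (1 / d) * norm \<xi>) powr - ?a"
        by (intro C) auto
      then show ?thesis using t d by (simp add: powr_mult powr_powr kern_def)
    qed
    then have "(\<integral>\<^sup>+\<xi>. ennreal (exp (- t * norm (\<xi> :: 'a) powr d)) \<partial>lborel)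
       \<le> (\<integral>\<^sup>+\<xi>. ennreal C * ennreal (kern d (t powr (1 / d) *\<^sub>R (\<xi> :: 'a)) 1) \<partial>lborel)"
      using C by (intro nn_integral_mono) (simp add: ennreal_mult'[symmetric] ennreal_leI)
    also have "\<dots> = ennreal C * (\<integral>\<^sup>+\<xi>. ennreal (kern d (t powr (1 / d) *\<^sub>R (\<xi> :: 'a)) 1) \<partial>lborel)"
      by (simp add: nn_integral_cmult)
    also have "(\<integral>\<^sup>+\<xi>. ennreal (kern d (t powr (1 / d) *\<^sub>R (\<xi> :: 'a)) 1) \<partial>lborel)
       = ennreal (t powr (- real DIM('a) / d)) * ennreal (kern_mass d TYPE('a))"
    proof -
      have "(t powr - (1 / d)) ^ DIM('a) = t powr (- real DIM('a) / d)"
        using t by (subst powr_realpow[symmetric]) (simp_all add: powr_powr)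
      moreover have "t powr (1 / d) * t powr - (1 / d) = 1"
        using t by (simp add: powr_add[symmetric])
      ultimately show ?thesis
        using nn_integral_lborel_affine[of "\<lambda>\<xi>::'a. ennreal (kern d (t powr (1 / d) *\<^sub>R \<xi>) 1)" "t powr - (1 / d)" 0]
          nn_integral_kern[OF d, of 1, where 'a='a] t by simp
    qed
    also have "ennreal C * (ennreal (t powr (- real DIM('a) / d)) * ennreal (kern_mass d TYPE('a)))
       = ennreal (C * kern_mass d TYPE('a) * t powr (- real DIM('a) / d))"
      using C kern_mass_nonneg[of d, where 'a='a] by (simp add: ennreal_mult'[symmetric] mult_ac)
    also have "\<dots> \<le> ennreal ((C * kern_mass d TYPE('a) + 1) * t powr (- real DIM('a) / d))"
      by (intro ennreal_leI mult_right_mono) auto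
    finally show ?thesis .
  qed
  moreover have "C * kern_mass d TYPE('a) + 1 > 0"
    using C kern_mass_nonneg[of d, where 'a='a] by (simp add: add_nonneg_pos)
  ultimately show ?thesis using that by blast
qed

lemma integrable_exp_powr:
  assumes "d > 0" "t > 0"
  shows "integrable lborel (\<lambda>\<xi>::'a::euclidean_space. exp (- t * norm \<xi> powr d))"
proof (rule integrableI_bounded)
  obtain C where "(\<integral>\<^sup>+\<xi>. ennreal (exp (- t * norm (\<xi> :: 'a) powr d)) \<partial>lborel) \<le> ennreal (C * t powr (- real DIM('a) / d))"
    using nn_integral_exp_powr_le[OF assms(1), where 'a='a] assms(2) by metis
  then show "(\<integral>\<^sup>+\<xi>. ennreal (norm (exp (- t * norm (\<xi> :: 'a) powr d))) \<partial>lborel) < \<infinity>"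
    by (simp add: order.strict_trans1[OF _ ennreal_less_top])
qed simp

text \<open>Two regimes. For |\<xi>| \<ge> L |h| Cauchy's inequality gives (|h| / |\<xi>|)^m against
  |\<xi>|^d. For smaller \<xi> the points of the difference may come near the origin, where the
  symbol need not be smooth; there each value of the exponential minus 1 is at most a multiple of t
  |h|^d, and the decay factor is bounded below.\<close>

lemma fwd_diff_exp_powr_le:
  assumes d: "d > 0" and m: "real m > d"
  obtains C where "C > 0" "\<And>t (\<xi> :: 'a::euclidean_space) h. t > 0 \<Longrightarrow> h \<noteq> 0 \<Longrightarrow>
    \<bar>(fwd_diff h ^^ m) (\<lambda>\<xi>. exp (- t * norm \<xi> powr d)) \<xi>\<bar>
      \<le> C * t * norm h powr d * (1 + norm \<xi> / norm h) powr - (real m - d)"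
proof -
  define L where "L = (2 * real m + 1) * (3 * d + 6)"
  define b where "b = real m - d"
  define C1 where "C1 = 3 * L ^ m * 2 powr b"
  define C2 where "C2 = 2 ^ m * (L + real m) powr d * (1 + L) powr b"
  have m0: "m > 0" using m d by (cases m) auto
  have "1 * 1 \<le> L" unfolding L_def using d by (intro mult_mono) auto
  then have L: "L \<ge> 1" by simp
  have b: "b > 0" using m by (simp add: b_def)
  have C: "C1 > 0" "C2 > 0" using L by (auto simp: C1_def C2_def)
  have main: "\<bar>(fwd_diff h ^^ m) (\<lambda>\<xi>. exp (- t * norm \<xi> powr d)) \<xi>\<bar>
      \<le> (C1 + C2) * t * norm h powr d * (1 + norm \<xi> / norm h) powr - b"
    if t: "t > 0" and h: "h \<noteq> 0" for t and \<xi> h :: 'a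
  proof -
    define q where "q = norm \<xi> / norm h"
    have nh: "norm h > 0" using h by simp
    have q: "q \<ge> 0" by (simp add: q_def)
    have \<xi>q: "norm \<xi> = q * norm h" using nh by (simp add: q_def)
    have "\<bar>(fwd_diff h ^^ m) (\<lambda>\<xi>. exp (- t * norm \<xi> powr d)) \<xi>\<bar> \<le> C1 * t * norm h powr d * (1 + q) powr - b
      \<or> \<bar>(fwd_diff h ^^ m) (\<lambda>\<xi>. exp (- t * norm \<xi> powr d)) \<xi>\<bar> \<le> C2 * t * norm h powr d * (1 + q) powr - b"
    proof (cases "L \<le> q")
      case True
      then have q1: "q \<ge> 1" using L by simp
      have "\<bar>(fwd_diff h ^^ m) (\<lambda>\<xi>. exp (- t * norm \<xi> powr d)) \<xi>\<bar>
         \<le> 3 * t * norm \<xi> powr d * (L * norm h / norm \<xi>) ^ m"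
        unfolding L_def
        by (rule fwd_diff_exp_powr_far[OF d t h m0]) (use True nh in \<open>simp add: L_def[symmetric] \<xi>q\<close>)
      also have "\<dots> = 3 * t * norm h powr d * L ^ m * q powr - b"
        using q1 nh by (simp add: \<xi>q powr_mult power_divide b_def powr_minus powr_diff powr_realpow field_simps)
      also have "\<dots> \<le> 3 * t * norm h powr d * L ^ m * (2 powr b * (1 + q) powr - b)"
      proof (rule mult_left_mono)
        have "q powr - b \<le> ((1 + q) / 2) powr - b"
          using q1 b by (intro powr_mono2') auto
        also have "\<dots> = 2 powr b * (1 + q) powr - b"
          using q1 by (simp add: powr_divide powr_minus field_simps)
        finally show "q powr - b \<le> 2 powr b * (1 + q) powr - b" .
      qed (use t L in auto)
      finally show ?thesis by (simp add: C1_def mult_ac)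
    next
      case False
      have "\<bar>(fwd_diff h ^^ m) (\<lambda>\<xi>. exp (- t * norm \<xi> powr d) + - 1) \<xi>\<bar> \<le> 2 ^ m * (t * ((L + real m) * norm h) powr d)"
        unfolding real_norm_def[symmetric]
      proof (rule norm_fwd_diff_le)
        fix j assume j: "j \<le> m"
        let ?\<eta> = "\<xi> + real j *\<^sub>R h"
        have "norm ?\<eta> \<le> q * norm h + real j * norm h"
          using norm_triangle_ineq[of \<xi> "real j *\<^sub>R h"] by (simp add: \<xi>q)
        also have "\<dots> \<le> L * norm h + real m * norm h"
          using False j by (intro add_mono mult_right_mono) auto
        finally have "norm ?\<eta> \<le> (L + real m) * norm h" by (simp add: algebra_simps)
        then have le: "norm ?\<eta> powr d \<le> ((L + real m) * norm h) powr d"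
          using d by (intro powr_mono2) auto
        have "1 + (- t * norm ?\<eta> powr d) \<le> exp (- t * norm ?\<eta> powr d)"
          by (rule exp_ge_add_one_self)
        moreover have "exp (- t * norm ?\<eta> powr d) \<le> 1" using t by simp
        ultimately have "\<bar>exp (- t * norm ?\<eta> powr d) + - 1\<bar> \<le> t * norm ?\<eta> powr d" by simp
        also have "\<dots> \<le> t * ((L + real m) * norm h) powr d"
          using le t by (intro mult_left_mono) auto
        finally show "norm (exp (- t * norm ?\<eta> powr d) + - 1) \<le> t * ((L + real m) * norm h) powr d" by simp
      qed
      then have "\<bar>(fwd_diff h ^^ m) (\<lambda>\<xi>. exp (- t * norm \<xi> powr d)) \<xi>\<bar>
          \<le> 2 ^ m * (t * ((L + real m) * norm h) powr d)"
        unfolding fwd_diff_add_const[OF m0] .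
      also have "\<dots> = 2 ^ m * (L + real m) powr d * t * norm h powr d * 1"
        using L by (simp add: powr_mult)
      also have "\<dots> \<le> 2 ^ m * (L + real m) powr d * t * norm h powr d * ((1 + L) powr b * (1 + q) powr - b)"
      proof (rule mult_left_mono)
        have "1 = (1 + L) powr b * (1 + L) powr - b" using L by (simp add: powr_minus)
        also have "\<dots> \<le> (1 + L) powr b * (1 + q) powr - b"
          using False q b by (intro mult_left_mono powr_mono2') auto
        finally show "1 \<le> (1 + L) powr b * (1 + q) powr - b" .
      qed (use t in auto)
      finally show ?thesis by (simp add: C2_def mult_ac)
    qed
    moreover have "0 \<le> C1 * (t * norm h powr d * (1 + q) powr - b)" "0 \<le> C2 * (t * norm h powr d * (1 + q) powr - b)"
      using C t by simp_all
    ultimately show ?thesis unfolding q_def[symmetric] by (auto simp: algebra_simps)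
  qed
  show ?thesis
    by (rule that[of "C1 + C2"]) (use C main in \<open>auto simp: b_def\<close>)
qed

section \<open>Decay and continuity of the Fourier integral\<close>

lemma integrable_lborel_shift:
  fixes f :: "'a::euclidean_space \<Rightarrow> 'b::{banach, second_countable_topology}"
  assumes "integrable lborel f"
  shows "integrable lborel (\<lambda>x. f (x + h))"
proof -
  have "integrable (distr lborel borel ((+) h)) f" using assms by (simp add: lborel_distr_plus)
  then show ?thesis using assms by (subst (asm) integrable_distr_eq) (auto simp: add.commute)
qed

lemma integral_lborel_shift:
  fixes f :: "'a::euclidean_space \<Rightarrow> 'b::{banach, second_countable_topology}"
  assumes "f \<in> borel_measurable borel"
  shows "(LINT x|lborel. f (x + h)) = (LINT x|lborel. f x)"
proof -
  have "(LINT x|lborel. f x) = (LINT x|distr lborel borel ((+) h). f x)" by (simp add: lborel_distr_plus)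
  also have "\<dots> = (LINT x|lborel. f (x + h))"
    using assms by (subst integral_distr) (auto simp: add.commute)
  finally show ?thesis by simp
qed

abbreviation wave :: "'a::real_inner \<Rightarrow> 'a \<Rightarrow> complex" where
  "wave x \<xi> \<equiv> exp (\<i> * complex_of_real (x \<bullet> \<xi>))"

lemma integral_fourier_fwd_diff:
  fixes f :: "'a::euclidean_space \<Rightarrow> real"
  assumes f: "integrable lborel f" and h: "x \<bullet> h = pi"
  shows "integrable lborel ((fwd_diff h ^^ m) f) \<and>
    (LINT \<xi>|lborel. wave x \<xi> * complex_of_real ((fwd_diff h ^^ m) f \<xi>))
     = (- 2) ^ m * (LINT \<xi>|lborel. wave x \<xi> * complex_of_real (f \<xi>))"
proof (induction m)
  case 0
  then show ?case using f by simp
next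
  case (Suc m)
  define g where "g = (fwd_diff h ^^ m) f"
  define E where "E \<xi> = wave x \<xi>" for \<xi>
  have [measurable]: "E \<in> borel_measurable borel"
    unfolding E_def by (intro borel_measurable_continuous_onI continuous_intros)
  have E: "norm (E \<xi>) = 1" for \<xi> by (simp add: E_def)
  have Eh: "E (\<xi> + h) = - E \<xi>" for \<xi>
    by (simp add: E_def inner_add_right h distrib_left exp_add mult.commute[of \<i> "complex_of_real pi"])
  have g: "integrable lborel g" using Suc by (simp add: g_def)
  then have [measurable]: "g \<in> borel_measurable borel" using borel_measurable_integrable by simp
  have Eint: "integrable lborel (\<lambda>\<xi>. E \<xi> * complex_of_real (u \<xi>))" if "integrable lborel u" for u
    using that
    by (rule Bochner_Integration.integrable_bound)
      (use that borel_measurable_integrable[OF that] in \<open>auto simp: norm_mult E\<close>)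
  have gh: "integrable lborel (\<lambda>\<xi>. g (\<xi> + h))" by (rule integrable_lborel_shift[OF g])
  have eq: "(fwd_diff h ^^ Suc m) f = (\<lambda>\<xi>. g (\<xi> + h) - g \<xi>)"
    unfolding g_def by (rule ext) (rule fwd_diff_Suc)
  have "(LINT \<xi>|lborel. E \<xi> * complex_of_real (g (\<xi> + h) - g \<xi>))
      = (LINT \<xi>|lborel. E \<xi> * complex_of_real (g (\<xi> + h))) - (LINT \<xi>|lborel. E \<xi> * complex_of_real (g \<xi>))"
    using Eint[OF g] Eint[OF gh] by (simp add: right_diff_distrib)
  also have "(LINT \<xi>|lborel. E \<xi> * complex_of_real (g (\<xi> + h)))
      = (LINT \<xi>|lborel. - (E (\<xi> + h) * complex_of_real (g (\<xi> + h))))"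
    by (simp add: Eh)
  also have "\<dots> = - (LINT \<xi>|lborel. E (\<xi> + h) * complex_of_real (g (\<xi> + h)))"
    by simp
  also have "(LINT \<xi>|lborel. E (\<xi> + h) * complex_of_real (g (\<xi> + h))) = (LINT \<xi>|lborel. E \<xi> * complex_of_real (g \<xi>))"
    by (rule integral_lborel_shift[of "\<lambda>\<xi>. E \<xi> * complex_of_real (g \<xi>)"]) measurable
  finally have "(LINT \<xi>|lborel. E \<xi> * complex_of_real (g (\<xi> + h) - g \<xi>)) = - 2 * (LINT \<xi>|lborel. E \<xi> * complex_of_real (g \<xi>))"
    by simp
  then show ?case
    unfolding eq using g gh Suc by (simp add: g_def[symmetric] E_def)
qed

lemma fourier_exp_powr_decay:
  assumes d: "d > 0"
  obtains C where "C > 0" "\<And>t (x :: 'a::euclidean_space). t > 0 \<Longrightarrow> x \<noteq> 0 \<Longrightarrow>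
    norm (LINT \<xi>|lborel. wave x \<xi> * complex_of_real (exp (- t * norm \<xi> powr d)))
      \<le> C * t * norm x powr - (real DIM('a) + d)"
proof -
  let ?N = "real DIM('a)"
  obtain m :: nat where m: "?N + d < real m" using reals_Archimedean2 by blast
  then have md: "real m > d" by (smt (verit) of_nat_0_le_iff)
  define b where "b = real m - d"
  have b: "b > ?N" using m by (simp add: b_def)
  obtain C where C: "C > 0" "\<And>t (\<xi> :: 'a) h. t > 0 \<Longrightarrow> h \<noteq> 0 \<Longrightarrow>
    \<bar>(fwd_diff h ^^ m) (\<lambda>\<xi>. exp (- t * norm \<xi> powr d)) \<xi>\<bar> \<le> C * t * norm h powr d * (1 + norm \<xi> / norm h) powr - b"
    using fwd_diff_exp_powr_le[OF d md, where 'a='a] unfolding b_def by blast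
  define J where "J = enn2real (\<integral>\<^sup>+\<xi>. ennreal ((1 + norm (\<xi>::'a)) powr - b) \<partial>lborel)"
  have J: "(\<integral>\<^sup>+\<xi>. ennreal ((1 + norm (\<xi>::'a)) powr - b) \<partial>lborel) = ennreal J" "J \<ge> 0"
    using nn_integral_powr_norm_finite[OF b] by (simp_all add: J_def)
  define C' where "C' = C * J * pi powr (?N + d) + 1"
  have "norm (LINT \<xi>|lborel. wave x \<xi> * complex_of_real (exp (- t * norm \<xi> powr d)))
      \<le> C' * t * norm x powr - (?N + d)" (is "norm ?I \<le> _") if t: "t > 0" and x: "x \<noteq> 0" for t and x :: 'a
  proof -
    define f where "f = (\<lambda>\<xi>::'a. exp (- t * norm \<xi> powr d))"
    define h where "h = (pi / (norm x)\<^sup>2) *\<^sub>R x"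
    have h: "x \<bullet> h = pi" "norm h = pi / norm x" "h \<noteq> 0"
      using x by (simp_all add: h_def power2_norm_eq_inner[symmetric]) (simp add: power2_eq_square)
    have fd: "integrable lborel ((fwd_diff h ^^ m) f)"
      "(LINT \<xi>|lborel. wave x \<xi> * complex_of_real ((fwd_diff h ^^ m) f \<xi>)) = (- 2) ^ m * ?I"
      using integral_fourier_fwd_diff[OF integrable_exp_powr[OF d t] h(1), of m] by (simp_all add: f_def)
    have "ennreal (norm ?I) \<le> ennreal (2 ^ m * norm ?I)" by (intro ennreal_leI) (simp add: mult_le_cancel_right1)
    also have "ennreal (2 ^ m * norm ?I) = ennreal (norm ((- 2) ^ m * ?I))"
      by (simp add: norm_mult norm_power)
    also have "\<dots> \<le> (\<integral>\<^sup>+\<xi>. ennreal (norm (wave x \<xi> * complex_of_real ((fwd_diff h ^^ m) f \<xi>))) \<partial>lborel)"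
      unfolding fd(2)[symmetric]
    proof (rule integral_norm_bound_ennreal)
      show "integrable lborel (\<lambda>\<xi>. wave x \<xi> * complex_of_real ((fwd_diff h ^^ m) f \<xi>))"
      proof (rule Bochner_Integration.integrable_bound[OF fd(1)])
        have "(\<lambda>\<xi>. wave x \<xi>) \<in> borel_measurable borel"
          by (intro borel_measurable_continuous_onI continuous_intros)
        then show "(\<lambda>\<xi>. wave x \<xi> * complex_of_real ((fwd_diff h ^^ m) f \<xi>)) \<in> borel_measurable lborel"
          using borel_measurable_integrable[OF fd(1)] by simp
      qed (simp add: norm_mult)
    qed
    also have "\<dots> \<le> (\<integral>\<^sup>+\<xi>. ennreal (C * t * norm h powr d) * ennreal ((1 + norm (\<xi>::'a) / norm h) powr - b) \<partial>lborel)"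
      using C(2)[OF t h(3)] C(1) t unfolding f_def[symmetric]
      by (intro nn_integral_mono) (simp add: norm_mult ennreal_mult'[symmetric] ennreal_leI)
    \<comment> \<open>Rescaling \<xi> by |h| contributes |h|^N; with the factor t |h|^d and |h| =
      \<pi> / |x| this is the asserted decay.\<close>
    also have "\<dots> = ennreal (C * t * norm h powr d) * (ennreal (norm h ^ DIM('a)) * ennreal J)"
    proof -
      have "(\<integral>\<^sup>+\<xi>. ennreal ((1 + norm (\<xi>::'a) / norm h) powr - b) \<partial>lborel)
        = ennreal (\<bar>norm h\<bar> ^ DIM('a)) * (\<integral>\<^sup>+\<xi>. ennreal ((1 + norm (0 + norm h *\<^sub>R (\<xi>::'a)) / norm h) powr - b) \<partial>lborel)"
        by (rule nn_integral_lborel_affine) (use h in auto)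
      then show ?thesis using J h(3) by (simp add: nn_integral_cmult)
    qed
    also have "\<dots> = ennreal (C * t * norm h powr d * (norm h powr ?N * J))"
      using C t J h(3) by (simp add: ennreal_mult'[symmetric] powr_realpow)
    also have "C * t * norm h powr d * (norm h powr ?N * J) = C * J * t * norm h powr (?N + d)"
      by (simp add: powr_add)
    also have "\<dots> = C * J * pi powr (?N + d) * t * norm x powr - (?N + d)"
      unfolding h(2) using x by (simp only: powr_divide powr_minus) (simp add: field_simps)
    also have "ennreal \<dots> \<le> ennreal (C' * t * norm x powr - (?N + d))"
      unfolding C'_def using t by (intro ennreal_leI mult_right_mono) auto
    finally show ?thesis
      using C(1) t J(2) by (subst (asm) ennreal_le_iff) (auto simp: C'_def)
  qed
  moreover have "C' > 0" unfolding C'_def using C J by (intro add_nonneg_pos) auto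
  ultimately show ?thesis using that by blast
qed

text \<open>Shifts, substitutions and product measures are handled over \<open>lborel\<close>; the
  completed measure of the definition gives the same integral because the integrand is
  Borel.\<close>

lemma G_eq_lborel:
  "G d x t = (1 / (2 * pi) ^ CARD('n)) *
     Re (LINT \<xi>|lborel. wave x \<xi> * complex_of_real (exp (- t * norm \<xi> powr d)))"
  for x :: "real ^ 'n::finite"
proof -
  have "(\<lambda>\<xi>. wave x \<xi>) \<in> borel_measurable borel"
    by (intro borel_measurable_continuous_onI continuous_intros)
  then have "(\<lambda>\<xi>. wave x \<xi> * complex_of_real (exp (- t * norm \<xi> powr d))) \<in> borel_measurable lborel"
    by simp
  then show ?thesis unfolding G_def by (simp only: integral_completion)
qed

text \<open>The trivial supremum bound serves \<open>norm x \<le> t powr (1 / d)\<close>, the decay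
  bound the remaining points. The factor \<open>2 powr (?N + d)\<close> in \<open>c\<close> pays for
  passing from the maximum of the two lengths to their sum.\<close>

lemma G_le_kern:
  assumes d: "d > 0"
  obtains c where "c > 0" "\<And>(x :: real ^ 'n::finite) t. t > 0 \<Longrightarrow> \<bar>G d x t\<bar> \<le> c * kern d x t"
proof -
  let ?N = "real DIM(real ^ 'n)"
  let ?I = "\<lambda>(x :: real ^ 'n) t. LINT \<xi>|lborel. wave x \<xi> * complex_of_real (exp (- t * norm \<xi> powr d))"
  obtain C1 where C1: "C1 > 0" "\<And>t. t > 0 \<Longrightarrow>
    (\<integral>\<^sup>+\<xi>. ennreal (exp (- t * norm (\<xi> :: real ^ 'n) powr d)) \<partial>lborel) \<le> ennreal (C1 * t powr (- ?N / d))"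
    using nn_integral_exp_powr_le[OF d, where 'a="real ^ 'n"] by blast
  obtain C2 where C2: "C2 > 0" "\<And>t (x :: real ^ 'n). t > 0 \<Longrightarrow> x \<noteq> 0 \<Longrightarrow> norm (?I x t) \<le> C2 * t * norm x powr - (?N + d)"
    using fourier_exp_powr_decay[OF d, where 'a="real ^ 'n"] by blast
  define c where "c = max C1 C2 * 2 powr (?N + d)"
  have "\<bar>G d x t\<bar> \<le> c * kern d x t" if t: "t > 0" for x :: "real ^ 'n" and t
  proof -
    have "(2 * pi) ^ CARD('n) \<ge> 1" using pi_gt3 by (intro one_le_power) simp
    then have "\<bar>1 / (2 * pi) ^ CARD('n)\<bar> \<le> 1"
      by (simp add: abs_mult del: power_mult_distrib)
    then have "\<bar>G d x t\<bar> \<le> 1 * \<bar>Re (?I x t)\<bar>"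
      unfolding G_eq_lborel abs_mult by (rule mult_right_mono) simp
    also have "\<dots> = \<bar>Re (?I x t)\<bar>" by simp
    also have "\<dots> \<le> norm (?I x t)" by (rule abs_Re_le_cmod)
    also have "\<dots> \<le> max C1 C2 * (t * (2 * max (t powr (1 / d)) (norm x)) powr - (?N + d)) * 2 powr (?N + d)"
    proof (cases "norm x \<le> t powr (1 / d)")
      case True
      have "ennreal (norm (?I x t)) \<le> (\<integral>\<^sup>+\<xi>. ennreal (norm (wave x \<xi> * complex_of_real (exp (- t * norm \<xi> powr d)))) \<partial>lborel)"
      proof (rule integral_norm_bound_ennreal, rule Bochner_Integration.integrable_bound[OF integrable_exp_powr[OF d t]])
        have "(\<lambda>\<xi>. wave x \<xi>) \<in> borel_measurable borel"
          by (intro borel_measurable_continuous_onI continuous_intros)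
        then show "(\<lambda>\<xi>. wave x \<xi> * complex_of_real (exp (- t * norm \<xi> powr d))) \<in> borel_measurable lborel"
          by simp
      qed (simp add: norm_mult)
      also have "\<dots> \<le> ennreal (C1 * t powr (- ?N / d))"
        using C1(2)[OF t] by (simp add: norm_mult)
      finally have "norm (?I x t) \<le> C1 * t powr (- ?N / d)"
        using C1 by (subst (asm) ennreal_le_iff) auto
      also have "\<dots> \<le> max C1 C2 * t powr (- ?N / d)" by (intro mult_right_mono) auto
      also have "t powr (- ?N / d) = t * (2 * max (t powr (1 / d)) (norm x)) powr - (?N + d) * 2 powr (?N + d)"
      proof -
        have "1 / d * - (?N + d) = - ?N / d - 1" using d by (simp add: field_simps)
        then have "(t powr (1 / d)) powr - (?N + d) = t powr (- ?N / d) / t"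
          using t by (simp only: powr_powr powr_diff) simp
        moreover have "(2 * t powr (1 / d)) powr - (?N + d) * 2 powr (?N + d) = (t powr (1 / d)) powr - (?N + d)"
          using t by (simp only: powr_mult powr_minus) simp
        ultimately show ?thesis using True t by (simp add: max_absorb1 mult.assoc)
      qed
      finally show ?thesis by (simp add: mult_ac)
    next
      case False
      then have x: "norm x > 0" "x \<noteq> 0" using powr_ge_zero[of t "1 / d"] by force+
      have "norm (?I x t) \<le> C2 * (t * norm x powr - (?N + d))" using C2(2)[OF t x(2)] by (simp add: mult_ac)
      also have "\<dots> \<le> max C1 C2 * (t * norm x powr - (?N + d))" using t by (intro mult_right_mono) auto
      also have "norm x powr - (?N + d) = (2 * max (t powr (1 / d)) (norm x)) powr - (?N + d) * 2 powr (?N + d)"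
        using False x by (simp add: max_absorb2) (simp only: powr_mult powr_minus powr_diff powr_add mult_ac, simp)
      finally show ?thesis by (simp add: mult_ac)
    qed
    also have "\<dots> = c * (t * (2 * max (t powr (1 / d)) (norm x)) powr - (?N + d))"
      by (simp add: c_def)
    also have "\<dots> \<le> c * kern d x t"
      unfolding kern_def using t d C1(1)
      by (intro mult_left_mono powr_mono2') (auto simp: c_def add_pos_nonneg max_def)
    finally show ?thesis .
  qed
  moreover have "c > 0" using C1(1) by (simp add: c_def)
  ultimately show ?thesis using that by blast
qed

lemma continuous_on_G:
  assumes d: "d > 0"
  shows "continuous_on (UNIV \<times> {0<..}) (\<lambda>(x :: real ^ 'n::finite, t). G d x t)"
  unfolding continuous_on_sequentially
proof (intro ballI allI impI, elim conjE)
  fix p :: "nat \<Rightarrow> (real ^ 'n) \<times> real" and a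
  assume a: "a \<in> UNIV \<times> {0<..}" and p: "\<forall>n. p n \<in> UNIV \<times> {0<..}" "p \<longlonglongrightarrow> a"
  define x t where "x n = fst (p n)" and "t n = snd (p n)" for n
  define x0 t0 where "x0 = fst a" and "t0 = snd a"
  have t0: "t0 > 0" using a by (auto simp: t0_def)
  have x: "x \<longlonglongrightarrow> x0" and t: "t \<longlonglongrightarrow> t0"
    unfolding x_def t_def x0_def t0_def by (intro tendsto_intros p)+
  let ?f = "\<lambda>x t \<xi>. wave x \<xi> * complex_of_real (exp (- t * norm \<xi> powr d))"
  have "(\<lambda>\<xi>. wave y \<xi>) \<in> borel_measurable borel" for y :: "real ^ 'n"
    by (intro borel_measurable_continuous_onI continuous_intros)
  then have meas: "?f y s \<in> borel_measurable lborel" for y :: "real ^ 'n" and s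
    by simp
  have "eventually (\<lambda>n. t n > t0 / 2) sequentially"
    using t t0 by (intro order_tendstoD) auto
  then obtain n0 where n0: "\<And>n. n \<ge> n0 \<Longrightarrow> t n > t0 / 2"
    by (auto simp: eventually_sequentially)
  have "(\<lambda>n. LINT \<xi>|lborel. ?f (x (n + n0)) (t (n + n0)) \<xi>) \<longlonglongrightarrow> (LINT \<xi>|lborel. ?f x0 t0 \<xi>)"
  proof (rule integral_dominated_convergence)
    show "integrable lborel (\<lambda>\<xi>::real ^ 'n. exp (- (t0 / 2) * norm \<xi> powr d))"
      by (rule integrable_exp_powr) (use d t0 in auto)
    show "AE \<xi> in lborel. (\<lambda>n. ?f (x (n + n0)) (t (n + n0)) \<xi>) \<longlonglongrightarrow> ?f x0 t0 \<xi>"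
      by (intro AE_I2 tendsto_intros LIMSEQ_ignore_initial_segment x t)
    show "AE \<xi> in lborel. norm (?f (x (n + n0)) (t (n + n0)) \<xi>) \<le> exp (- (t0 / 2) * norm \<xi> powr d)" for n
    proof (rule AE_I2)
      fix \<xi> :: "real ^ 'n"
      have "(t0 / 2) * norm \<xi> powr d \<le> t (n + n0) * norm \<xi> powr d"
        using n0[of "n + n0"] by (intro mult_right_mono) auto
      then show "norm (?f (x (n + n0)) (t (n + n0)) \<xi>) \<le> exp (- (t0 / 2) * norm \<xi> powr d)"
        by (simp add: norm_mult)
    qed
  qed (rule meas)+
  then have "(\<lambda>n. LINT \<xi>|lborel. ?f (x n) (t n) \<xi>) \<longlonglongrightarrow> (LINT \<xi>|lborel. ?f x0 t0 \<xi>)"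
    by (rule LIMSEQ_offset)
  then have "(\<lambda>n. G d (x n) (t n)) \<longlonglongrightarrow> G d x0 t0"
    unfolding G_eq_lborel by (intro tendsto_intros)
  then show "((\<lambda>(x, t). G d x t) \<circ> p) \<longlonglongrightarrow> (\<lambda>(x, t). G d x t) a"
    by (simp add: x_def t_def x0_def t0_def case_prod_unfold o_def)
qed

section \<open>Picard iteration with a weight\<close>

text \<open>Mean value theorem: the intermediate point is positive, so the power is differentiable
  there even if an endpoint is 0.\<close>

lemma abs_powr_diff_le:
  fixes a b M p :: real
  assumes p: "p > 1" and a: "\<bar>a\<bar> \<le> M" and b: "\<bar>b\<bar> \<le> M"
  shows "\<bar>\<bar>a\<bar> powr p - \<bar>b\<bar> powr p\<bar> \<le> p * M powr (p - 1) * \<bar>a - b\<bar>"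
proof -
  have main: "y powr p - x powr p \<le> p * M powr (p - 1) * (y - x)" if "0 \<le> x" "x \<le> y" "y \<le> M" for x y
  proof (cases "x = y")
    case False
    then have xy: "x < y" using that by simp
    have der: "((\<lambda>z. z powr p) has_real_derivative p * z powr (p - 1)) (at z)" if "x < z" for z
      using that \<open>0 \<le> x\<close> by (intro has_real_derivative_powr) simp
    have "continuous_on {x..y} (\<lambda>z. z powr p)"
      using that p by (intro continuous_on_powr' continuous_intros) auto
    from MVT[OF xy this] obtain l z where z': "x < z" "z < y" "((\<lambda>z. z powr p) has_real_derivative l) (at z)"
        "y powr p - x powr p = (y - x) * l"
      using der by (metis real_differentiable_def)
    then have "l = p * z powr (p - 1)" using der DERIV_unique by blast
    with z' have z: "x < z" "z < y" "y powr p - x powr p = (y - x) * (p * z powr (p - 1))" by auto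
    have "(y - x) * (p * z powr (p - 1)) \<le> (y - x) * (p * M powr (p - 1))"
      using z that p by (intro mult_left_mono powr_mono2) auto
    then show ?thesis using z by (simp add: mult_ac)
  qed simp
  have "\<bar>\<bar>a\<bar> powr p - \<bar>b\<bar> powr p\<bar> \<le> p * M powr (p - 1) * \<bar>\<bar>a\<bar> - \<bar>b\<bar>\<bar>"
  proof (cases "\<bar>a\<bar> \<le> \<bar>b\<bar>")
    case True
    then show ?thesis using main[of "\<bar>a\<bar>" "\<bar>b\<bar>"] b p powr_mono2[of p "\<bar>a\<bar>" "\<bar>b\<bar>"] by simp
  next
    case False
    then show ?thesis using main[of "\<bar>b\<bar>" "\<bar>a\<bar>"] a p powr_mono2[of p "\<bar>b\<bar>" "\<bar>a\<bar>"] by simp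
  qed
  also have "\<dots> \<le> p * M powr (p - 1) * \<bar>a - b\<bar>"
    using p by (intro mult_left_mono) auto
  finally show ?thesis .
qed

text \<open>Applied at every point of space-time with \<open>K = 2 * V x t\<close>, this takes the
  place of completeness of a weighted function space.\<close>

lemma geometric_cauchy_limit:
  fixes a :: "nat \<Rightarrow> real"
  assumes a: "\<And>n. \<bar>a (Suc n) - a n\<bar> \<le> K * (1 / 2) ^ n"
  shows "\<exists>l. a \<longlonglongrightarrow> l \<and> (\<forall>n. \<bar>l - a n\<bar> \<le> 2 * K * (1 / 2) ^ n)"
proof -
  define e where "e k = a (Suc k) - a k" for k
  have geo: "summable (\<lambda>k. K * (1 / 2) ^ n * (1 / 2 :: real) ^ k)" for n
    by (intro summable_mult summable_geometric) simp
  have le: "norm (e (k + n)) \<le> K * (1 / 2) ^ n * (1 / 2) ^ k" for n k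
    using a[of "k + n"] by (simp add: e_def power_add mult_ac)
  have sum2: "summable (\<lambda>k. norm (e (k + n)))" for n
    by (rule summable_comparison_test'[OF geo[of n], of 0]) (use le in auto)
  have sum: "summable (\<lambda>k. e (k + n))" "summable (\<lambda>k. norm (e (k + n)))" for n
    using summable_norm_cancel[OF sum2] sum2 by auto
  have tel: "(\<Sum>k<n. e k) = a n - a 0" for n
    unfolding e_def by (rule sum_lessThan_telescope)
  have "(\<lambda>n. \<Sum>k<n. e k) \<longlonglongrightarrow> suminf e"
    using sum(1)[of 0] by (intro summable_LIMSEQ) simp
  then have "(\<lambda>n. a 0 + (\<Sum>k<n. e k)) \<longlonglongrightarrow> a 0 + suminf e" by (intro tendsto_intros)
  then have lim: "a \<longlonglongrightarrow> a 0 + suminf e" by (simp add: tel)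
  have "\<bar>a 0 + suminf e - a n\<bar> \<le> 2 * K * (1 / 2) ^ n" for n
  proof -
    have "suminf e = (\<Sum>k. e (k + n)) + (\<Sum>k<n. e k)"
      using suminf_split_initial_segment[of e n] sum(1)[of 0] by simp
    then have "a 0 + suminf e - a n = (\<Sum>k. e (k + n))" by (simp add: tel)
    also have "\<bar>\<dots>\<bar> \<le> (\<Sum>k. norm (e (k + n)))"
      using summable_norm[OF sum(2)[of n]] by simp
    also have "\<dots> \<le> (\<Sum>k. K * (1 / 2) ^ n * (1 / 2) ^ k)"
      by (intro suminf_le sum geo le)
    also have "\<dots> = K * (1 / 2) ^ n * 2"
      using suminf_mult[OF summable_geometric[of "1 / 2 :: real"], of "K * (1 / 2) ^ n"]
      by (simp add: suminf_geometric)
    finally show ?thesis by (simp add: mult_ac)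
  qed
  then show ?thesis using lim by blast
qed

text \<open>Functions of space and time are curried as \<open>f y s\<close>, while iterated integrals are taken first over
  \<open>y\<close> and then over \<open>s\<close>; hence the exchanged order of the arguments.\<close>

abbreviation st_measurable :: "('a::euclidean_space \<Rightarrow> real \<Rightarrow> real) \<Rightarrow> bool" where
  "st_measurable f \<equiv> (\<lambda>(s, y). f y s) \<in> borel_measurable (lborel \<Otimes>\<^sub>M lborel)"

text \<open>The properties of the fundamental solution on which the fixed point argument rests. Only
  its absolute value is controlled, which accommodates sign changes.\<close>

locale dominated_kernel =
  fixes d c :: real and g :: "'a::euclidean_space \<Rightarrow> real \<Rightarrow> real"
  assumes d: "d > 0" and c: "c > 0"
    and g_cont: "continuous_on (UNIV \<times> {0<..}) (\<lambda>(x, t). g x t)"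
    and g_le: "t > 0 \<Longrightarrow> \<bar>g x t\<bar> \<le> c * kern d x t"
begin

text \<open>Extension by 0 to nonpositive times, where \<open>g\<close> is unconstrained; it makes
  the kernel Borel on all of space-time.\<close>

definition gpos :: "'a \<Rightarrow> real \<Rightarrow> real" where
  "gpos x t = (if t > 0 then g x t else 0)"

lemma gpos_measurable: "(\<lambda>p. gpos (fst p) (snd p)) \<in> borel_measurable borel"
proof -
  have "(\<lambda>p. indicator (UNIV \<times> {0<..}) p *\<^sub>R (case p of (x, t) \<Rightarrow> g x t)) \<in> borel_measurable borel"
    by (rule borel_measurable_continuous_on_indicator[OF _ g_cont])
       (intro borel_open open_Times; simp)
  also have "(\<lambda>p. indicator (UNIV \<times> {0<..}) p *\<^sub>R (case p of (x, t) \<Rightarrow> g x t)) = (\<lambda>p. gpos (fst p) (snd p))"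
    by (auto simp: gpos_def indicator_def split: prod.splits)
  finally show ?thesis .
qed

lemma gpos_measurable' [measurable (raw)]:
  assumes [measurable]: "f \<in> borel_measurable M" "h \<in> borel_measurable M"
  shows "(\<lambda>x. gpos (f x) (h x)) \<in> borel_measurable M"
proof -
  have "(\<lambda>x. (f x, h x)) \<in> M \<rightarrow>\<^sub>M borel"
    unfolding borel_prod[symmetric] by measurable
  from measurable_compose[OF this gpos_measurable] show ?thesis by simp
qed

lemma gpos_le: "\<bar>gpos x t\<bar> \<le> c * kern d x t" if "t \<ge> 0"
  using g_le[of t x] mult_nonneg_nonneg[OF less_imp_le[OF c] kern_nonneg[OF that, of d x]] that
  by (cases "t = 0") (simp_all add: gpos_def)

lemma gpos_tendsto:
  assumes "x \<longlonglongrightarrow> x0" "t \<longlonglongrightarrow> t0" "t0 > 0"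
  shows "(\<lambda>n. gpos (x n) (t n)) \<longlonglongrightarrow> gpos x0 t0"
proof -
  have "open (UNIV \<times> {0<..} :: ('a \<times> real) set)" by (intro open_Times) auto
  then have "isCont (\<lambda>(x, t). g x t) (x0, t0)"
    using g_cont assms(3) by (subst (asm) continuous_on_eq_continuous_at) auto
  then have "(\<lambda>n. (\<lambda>(x, t). g x t) (x n, t n)) \<longlonglongrightarrow> (\<lambda>(x, t). g x t) (x0, t0)"
    by (rule isCont_tendsto_compose) (intro tendsto_Pair assms)
  then have "(\<lambda>n. g (x n) (t n)) \<longlonglongrightarrow> g x0 t0" by simp
  moreover have "eventually (\<lambda>n. g (x n) (t n) = gpos (x n) (t n)) sequentially"
    using order_tendstoD(1)[OF assms(2,3)] by eventually_elim (simp add: gpos_def)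
  ultimately show ?thesis
    using assms(3) by (simp add: gpos_def[of x0 t0] tendsto_cong)
qed

section \<open>The linear part and the Duhamel integral\<close>

definition linpart :: "('a \<Rightarrow> real) \<Rightarrow> 'a \<Rightarrow> real \<Rightarrow> real" where
  "linpart \<phi> x t = (LINT y|lborel. gpos (x - y) t * \<phi> y)"

text \<open>One integral over the product space, so that linearity and dominated convergence apply
  in a single step; Fubini's theorem recovers the iterated form of the integral equation at the
  end.\<close>

definition duh :: "('a \<Rightarrow> real \<Rightarrow> real) \<Rightarrow> 'a \<Rightarrow> real \<Rightarrow> real" where
  "duh f x t = (LINT (s, y)|(lborel \<Otimes>\<^sub>M lborel). indicator {0<..<t} s * (gpos (x - y) (t - s) * f y s))"

text \<open>The nonnegative majorant of \<open>duh\<close>, up to the factor \<open>c\<close>. It is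
  iterated because supersolution estimates are made on each time slice, and extended-valued so that
  finiteness can be proved by estimation.\<close>

definition duhK :: "('a \<Rightarrow> real \<Rightarrow> real) \<Rightarrow> 'a \<Rightarrow> real \<Rightarrow> ennreal" where
  "duhK f x t = (\<integral>\<^sup>+s\<in>{0<..<t}. kern_conv d (\<lambda>y. ennreal (f y s)) x (t - s) \<partial>lborel)"

lemma duhK_pair:
  assumes [measurable]: "st_measurable f"
  shows "duhK f x t = (\<integral>\<^sup>+(s, y). indicator {0<..<t} s * (ennreal (kern d (x - y) (t - s)) * ennreal (f y s)) \<partial>(lborel \<Otimes>\<^sub>M lborel))"
proof -
  have "duhK f x t = (\<integral>\<^sup>+s. (\<integral>\<^sup>+y. indicator {0<..<t} s * (ennreal (kern d (x - y) (t - s)) * ennreal (f y s)) \<partial>lborel) \<partial>lborel)"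
    unfolding duhK_def by (intro nn_integral_cong) (auto simp: indicator_def)
  also have "\<dots> = (\<integral>\<^sup>+p. (case p of (s, y) \<Rightarrow> indicator {0<..<t} s * (ennreal (kern d (x - y) (t - s)) * ennreal (f y s))) \<partial>(lborel \<Otimes>\<^sub>M lborel))"
    by (subst lborel.nn_integral_fst[symmetric]) (simp_all add: case_prod_unfold)
  finally show ?thesis .
qed

lemma duh_integrable:
  assumes [measurable]: "st_measurable f"
    and fin: "duhK (\<lambda>y s. \<bar>f y s\<bar>) x t < \<infinity>"
  shows "integrable (lborel \<Otimes>\<^sub>M lborel) (\<lambda>(s, y). indicator {0<..<t} s * (gpos (x - y) (t - s) * f y s))"
    and "\<bar>duh f x t\<bar> \<le> enn2real (ennreal c * duhK (\<lambda>y s. \<bar>f y s\<bar>) x t)"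
proof -
  let ?h = "\<lambda>(s, y). indicator {0<..<t} s * (gpos (x - y) (t - s) * f y s)"
  have le: "(\<integral>\<^sup>+p. ennreal (norm (?h p)) \<partial>(lborel \<Otimes>\<^sub>M lborel)) \<le> ennreal c * duhK (\<lambda>y s. \<bar>f y s\<bar>) x t"
  proof -
    have "ennreal (norm (?h p)) \<le> ennreal c * (case p of (s, y) \<Rightarrow> indicator {0<..<t} s * (ennreal (kern d (x - y) (t - s)) * ennreal \<bar>f y s\<bar>))" for p
    proof (cases p)
      case (Pair s y)
      show ?thesis
      proof (cases "s \<in> {0<..<t}")
        case True
        have "\<bar>gpos (x - y) (t - s)\<bar> * \<bar>f y s\<bar> \<le> c * kern d (x - y) (t - s) * \<bar>f y s\<bar>"
          using True by (intro mult_right_mono gpos_le) auto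
        then show ?thesis
          using True c Pair kern_nonneg[of "t - s" d "x - y"]
          by (simp add: abs_mult ennreal_mult'[symmetric] mult.assoc ennreal_leI)
      qed (simp add: Pair)
    qed
    then have "(\<integral>\<^sup>+p. ennreal (norm (?h p)) \<partial>(lborel \<Otimes>\<^sub>M lborel))
      \<le> (\<integral>\<^sup>+p. ennreal c * (case p of (s, y) \<Rightarrow> indicator {0<..<t} s * (ennreal (kern d (x - y) (t - s)) * ennreal \<bar>f y s\<bar>)) \<partial>(lborel \<Otimes>\<^sub>M lborel))"
      by (intro nn_integral_mono) auto
    also have "\<dots> = ennreal c * duhK (\<lambda>y s. \<bar>f y s\<bar>) x t"
      by (subst duhK_pair) (auto intro!: nn_integral_cmult)
    finally show ?thesis .
  qed
  have fin': "ennreal c * duhK (\<lambda>y s. \<bar>f y s\<bar>) x t < \<infinity>"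
    using fin by (simp add: ennreal_mult_less_top)
  show int: "integrable (lborel \<Otimes>\<^sub>M lborel) ?h"
    by (rule integrableI_bounded) (use order.strict_trans1[OF le fin'] in auto)
  have "ennreal (norm (duh f x t)) \<le> (\<integral>\<^sup>+p. ennreal (norm (?h p)) \<partial>(lborel \<Otimes>\<^sub>M lborel))"
    unfolding duh_def by (rule integral_norm_bound_ennreal[OF int])
  also note le
  finally have "enn2real (ennreal \<bar>duh f x t\<bar>) \<le> enn2real (ennreal c * duhK (\<lambda>y s. \<bar>f y s\<bar>) x t)"
    using fin' by (intro enn2real_mono) auto
  then show "\<bar>duh f x t\<bar> \<le> enn2real (ennreal c * duhK (\<lambda>y s. \<bar>f y s\<bar>) x t)" by simp
qed

lemma linpart_integrable:
  assumes [measurable]: "\<phi> \<in> borel_measurable borel" and t: "t > 0"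
    and fin: "kern_conv d (\<lambda>y. ennreal \<bar>\<phi> y\<bar>) x t < \<infinity>" (is "?K < _")
  shows "integrable lborel (\<lambda>y. gpos (x - y) t * \<phi> y)"
    and "\<bar>linpart \<phi> x t\<bar> \<le> enn2real (ennreal c * ?K)"
proof -
  have "(\<integral>\<^sup>+y. ennreal (norm (gpos (x - y) t * \<phi> y)) \<partial>lborel)
      \<le> (\<integral>\<^sup>+y. ennreal c * (ennreal (kern d (x - y) t) * ennreal \<bar>\<phi> y\<bar>) \<partial>lborel)"
  proof (rule nn_integral_mono)
    fix y
    have "\<bar>gpos (x - y) t\<bar> * \<bar>\<phi> y\<bar> \<le> c * kern d (x - y) t * \<bar>\<phi> y\<bar>"
      using t by (intro mult_right_mono gpos_le) auto
    then show "ennreal (norm (gpos (x - y) t * \<phi> y)) \<le> ennreal c * (ennreal (kern d (x - y) t) * ennreal \<bar>\<phi> y\<bar>)"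
      using t c by (simp add: abs_mult ennreal_mult'[symmetric] kern_nonneg mult.assoc ennreal_leI)
  qed
  also have "\<dots> = ennreal c * ?K" by (rule nn_integral_cmult) measurable
  finally have le: "(\<integral>\<^sup>+y. ennreal (norm (gpos (x - y) t * \<phi> y)) \<partial>lborel) \<le> ennreal c * ?K" .
  have fin': "ennreal c * ?K < \<infinity>"
    using fin by (simp add: ennreal_mult_less_top)
  show int: "integrable lborel (\<lambda>y. gpos (x - y) t * \<phi> y)"
    by (rule integrableI_bounded) (use order.strict_trans1[OF le fin'] in auto)
  have "ennreal (norm (linpart \<phi> x t)) \<le> (\<integral>\<^sup>+y. ennreal (norm (gpos (x - y) t * \<phi> y)) \<partial>lborel)"
    unfolding linpart_def by (rule integral_norm_bound_ennreal[OF int])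
  also note le
  finally have "enn2real (ennreal \<bar>linpart \<phi> x t\<bar>) \<le> enn2real (ennreal c * ?K)"
    using fin' by (intro enn2real_mono) auto
  then show "\<bar>linpart \<phi> x t\<bar> \<le> enn2real (ennreal c * ?K)" by simp
qed

text \<open>Finiteness at the one point \<open>(x0, t0)\<close> suffices: by Harnack's inequality
  the kernels at all nearby points are below a fixed multiple of the kernel there. Distances below
  \<open>(t0 / 2) powr (1 / d)\<close> are admissible as soon as
  \<open>t n > t0 / 2\<close>.\<close>

lemma linpart_tendsto:
  assumes [measurable]: "\<phi> \<in> borel_measurable borel" and t0: "t0 > 0"
    and fin: "(\<integral>\<^sup>+y. ennreal (kern d (x0 - y) t0) * ennreal \<bar>\<phi> y\<bar> \<partial>lborel) < \<infinity>"
    and x: "x \<longlonglongrightarrow> x0" and t: "t \<longlonglongrightarrow> t0"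
  shows "(\<lambda>n. linpart \<phi> (x n) (t n)) \<longlonglongrightarrow> linpart \<phi> x0 t0"
proof -
  let ?C = "2 * (2 powr (1 / d) + 1) powr (real DIM('a) + d)"
  have "eventually (\<lambda>n. t n > t0 / 2) sequentially" "eventually (\<lambda>n. t n < 2 * t0) sequentially"
    using t0 order_tendstoD(1)[OF t, of "t0 / 2"] order_tendstoD(2)[OF t, of "2 * t0"] by auto
  moreover have "eventually (\<lambda>n. dist (x n) x0 < (t0 / 2) powr (1 / d)) sequentially"
    using x t0 by (intro tendstoD) auto
  ultimately have "eventually (\<lambda>n. t n > t0 / 2 \<and> t n < 2 * t0 \<and> dist (x n) x0 < (t0 / 2) powr (1 / d)) sequentially"
    by eventually_elim auto
  then obtain n0 where n0: "\<And>n. n \<ge> n0 \<Longrightarrow> t n > t0 / 2 \<and> t n < 2 * t0 \<and> dist (x n) x0 < (t0 / 2) powr (1 / d)"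
    by (auto simp: eventually_sequentially)
  have "(\<lambda>n. linpart \<phi> (x (n + n0)) (t (n + n0))) \<longlonglongrightarrow> linpart \<phi> x0 t0"
    unfolding linpart_def
  proof (rule integral_dominated_convergence)
    show "integrable lborel (\<lambda>y. c * ?C * (kern d (x0 - y) t0 * \<bar>\<phi> y\<bar>))"
      by (intro integrable_mult_right integrableI_bounded)
        (use fin t0 in \<open>auto simp: abs_mult ennreal_mult' kern_nonneg\<close>)
    show "AE y in lborel. (\<lambda>n. gpos (x (n + n0) - y) (t (n + n0)) * \<phi> y) \<longlonglongrightarrow> gpos (x0 - y) t0 * \<phi> y"
      by (intro AE_I2 tendsto_intros gpos_tendsto LIMSEQ_ignore_initial_segment x t t0)
    show "AE y in lborel. norm (gpos (x (n + n0) - y) (t (n + n0)) * \<phi> y) \<le> c * ?C * (kern d (x0 - y) t0 * \<bar>\<phi> y\<bar>)" for n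
    proof (rule AE_I2)
      fix y
      let ?x = "x (n + n0)" and ?t = "t (n + n0)"
      have n: "?t > t0 / 2" "?t < 2 * t0" "dist ?x x0 < (t0 / 2) powr (1 / d)" using n0[of "n + n0"] by auto
      have "(t0 / 2) powr (1 / d) \<le> ?t powr (1 / d)" using n t0 d by (intro powr_mono2) auto
      then have "kern d (?x - y) ?t \<le> ?C * kern d (x0 - y) t0"
        using n t0 by (intro kern_harnack[OF d]) (auto simp: dist_norm)
      then have "c * kern d (?x - y) ?t \<le> c * (?C * kern d (x0 - y) t0)"
        using c by (intro mult_left_mono) auto
      moreover have "\<bar>gpos (?x - y) ?t\<bar> \<le> c * kern d (?x - y) ?t"
        using n t0 by (intro gpos_le) auto
      ultimately have "\<bar>gpos (?x - y) ?t\<bar> * \<bar>\<phi> y\<bar> \<le> c * (?C * kern d (x0 - y) t0) * \<bar>\<phi> y\<bar>"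
        by (intro mult_right_mono) auto
      then show "norm (gpos (?x - y) ?t * \<phi> y) \<le> c * ?C * (kern d (x0 - y) t0 * \<bar>\<phi> y\<bar>)"
        by (simp add: abs_mult mult_ac)
    qed
  qed measurable
  then show ?thesis by (rule LIMSEQ_offset)
qed

text \<open>The singularity of the kernel at s = t is harmless on slices where \<open>f\<close> is
  bounded, since each slice has the same mass; the error is therefore linear in
  \<open>t - a\<close>.\<close>

lemma duh_split:
  assumes [measurable]: "st_measurable f"
    and fin: "duhK (\<lambda>y s. \<bar>f y s\<bar>) x t < \<infinity>"
    and a: "0 < a" "a < t" and B: "B \<ge> 0" "\<And>y s. a \<le> s \<Longrightarrow> s < t \<Longrightarrow> \<bar>f y s\<bar> \<le> B"
  shows "\<bar>duh f x t - (LINT (s, y)|(lborel \<Otimes>\<^sub>M lborel). indicator {0<..<a} s * (gpos (x - y) (t - s) * f y s))\<bar>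
    \<le> c * B * kern_mass d TYPE('a) * (t - a)"
proof -
  let ?M = "lborel \<Otimes>\<^sub>M lborel :: (real \<times> 'a) measure" and ?\<kappa> = "kern_mass d TYPE('a)"
  let ?h = "\<lambda>I (s, y). indicator I s * (gpos (x - y) (t - s) * f y s)"
  have int: "integrable ?M (?h {0<..<t})"
    by (rule duh_integrable[OF assms(1) fin])
  have int': "integrable ?M (?h I)" if "I \<subseteq> {0<..<t}" and [measurable]: "I \<in> sets borel" for I
  proof (rule Bochner_Integration.integrable_bound[OF int])
    show "?h I \<in> borel_measurable ?M" by measurable
    show "AE p in ?M. norm (?h I p) \<le> norm (?h {0<..<t} p)"
      using that(1) by (intro AE_I2) (auto simp: indicator_def)
  qed
  have i1: "integrable ?M (?h {0<..<a})" using a by (intro int') auto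
  have i2: "integrable ?M (?h {a..<t})" using a by (intro int') auto
  have "duh f x t = (LINT p|?M. ?h {0<..<a} p + ?h {a..<t} p)"
    unfolding duh_def using a by (intro Bochner_Integration.integral_cong) (auto simp: indicator_def)
  also have "\<dots> = (LINT p|?M. ?h {0<..<a} p) + (LINT p|?M. ?h {a..<t} p)"
    by (rule Bochner_Integration.integral_add[OF i1 i2])
  finally have eq: "duh f x t - (LINT p|?M. ?h {0<..<a} p) = (LINT p|?M. ?h {a..<t} p)" by simp
  have "ennreal (norm (LINT p|?M. ?h {a..<t} p)) \<le> (\<integral>\<^sup>+p. ennreal (norm (?h {a..<t} p)) \<partial>?M)"
    by (rule integral_norm_bound_ennreal[OF i2])
  also have "\<dots> \<le> (\<integral>\<^sup>+(s, y). indicator {a..<t} s * (ennreal (c * B) * ennreal (kern d (x - y) (t - s))) \<partial>?M)"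
  proof (rule nn_integral_mono)
    fix p :: "real \<times> 'a"
    obtain s y where p: "p = (s, y)" by (cases p)
    show "ennreal (norm (?h {a..<t} p)) \<le> (case p of (s, y) \<Rightarrow> indicator {a..<t} s * (ennreal (c * B) * ennreal (kern d (x - y) (t - s))))"
    proof (cases "s \<in> {a..<t}")
      case True
      have "\<bar>gpos (x - y) (t - s)\<bar> * \<bar>f y s\<bar> \<le> (c * kern d (x - y) (t - s)) * B"
        using True B by (intro mult_mono gpos_le) (auto intro: order_trans[OF abs_ge_zero gpos_le])
      then show ?thesis
        using True B c by (simp add: p abs_mult ennreal_mult'[symmetric] mult_ac ennreal_leI)
    qed (simp add: p)
  qed
  also have "\<dots> = (\<integral>\<^sup>+s. (\<integral>\<^sup>+y. indicator {a..<t} s * (ennreal (c * B) * ennreal (kern d (x - y) (t - s))) \<partial>lborel) \<partial>lborel)"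
    by (subst lborel.nn_integral_fst[symmetric]) (simp_all add: case_prod_unfold)
  also have "\<dots> = (\<integral>\<^sup>+s. ennreal (c * B) * ennreal ?\<kappa> * indicator {a..<t} s \<partial>lborel)"
    using d by (intro nn_integral_cong) (auto simp: indicator_def nn_integral_cmult nn_integral_kern_diff)
  also have "\<dots> = ennreal (c * B * ?\<kappa> * (t - a))"
    using a B c kern_mass_nonneg[of d, where 'a='a]
    by (subst nn_integral_cmult_indicator) (auto simp: ennreal_mult'[symmetric])
  finally have "norm (LINT p|?M. ?h {a..<t} p) \<le> c * B * ?\<kappa> * (t - a)"
    using a B c kern_mass_nonneg[of d, where 'a='a] by (subst (asm) ennreal_le_iff) auto
  then show ?thesis unfolding eq[symmetric] by simp
qed

text \<open>The part of the Duhamel integral with \<open>s\<close> near \<open>t\<close> is uniformly small, since \<open>f\<close> is bounded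
  there; on the rest dominated convergence applies.\<close>

lemma duh_tendsto:
  assumes [measurable]: "st_measurable f"
    and fin: "\<And>x t. 0 < t \<Longrightarrow> ennreal t < T \<Longrightarrow> duhK (\<lambda>y s. \<bar>f y s\<bar>) x t < \<infinity>"
    and bdd: "\<And>\<tau>. \<tau> > 0 \<Longrightarrow> \<exists>B. \<forall>y s. \<tau> < s \<longrightarrow> ennreal s < T \<longrightarrow> \<bar>f y s\<bar> \<le> B"
    and x: "x \<longlonglongrightarrow> x0" and t: "t \<longlonglongrightarrow> t0" and t0: "t0 > 0" "ennreal t0 < T"
    and tT: "\<And>n. 0 < t n \<and> ennreal (t n) < T"
  shows "(\<lambda>n. duh f (x n) (t n)) \<longlonglongrightarrow> duh f x0 t0"
proof (rule tendstoI)
  fix e :: real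
  assume e: "e > 0"
  let ?M = "lborel \<Otimes>\<^sub>M lborel :: (real \<times> 'a) measure" and ?\<kappa> = "kern_mass d TYPE('a)"
  let ?C = "2 * (2 powr (1 / d) + 1) powr (real DIM('a) + d)"
  obtain B0 where B0: "\<And>y s. t0 / 3 < s \<Longrightarrow> ennreal s < T \<Longrightarrow> \<bar>f y s\<bar> \<le> B0"
    using bdd[of "t0 / 3"] t0 by auto
  define B where "B = max B0 0"
  have B: "B \<ge> 0" "\<And>y s. t0 / 3 < s \<Longrightarrow> ennreal s < T \<Longrightarrow> \<bar>f y s\<bar> \<le> B"
    using B0 by (auto simp: B_def le_max_iff_disj)
  define A where "A = c * B * ?\<kappa>"
  have A: "A \<ge> 0" using c B kern_mass_nonneg[of d, where 'a='a] by (simp add: A_def)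
  \<comment> \<open>The tail estimate is used on intervals of length at most
    \<open>2 * \<eta>\<close>. The denominator \<open>A + 1\<close> allows \<open>A = 0\<close>, and
    \<open>\<eta> \<le> t0 / 2\<close> keeps the cut above \<open>t0 / 3\<close>, where
    \<open>B\<close> bounds \<open>f\<close>.\<close>
  define \<eta> where "\<eta> = min (t0 / 2) (e / (6 * (A + 1)))"
  have \<eta>: "\<eta> > 0" "\<eta> \<le> t0 / 2" "A * (2 * \<eta>) \<le> e / 3"
  proof -
    show "\<eta> > 0" using t0 e A by (auto simp: \<eta>_def)
    show "\<eta> \<le> t0 / 2" unfolding \<eta>_def by (rule min.cobounded1)
    have "A * (2 * \<eta>) \<le> (A + 1) * (2 * (e / (6 * (A + 1))))"
      using \<open>\<eta> > 0\<close> A by (intro mult_mono) (auto simp: \<eta>_def)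
    also have "\<dots> = e / 3" using A by (simp add: field_simps)
    finally show "A * (2 * \<eta>) \<le> e / 3" .
  qed
  \<comment> \<open>Cutting at distance \<open>\<eta>\<close> while \<open>t n\<close> stays within
    \<open>\<eta> / 2\<close> of \<open>t0\<close> leaves \<open>t n - s > \<eta> / 2\<close> for
    \<open>s < a\<close>, and \<open>t n - s\<close> and \<open>t0 - s\<close> within a factor 2 of
    each other, as Harnack's inequality requires.\<close>
  define a where "a = t0 - \<eta>"
  have a: "0 < a" "t0 / 3 < a" "a < t0" using \<eta> t0 by (auto simp: a_def)
  define P where "P x t = (LINT (s, y)|?M. indicator {0<..<a} s * (gpos (x - y) (t - s) * f y s))" for x t
  have tail: "\<bar>duh f x t - P x t\<bar> \<le> e / 3" if "a < t" "t \<le> t0 + \<eta>" "ennreal t < T" for x t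
  proof -
    have "\<bar>duh f x t - P x t\<bar> \<le> A * (t - a)"
      unfolding P_def A_def
    proof (rule duh_split[OF assms(1)])
      show "\<bar>f y s\<bar> \<le> B" if "a \<le> s" "s < t" for y s
        using that a order.strict_trans1[OF ennreal_leI[of s t] \<open>ennreal t < T\<close>] by (intro B) auto
    qed (use that a B fin in auto)
    also have "\<dots> \<le> A * (2 * \<eta>)" using that A by (intro mult_left_mono) (auto simp: a_def)
    finally show ?thesis using \<eta> by simp
  qed
  have "eventually (\<lambda>n. t n > t0 - \<eta> / 2) sequentially" "eventually (\<lambda>n. t n < t0 + \<eta> / 2) sequentially"
    using \<eta> by (auto intro!: order_tendstoD[OF t])
  moreover have "eventually (\<lambda>n. dist (x n) x0 < (\<eta> / 2) powr (1 / d)) sequentially"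
    using x \<eta> by (intro tendstoD) auto
  ultimately have ev: "eventually (\<lambda>n. t n > t0 - \<eta> / 2 \<and> t n < t0 + \<eta> / 2 \<and> dist (x n) x0 < (\<eta> / 2) powr (1 / d)) sequentially"
    by eventually_elim auto
  then obtain n0 where n0: "\<And>n. n \<ge> n0 \<Longrightarrow> t n > t0 - \<eta> / 2 \<and> t n < t0 + \<eta> / 2 \<and> dist (x n) x0 < (\<eta> / 2) powr (1 / d)"
    by (auto simp: eventually_sequentially)
  have "(\<lambda>n. P (x (n + n0)) (t (n + n0))) \<longlonglongrightarrow> P x0 t0"
    unfolding P_def
  proof (rule integral_dominated_convergence)
    let ?w = "\<lambda>(s, y). c * ?C * (indicator {0<..<t0} s * (kern d (x0 - y) (t0 - s) * \<bar>f y s\<bar>))"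
    have "(\<integral>\<^sup>+p. ennreal (norm (case p of (s, y) \<Rightarrow> indicator {0<..<t0} s * (kern d (x0 - y) (t0 - s) * \<bar>f y s\<bar>))) \<partial>?M)
       = duhK (\<lambda>y s. \<bar>f y s\<bar>) x0 t0"
      by (subst duhK_pair) (auto intro!: nn_integral_cong simp: indicator_def ennreal_mult' kern_nonneg abs_mult split: prod.splits)
    then have "integrable ?M (\<lambda>(s, y). indicator {0<..<t0} s * (kern d (x0 - y) (t0 - s) * \<bar>f y s\<bar>))"
      using fin[OF t0, of x0] by (intro integrableI_bounded) auto
    from integrable_mult_right[OF this, of "c * ?C"] show "integrable ?M ?w"
      by (simp add: case_prod_unfold)
    show "AE p in ?M. (\<lambda>n. case p of (s, y) \<Rightarrow> indicator {0<..<a} s * (gpos (x (n + n0) - y) (t (n + n0) - s) * f y s))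
        \<longlonglongrightarrow> (case p of (s, y) \<Rightarrow> indicator {0<..<a} s * (gpos (x0 - y) (t0 - s) * f y s))"
    proof (rule AE_I2)
      fix p :: "real \<times> 'a"
      obtain s y where p: "p = (s, y)" by (cases p)
      show "(\<lambda>n. case p of (s, y) \<Rightarrow> indicator {0<..<a} s * (gpos (x (n + n0) - y) (t (n + n0) - s) * f y s))
        \<longlonglongrightarrow> (case p of (s, y) \<Rightarrow> indicator {0<..<a} s * (gpos (x0 - y) (t0 - s) * f y s))"
      proof (cases "s < a")
        case True
        then show ?thesis unfolding p prod.case using a
          by (intro tendsto_intros gpos_tendsto LIMSEQ_ignore_initial_segment x t) auto
      qed (simp add: p)
    qed
    show "AE p in ?M. norm (case p of (s, y) \<Rightarrow> indicator {0<..<a} s * (gpos (x (n + n0) - y) (t (n + n0) - s) * f y s)) \<le> ?w p" for n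
    proof (rule AE_I2)
      fix p :: "real \<times> 'a"
      obtain s y where p: "p = (s, y)" by (cases p)
      let ?x = "x (n + n0)" and ?t = "t (n + n0)"
      have n: "?t > t0 - \<eta> / 2" "?t < t0 + \<eta> / 2" "dist ?x x0 < (\<eta> / 2) powr (1 / d)" using n0[of "n + n0"] by auto
      show "norm (case p of (s, y) \<Rightarrow> indicator {0<..<a} s * (gpos (?x - y) (?t - s) * f y s)) \<le> ?w p"
      proof (cases "s \<in> {0<..<a}")
        case True
        have le: "\<eta> / 2 \<le> ?t - s" using True n by (auto simp: a_def)
        have "(\<eta> / 2) powr (1 / d) \<le> (?t - s) powr (1 / d)"
          using le \<eta> d by (intro powr_mono2) auto
        then have "kern d (?x - y) (?t - s) \<le> ?C * kern d (x0 - y) (t0 - s)"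
          using n True \<eta> by (intro kern_harnack[OF d]) (auto simp: dist_norm a_def)
        then have "c * kern d (?x - y) (?t - s) \<le> c * (?C * kern d (x0 - y) (t0 - s))"
          using c by (intro mult_left_mono) auto
        moreover have "\<bar>gpos (?x - y) (?t - s)\<bar> \<le> c * kern d (?x - y) (?t - s)"
          using le \<eta> by (intro gpos_le) auto
        ultimately have "\<bar>gpos (?x - y) (?t - s)\<bar> * \<bar>f y s\<bar> \<le> c * (?C * kern d (x0 - y) (t0 - s)) * \<bar>f y s\<bar>"
          by (intro mult_right_mono) auto
        then show ?thesis using True a by (simp add: p abs_mult mult_ac)
      next
        case False
        have "0 \<le> c * ?C * (kern d (x0 - y) (t0 - s) * \<bar>f y s\<bar>)" if "s < t0"
          using c that by (intro mult_nonneg_nonneg kern_nonneg) auto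
        then show ?thesis using False by (auto simp: p indicator_def)
      qed
    qed
  qed measurable
  then have "(\<lambda>n. P (x n) (t n)) \<longlonglongrightarrow> P x0 t0" by (rule LIMSEQ_offset)
  then have "eventually (\<lambda>n. dist (P (x n) (t n)) (P x0 t0) < e / 3) sequentially"
    using e by (intro tendstoD) auto
  then show "eventually (\<lambda>n. dist (duh f (x n) (t n)) (duh f x0 t0) < e) sequentially"
    using ev
  proof eventually_elim
    case (elim n)
    have "\<bar>duh f (x n) (t n) - P (x n) (t n)\<bar> \<le> e / 3" using elim tT[of n] \<eta> by (intro tail) (auto simp: a_def)
    moreover have "\<bar>duh f x0 t0 - P x0 t0\<bar> \<le> e / 3" using t0 a \<eta> by (intro tail) auto
    moreover have "\<bar>\<alpha> - \<beta>\<bar> < r" if "\<bar>\<alpha> - \<alpha>'\<bar> \<le> r / 3" "\<bar>\<beta> - \<beta>'\<bar> \<le> r / 3" "\<bar>\<alpha>' - \<beta>'\<bar> < r / 3"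
      for \<alpha> \<alpha>' \<beta> \<beta>' r :: real using that by arith
    ultimately show ?case using elim(1) unfolding dist_real_def by blast
  qed
qed

end

section \<open>The fixed point\<close>

lemma open_time_domain: "open {t. 0 < t \<and> ennreal t < T}"
proof -
  have "continuous_on UNIV (\<lambda>t. ennreal t)" by (intro continuous_on_ennreal continuous_on_id)
  then show ?thesis by (intro open_Collect_conj open_Collect_less continuous_on_const continuous_on_id)
qed

context dominated_kernel
begin

lemma duhK_mono:
  assumes [measurable]: "st_measurable h"
    and A: "A \<ge> 0" and le: "\<And>y s. 0 < s \<Longrightarrow> s < t \<Longrightarrow> f y s \<le> A * h y s"
  shows "duhK f x t \<le> ennreal A * duhK h x t"
proof -
  have "duhK f x t \<le> (\<integral>\<^sup>+s. ennreal A * (kern_conv d (\<lambda>y. ennreal (h y s)) x (t - s) * indicator {0<..<t} s) \<partial>lborel)"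
    unfolding duhK_def
  proof (rule nn_integral_mono)
    fix s :: real
    show "kern_conv d (\<lambda>y. ennreal (f y s)) x (t - s) * indicator {0<..<t} s
      \<le> ennreal A * (kern_conv d (\<lambda>y. ennreal (h y s)) x (t - s) * indicator {0<..<t} s)"
    proof (cases "s \<in> {0<..<t}")
      case True
      have "kern_conv d (\<lambda>y. ennreal (f y s)) x (t - s)
        \<le> (\<integral>\<^sup>+y. ennreal A * (ennreal (kern d (x - y) (t - s)) * ennreal (h y s)) \<partial>lborel)"
      proof (rule nn_integral_mono)
        fix y
        have "ennreal (f y s) \<le> ennreal A * ennreal (h y s)"
          using le[of s y] True A by (simp add: ennreal_mult'[symmetric] ennreal_leI)
        then have "ennreal (kern d (x - y) (t - s)) * ennreal (f y s)
            \<le> ennreal (kern d (x - y) (t - s)) * (ennreal A * ennreal (h y s))"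
          by (intro mult_left_mono) auto
        then show "ennreal (kern d (x - y) (t - s)) * ennreal (f y s)
            \<le> ennreal A * (ennreal (kern d (x - y) (t - s)) * ennreal (h y s))"
          by (simp add: mult.left_commute)
      qed
      also have "\<dots> = ennreal A * kern_conv d (\<lambda>y. ennreal (h y s)) x (t - s)"
        by (rule nn_integral_cmult) measurable
      finally show ?thesis using True by simp
    qed simp
  qed
  also have "\<dots> = ennreal A * duhK h x t"
    unfolding duhK_def by (rule nn_integral_cmult) measurable
  finally show ?thesis .
qed

lemma duh_diff:
  assumes [measurable]: "st_measurable f"
    "st_measurable h"
    and "duhK (\<lambda>y s. \<bar>f y s\<bar>) x t < \<infinity>" "duhK (\<lambda>y s. \<bar>h y s\<bar>) x t < \<infinity>"
  shows "duh f x t - duh h x t = duh (\<lambda>y s. f y s - h y s) x t"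
  unfolding duh_def
  by (subst Bochner_Integration.integral_diff[symmetric])
    (use duh_integrable(1)[OF assms(1,3)] duh_integrable(1)[OF assms(2,4)]
      in \<open>auto simp: case_prod_unfold right_diff_distrib\<close>)

text \<open>On |u| \<le> 2 V the linear part contributes at most V and the Duhamel part at most c
  2^p \<delta> V \<le> V / 2, so the set is mapped into itself. If |u - v| \<le> e V, the p-th
  powers differ by at most p 2^(p-1) e V^p, and the images by at most c p 2^(p-1) \<delta> e V \<le>
  (e / 4) V: this is where the condition on \<open>\<delta>\<close> comes from.\<close>

theorem ex_fixed_point:
  fixes T :: ennreal and V :: "'a \<Rightarrow> real \<Rightarrow> real"
  assumes p: "p > 1" and \<phi>[measurable]: "\<phi> \<in> borel_measurable borel"
    and V_meas[measurable]: "st_measurable V"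
    and V0: "\<And>x t. 0 < t \<Longrightarrow> ennreal t < T \<Longrightarrow> V x t \<ge> 0"
    and lin: "\<And>x t. 0 < t \<Longrightarrow> ennreal t < T \<Longrightarrow>
      ennreal c * kern_conv d (\<lambda>y. ennreal \<bar>\<phi> y\<bar>) x t \<le> ennreal (V x t)"
    and non: "\<And>x t. 0 < t \<Longrightarrow> ennreal t < T \<Longrightarrow> duhK (\<lambda>y s. V y s powr p) x t \<le> ennreal (\<delta> * V x t)"
    and \<delta>: "\<delta> \<ge> 0" "c * p * 2 powr p * \<delta> \<le> 1 / 2"
    and bdd: "\<And>\<tau>. \<tau> > 0 \<Longrightarrow> \<exists>B. \<forall>y s. \<tau> < s \<longrightarrow> ennreal s < T \<longrightarrow> V y s \<le> B"
  shows "\<exists>u. st_measurable u \<and>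
    continuous_on (UNIV \<times> {t. 0 < t \<and> ennreal t < T}) (\<lambda>(x, t). u x t) \<and>
    (\<forall>x t. 0 < t \<longrightarrow> ennreal t < T \<longrightarrow> \<bar>u x t\<bar> \<le> 2 * V x t \<and>
      duhK (\<lambda>y s. \<bar>u y s\<bar> powr p) x t < \<infinity> \<and>
      u x t = linpart \<phi> x t + duh (\<lambda>y s. \<bar>u y s\<bar> powr p) x t)"
proof -
  define S where "S = {t. 0 < t \<and> ennreal t < T}"
  have S: "open S" unfolding S_def by (rule open_time_domain)
  have Sless: "s \<in> S" if "0 < s" "s < t" "t \<in> S" for s t
    using that order.strict_trans1[OF ennreal_leI[of s t]] by (auto simp: S_def)

  define good where "good u \<longleftrightarrow> st_measurable u \<and> (\<forall>x. \<forall>t\<in>S. \<bar>u x t\<bar> \<le> 2 * V x t)"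
    for u :: "'a \<Rightarrow> real \<Rightarrow> real"
  \<comment> \<open>The value 0 outside the time domain makes iterates total functions, measurable
    on all of space-time.\<close>
  define F where "F u x t = (if t \<in> S then linpart \<phi> x t + duh (\<lambda>y s. \<bar>u y s\<bar> powr p) x t else 0)"
    for u :: "'a \<Rightarrow> real \<Rightarrow> real" and x t
  have pw[measurable]: "st_measurable (\<lambda>y s. \<bar>u y s\<bar> powr p)" if "good u" for u
  proof -
    have [measurable]: "st_measurable u" using that by (simp add: good_def)
    show ?thesis by measurable
  qed
  have fin: "duhK (\<lambda>y s. \<bar>\<bar>u y s\<bar> powr p\<bar>) x t \<le> ennreal (2 powr p * \<delta> * V x t)" if u: "good u" and t: "t \<in> S" for u x t
  proof -
    have "duhK (\<lambda>y s. \<bar>\<bar>u y s\<bar> powr p\<bar>) x t \<le> ennreal (2 powr p) * duhK (\<lambda>y s. V y s powr p) x t"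
    proof (rule duhK_mono)
      fix y s assume s: "0 < s" "s < t"
      then have sS: "s \<in> S" using Sless t by blast
      have "\<bar>u y s\<bar> powr p \<le> (2 * V y s) powr p"
        using u sS p by (intro powr_mono2) (auto simp: good_def)
      then show "\<bar>\<bar>u y s\<bar> powr p\<bar> \<le> 2 powr p * V y s powr p"
        using V0[of s y] sS by (simp add: powr_mult S_def)
    qed simp_all
    also have "\<dots> \<le> ennreal (2 powr p) * ennreal (\<delta> * V x t)"
      using t by (intro mult_left_mono non) (auto simp: S_def)
    also have "\<dots> = ennreal (2 powr p * (\<delta> * V x t))"
      by (rule ennreal_mult'[symmetric]) simp
    finally show ?thesis by (simp add: mult_ac)
  qed
  have fin': "duhK (\<lambda>y s. \<bar>\<bar>u y s\<bar> powr p\<bar>) x t < \<infinity>" if "good u" "t \<in> S" for u x t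
    using order.strict_trans1[OF fin[OF that]] by simp
  have linfin: "kern_conv d (\<lambda>y. ennreal \<bar>\<phi> y\<bar>) x t < \<infinity>" if "t \<in> S" for x t
  proof -
    have "ennreal c * kern_conv d (\<lambda>y. ennreal \<bar>\<phi> y\<bar>) x t < \<infinity>"
      using that by (intro order.strict_trans1[OF lin]) (auto simp: S_def)
    then show ?thesis using c by (auto simp: ennreal_mult_less_top)
  qed
  have half: "c * (2 powr p * \<delta> * v) \<le> v / 2" if "v \<ge> 0" for v
  proof -
    have "c * 2 powr p * \<delta> * 1 \<le> c * 2 powr p * \<delta> * p"
      using p c \<delta> by (intro mult_left_mono) auto
    also have "\<dots> \<le> 1 / 2" using \<delta> by (simp add: mult_ac)
    finally have "(c * 2 powr p * \<delta>) * v \<le> (1 / 2) * v" using that by (intro mult_right_mono) auto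
    then show ?thesis by (simp add: mult_ac)
  qed
  have F_bd: "\<bar>F u x t\<bar> \<le> 2 * V x t" if u: "good u" and t: "t \<in> S" for u x t
  proof -
    have Vt: "V x t \<ge> 0" and t0: "t > 0" using t V0 by (auto simp: S_def)
    have "\<bar>linpart \<phi> x t\<bar> \<le> enn2real (ennreal c * kern_conv d (\<lambda>y. ennreal \<bar>\<phi> y\<bar>) x t)"
      by (rule linpart_integrable(2)[OF \<phi> t0 linfin[OF t]])
    also have "\<dots> \<le> enn2real (ennreal (V x t))"
      using t by (intro enn2real_mono lin) (auto simp: S_def)
    finally have 1: "\<bar>linpart \<phi> x t\<bar> \<le> V x t" using Vt by simp
    have "\<bar>duh (\<lambda>y s. \<bar>u y s\<bar> powr p) x t\<bar> \<le> enn2real (ennreal c * duhK (\<lambda>y s. \<bar>\<bar>u y s\<bar> powr p\<bar>) x t)"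
      by (rule duh_integrable(2)[OF pw[OF u] fin'[OF u t]])
    also have "\<dots> \<le> enn2real (ennreal c * ennreal (2 powr p * \<delta> * V x t))"
      by (intro enn2real_mono mult_left_mono fin u t) (auto simp: ennreal_mult_less_top)
    also have "\<dots> = c * (2 powr p * \<delta> * V x t)"
      using c \<delta> Vt by (simp add: ennreal_mult'[symmetric])
    also have "\<dots> \<le> V x t / 2" by (rule half[OF Vt])
    finally show ?thesis using 1 Vt t by (simp add: F_def)
  qed
  have F_cont: "continuous_on (UNIV \<times> S) (\<lambda>(x, t). F u x t)" if u: "good u" for u
    unfolding continuous_on_sequentially
  proof (intro ballI allI impI, elim conjE)
    fix q :: "nat \<Rightarrow> 'a \<times> real" and a
    assume a: "a \<in> UNIV \<times> S" and q: "\<forall>n. q n \<in> UNIV \<times> S" "q \<longlonglongrightarrow> a"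
    have x: "(\<lambda>n. fst (q n)) \<longlonglongrightarrow> fst a" and t: "(\<lambda>n. snd (q n)) \<longlonglongrightarrow> snd a"
      by (intro tendsto_intros q)+
    have qS: "snd (q n) \<in> S" "snd a \<in> S" for n using a q by (auto simp: mem_Times_iff)
    have 1: "(\<lambda>n. linpart \<phi> (fst (q n)) (snd (q n))) \<longlonglongrightarrow> linpart \<phi> (fst a) (snd a)"
      by (rule linpart_tendsto[OF \<phi> _ linfin x t]) (use qS in \<open>auto simp: S_def\<close>)
    have 2: "(\<lambda>n. duh (\<lambda>y s. \<bar>u y s\<bar> powr p) (fst (q n)) (snd (q n))) \<longlonglongrightarrow> duh (\<lambda>y s. \<bar>u y s\<bar> powr p) (fst a) (snd a)"
    proof (rule duh_tendsto[OF pw[OF u] _ _ x t, where T = T])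
      show "duhK (\<lambda>y s. \<bar>\<bar>u y s\<bar> powr p\<bar>) x t < \<infinity>" if "0 < t" "ennreal t < T" for x t
        using that by (intro fin'[OF u]) (simp add: S_def)
      show "\<exists>B. \<forall>y s. \<tau> < s \<longrightarrow> ennreal s < T \<longrightarrow> \<bar>\<bar>u y s\<bar> powr p\<bar> \<le> B" if \<tau>: "\<tau> > 0" for \<tau>
      proof -
        obtain B where B: "\<And>y s. \<tau> < s \<Longrightarrow> ennreal s < T \<Longrightarrow> V y s \<le> B" using bdd[OF \<tau>] by blast
        have "\<bar>u y s\<bar> powr p \<le> (2 * B) powr p" if "\<tau> < s" "ennreal s < T" for y s
        proof (rule powr_mono2)
          have "\<bar>u y s\<bar> \<le> 2 * V y s" using u that \<tau> by (auto simp: good_def S_def)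
          then show "\<bar>u y s\<bar> \<le> 2 * B" using B[OF that, of y] by simp
        qed (use p in auto)
        then show ?thesis by (intro exI[of _ "(2 * B) powr p"]) auto
      qed
    qed (use qS in \<open>auto simp: S_def\<close>)
    show "((\<lambda>(x, t). F u x t) \<circ> q) \<longlonglongrightarrow> (\<lambda>(x, t). F u x t) a"
      using tendsto_add[OF 1 2] qS by (simp add: F_def o_def case_prod_unfold)
  qed
  have F_good: "good (F u)" if u: "good u" for u
  proof -
    \<comment> \<open>Measurability is read off from continuity on an open set and vanishing
      elsewhere; afterwards the coordinates are swapped.\<close>
    have "(\<lambda>q. indicator (UNIV \<times> S) q *\<^sub>R (case q of (x, t) \<Rightarrow> F u x t)) \<in> borel_measurable borel"
      by (rule borel_measurable_continuous_on_indicator[OF _ F_cont[OF u]])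
        (intro borel_open open_Times S open_UNIV)
    also have "(\<lambda>q. indicator (UNIV \<times> S) q *\<^sub>R (case q of (x, t) \<Rightarrow> F u x t)) = (\<lambda>q. F u (fst q) (snd q))"
      by (auto simp: F_def indicator_def)
    finally have 1: "(\<lambda>q. F u (fst q) (snd q)) \<in> borel_measurable borel" .
    have 2: "(\<lambda>q. (snd q, fst q)) \<in> borel_measurable (lborel \<Otimes>\<^sub>M lborel :: (real \<times> 'a) measure)"
      unfolding borel_prod[symmetric] by measurable
    have "st_measurable (F u)"
      using measurable_compose[OF 2 1] by (simp add: case_prod_unfold)
    then show ?thesis using F_bd[OF u] by (simp add: good_def)
  qed
  have F_contr: "\<bar>F u x t - F v x t\<bar> \<le> e / 4 * V x t"
    if u: "good u" and v: "good v" and e: "e \<ge> 0" "\<And>x t. t \<in> S \<Longrightarrow> \<bar>u x t - v x t\<bar> \<le> e * V x t" and t: "t \<in> S" for u v e x t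
  proof -
    let ?w = "\<lambda>y s. \<bar>u y s\<bar> powr p - \<bar>v y s\<bar> powr p"
    let ?A = "p * 2 powr (p - 1) * e"
    have Vt: "V x t \<ge> 0" using t V0 by (auto simp: S_def)
    have A: "?A \<ge> 0" using p e by simp
    have wm: "st_measurable ?w"
      using borel_measurable_diff[OF pw[OF u] pw[OF v]] by (simp add: case_prod_unfold)
    have "duhK (\<lambda>y s. \<bar>?w y s\<bar>) x t \<le> ennreal ?A * duhK (\<lambda>y s. V y s powr p) x t"
    proof (rule duhK_mono[OF _ A])
      fix y s assume s: "0 < s" "s < t"
      then have sS: "s \<in> S" using Sless t by blast
      then have Vs: "V y s \<ge> 0" using V0 by (simp add: S_def)
      have "\<bar>?w y s\<bar> \<le> p * (2 * V y s) powr (p - 1) * \<bar>u y s - v y s\<bar>"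
        using u v sS by (intro abs_powr_diff_le p) (auto simp: good_def)
      also have "\<dots> \<le> p * (2 * V y s) powr (p - 1) * (e * V y s)"
        using p sS by (intro mult_left_mono e) auto
      also have "\<dots> = ?A * (V y s powr (p - 1) * V y s)"
        using Vs by (simp add: powr_mult)
      also have "V y s powr (p - 1) * V y s = V y s powr p"
        using Vs p by (cases "V y s = 0") (simp_all add: powr_diff)
      finally show "\<bar>?w y s\<bar> \<le> ?A * V y s powr p" .
    qed measurable
    also have "\<dots> \<le> ennreal ?A * ennreal (\<delta> * V x t)"
      using t by (intro mult_left_mono non) (auto simp: S_def)
    also have "\<dots> = ennreal (?A * (\<delta> * V x t))"
      using A \<delta> Vt by (intro ennreal_mult'[symmetric]) simp
    finally have le: "duhK (\<lambda>y s. \<bar>?w y s\<bar>) x t \<le> ennreal (?A * (\<delta> * V x t))" .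
    have "F u x t - F v x t = duh ?w x t"
      using t duh_diff[OF pw[OF u] pw[OF v] fin'[OF u t] fin'[OF v t]] by (simp add: F_def)
    also have "\<bar>duh ?w x t\<bar> \<le> enn2real (ennreal c * duhK (\<lambda>y s. \<bar>?w y s\<bar>) x t)"
      by (rule duh_integrable(2)[OF wm order.strict_trans1[OF le]]) simp
    also have "\<dots> \<le> enn2real (ennreal c * ennreal (?A * (\<delta> * V x t)))"
      by (intro enn2real_mono mult_left_mono le) (auto simp: ennreal_mult_less_top)
    also have "\<dots> = c * (?A * (\<delta> * V x t))"
      using c A \<delta> Vt by (simp add: ennreal_mult'[symmetric])
    also have "\<dots> = (c * p * 2 powr p * \<delta>) * (e / 2 * V x t)"
      by (simp add: powr_diff)
    also have "\<dots> \<le> (1 / 2) * (e / 2 * V x t)"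
      using \<delta> e Vt by (intro mult_right_mono) auto
    finally show ?thesis by simp
  qed
  define U where "U n = (F ^^ n) (\<lambda>_ _. 0)" for n
  have U_Suc: "U (Suc n) = F (U n)" for n by (simp add: U_def)
  have U_good: "good (U n)" for n
  proof (induction n)
    case 0
    then show ?case using V0 by (simp add: U_def good_def S_def)
  qed (simp add: U_Suc F_good)
  have U_diff: "\<forall>x. \<forall>t\<in>S. \<bar>U (Suc n) x t - U n x t\<bar> \<le> 2 * (1 / 2) ^ n * V x t" for n
  proof (induction n)
    case 0
    then show ?case using F_bd[OF U_good[of 0]] by (simp add: U_Suc) (simp add: U_def)
  next
    case (Suc n)
    show ?case
    proof (intro allI ballI)
      fix x t assume t: "t \<in> S"
      then have Vt: "V x t \<ge> 0" using V0 by (simp add: S_def)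
      have "\<bar>F (U (Suc n)) x t - F (U n) x t\<bar> \<le> 2 * (1 / 2) ^ n / 4 * V x t"
        using Suc by (intro F_contr U_good t) auto
      also have "\<dots> \<le> 2 * (1 / 2) ^ Suc n * V x t"
        using Vt by (intro mult_right_mono) auto
      finally show "\<bar>U (Suc (Suc n)) x t - U (Suc n) x t\<bar> \<le> 2 * (1 / 2) ^ Suc n * V x t" by (simp only: U_Suc)
    qed
  qed
  have "\<exists>l. (\<lambda>n. U n x t) \<longlonglongrightarrow> l \<and> (t \<in> S \<longrightarrow> (\<forall>n. \<bar>l - U n x t\<bar> \<le> 4 * V x t * (1 / 2) ^ n))" for x t
  proof (cases "t \<in> S")
    case True
    have "\<bar>U (Suc n) x t - U n x t\<bar> \<le> (2 * V x t) * (1 / 2) ^ n" for n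
      using U_diff[of n] True by (simp add: mult_ac)
    from geometric_cauchy_limit[of "\<lambda>n. U n x t", OF this] True show ?thesis by simp
  next
    case False
    have "U n x t = 0" for n
      using False by (cases n) (simp_all add: U_Suc F_def, simp add: U_def)
    then show ?thesis using False by (intro exI[of _ 0]) simp
  qed
  then obtain u where lim: "\<And>x t. (\<lambda>n. U n x t) \<longlonglongrightarrow> u x t"
    and u_diff: "\<And>x t n. t \<in> S \<Longrightarrow> \<bar>u x t - U n x t\<bar> \<le> 4 * V x t * (1 / 2) ^ n" by metis
  have u_good: "good u"
    unfolding good_def
  proof (intro conjI allI ballI)
    show "st_measurable u"
    proof (rule borel_measurable_LIMSEQ_real)
      show "(\<lambda>n. (\<lambda>(s, y). U n y s) q) \<longlonglongrightarrow> (\<lambda>(s, y). u y s) q" for q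
        using lim by (simp add: case_prod_unfold)
      show "st_measurable (U n)" for n
        using U_good[of n] by (simp add: good_def)
    qed
    show "\<bar>u x t\<bar> \<le> 2 * V x t" if "t \<in> S" for x t
      using U_good that
      by (intro LIMSEQ_le_const2[OF tendsto_rabs[OF lim[of x t]]]) (auto simp: good_def)
  qed
  \<comment> \<open>The contraction estimate applies to \<open>u\<close> itself, since
    \<open>u\<close> is good and its distance to \<open>U n\<close> is a small multiple of
    \<open>V\<close>; no limit has to be taken inside the integrals.\<close>
  have u_eq: "u x t = F u x t" if t: "t \<in> S" for x t
  proof -
    have "\<bar>F u x t - U (Suc n) x t\<bar> \<le> 4 * (1 / 2) ^ n / 4 * V x t" for n
      unfolding U_Suc by (intro F_contr u_good U_good t) (use u_diff in \<open>auto simp: mult_ac\<close>)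
    then have le: "\<bar>F u x t - U (Suc n) x t\<bar> \<le> V x t * (1 / 2) ^ n" for n
      by (simp add: mult_ac)
    have "(\<lambda>n. V x t * (1 / 2) ^ n) \<longlonglongrightarrow> V x t * 0"
      by (intro tendsto_intros LIMSEQ_power_zero) simp
    then have "(\<lambda>n. F u x t - U (Suc n) x t) \<longlonglongrightarrow> 0"
      by (intro Lim_null_comparison[of "\<lambda>n. F u x t - U (Suc n) x t"]) (use le in auto)
    moreover have "(\<lambda>n. F u x t - U (Suc n) x t) \<longlonglongrightarrow> F u x t - u x t"
      by (intro tendsto_intros LIMSEQ_Suc lim)
    ultimately show ?thesis using LIMSEQ_unique by fastforce
  qed
  have "continuous_on (UNIV \<times> S) (\<lambda>(x, t). u x t)"
    using F_cont[OF u_good] by (rule continuous_on_eq) (use u_eq in auto)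
  moreover have "duhK (\<lambda>y s. \<bar>u y s\<bar> powr p) x t < \<infinity>" if "t \<in> S" for x t
    using fin'[OF u_good that, of x] by simp
  ultimately show ?thesis
    using u_good u_eq by (intro exI[of _ u]) (auto simp: good_def S_def F_def)
qed

text \<open>The passage from Borel and product integrals to the completed, iterated integrals of
  \<open>is_solution\<close>. The datum is only Lebesgue measurable and is replaced by the Borel
  representative \<open>\<phi>'\<close>. Integrability in \<open>y\<close> is demanded for every
  \<open>s\<close>, whereas Fubini's theorem yields it for almost every one; hence the bound on each
  slice.\<close>

lemma solution_integrals:
  fixes x :: 'a
  assumes t: "0 < t" and \<phi>: "\<phi> \<in> borel_measurable lebesgue" and \<phi>'[measurable]: "\<phi>' \<in> borel_measurable borel"
    and ae: "AE y in lborel. \<phi> y = \<phi>' y"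
    and fin: "kern_conv d (\<lambda>y. ennreal \<bar>\<phi>' y\<bar>) x t < \<infinity>"
    and f[measurable]: "st_measurable f"
    and ffin: "duhK (\<lambda>y s. \<bar>f y s\<bar>) x t < \<infinity>"
    and fbdd: "\<And>s. 0 < s \<Longrightarrow> s < t \<Longrightarrow> \<exists>B. \<forall>y. \<bar>f y s\<bar> \<le> B"
  shows "integrable lebesgue (\<lambda>y. g (x - y) t * \<phi> y)"
    and "(LINT y|lebesgue. g (x - y) t * \<phi> y) = linpart \<phi>' x t"
    and "s \<in> {0<..<t} \<Longrightarrow> integrable lebesgue (\<lambda>y. g (x - y) (t - s) * f y s)"
    and "set_integrable lebesgue {0<..<t} (\<lambda>s. LINT y|lebesgue. g (x - y) (t - s) * f y s)"
    and "(LINT s:{0<..<t}|lebesgue. LINT y|lebesgue. g (x - y) (t - s) * f y s) = duh f x t"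
proof -
  have g: "g (x - y) r = gpos (x - y) r" if "r > 0" for y r using that by (simp add: gpos_def)
  have ae': "AE y in lebesgue. gpos (x - y) t * \<phi> y = gpos (x - y) t * \<phi>' y"
    using AE_completion[OF ae] by eventually_elim simp
  have gm: "(\<lambda>y. gpos (x - y) t) \<in> borel_measurable lebesgue"
    by (rule measurable_completion) measurable
  have m: "(\<lambda>y. gpos (x - y) t * \<phi> y) \<in> borel_measurable lebesgue"
    by (rule borel_measurable_times[OF gm \<phi>])
  have m': "(\<lambda>y. gpos (x - y) t * \<phi>' y) \<in> borel_measurable lebesgue"
    by (rule measurable_completion) measurable
  have int: "integrable lebesgue (\<lambda>y. gpos (x - y) t * \<phi>' y)"
    by (subst integrable_completion) (use linpart_integrable(1)[OF \<phi>' t fin] in auto)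
  show "integrable lebesgue (\<lambda>y. g (x - y) t * \<phi> y)"
    unfolding g[OF t] using int integrable_cong_AE[OF m m' ae'] by simp
  show "(LINT y|lebesgue. g (x - y) t * \<phi> y) = linpart \<phi>' x t"
    unfolding g[OF t] linpart_def integral_cong_AE[OF m m' ae']
    by (rule integral_completion) measurable
  have fm: "(\<lambda>y. f y s) \<in> borel_measurable lborel" for s
    using measurable_Pair2[OF f, of s] by simp
  have inner: "integrable lborel (\<lambda>y. gpos (x - y) (t - s) * f y s)" if s: "s \<in> {0<..<t}" for s
  proof -
    obtain B where B: "\<And>y. \<bar>f y s\<bar> \<le> B" using fbdd[of s] s by auto
    have "integrable lborel (\<lambda>y. kern d (x - y) (t - s))"
      using s d nn_integral_kern_diff[of d "t - s" x]
      by (intro integrableI_bounded) (auto simp: kern_nonneg)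
    then have "integrable lborel (\<lambda>y. c * B * kern d (x - y) (t - s))" by simp
    then show ?thesis
    proof (rule Bochner_Integration.integrable_bound)
      show "(\<lambda>y. gpos (x - y) (t - s) * f y s) \<in> borel_measurable lborel"
        using fm[of s] by measurable
      show "AE y in lborel. norm (gpos (x - y) (t - s) * f y s) \<le> norm (c * B * kern d (x - y) (t - s))"
      proof (rule AE_I2)
        fix y
        have "\<bar>gpos (x - y) (t - s)\<bar> * \<bar>f y s\<bar> \<le> (c * kern d (x - y) (t - s)) * B"
          using s B by (intro mult_mono gpos_le) (auto intro: order_trans[OF abs_ge_zero gpos_le])
        then show "norm (gpos (x - y) (t - s) * f y s) \<le> norm (c * B * kern d (x - y) (t - s))"
          by (simp add: abs_mult[symmetric] mult_ac)
      qed
    qed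
  qed
  show "integrable lebesgue (\<lambda>y. g (x - y) (t - s) * f y s)" if s: "s \<in> {0<..<t}"
    using inner[OF s] s fm[of s] by (simp add: g integrable_completion)
  define J where "J s = (LINT y|lborel. (case (s, y) of (s, y) \<Rightarrow> indicator {0<..<t} s * (gpos (x - y) (t - s) * f y s)))" for s
  have J: "indicator {0<..<t} s *\<^sub>R (LINT y|lebesgue. g (x - y) (t - s) * f y s) = J s" for s
  proof (cases "s \<in> {0<..<t}")
    case True
    have "(\<lambda>y. gpos (x - y) (t - s) * f y s) \<in> borel_measurable lborel"
      using fm[of s] by measurable
    then show ?thesis using True by (simp add: J_def g integral_completion)
  qed (simp add: J_def)
  have pair: "integrable (lborel \<Otimes>\<^sub>M lborel) (\<lambda>(s, y). indicator {0<..<t} s * (gpos (x - y) (t - s) * f y s))"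
    by (rule duh_integrable(1)[OF f ffin])
  have Jint: "integrable lborel J"
    unfolding J_def by (rule lborel_pair.integrable_fst'[OF pair])
  show "set_integrable lebesgue {0<..<t} (\<lambda>s. LINT y|lebesgue. g (x - y) (t - s) * f y s)"
    unfolding set_integrable_def J using Jint by (subst integrable_completion) auto
  show "(LINT s:{0<..<t}|lebesgue. LINT y|lebesgue. g (x - y) (t - s) * f y s) = duh f x t"
    unfolding set_lebesgue_integral_def J duh_def lborel_pair.integral_fst'[OF pair, symmetric]
    unfolding J_def[symmetric] using Jint by (intro integral_completion) auto
qed

end

section \<open>Supersolutions\<close>

text \<open>After Tonelli's theorem the inner integral over \<open>y\<close> is a convolution of two
  kernels translated by \<open>z\<close>, so one constant serves all nonnegative data.\<close>

lemma kern_semigroup_le: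
  assumes d: "d > 0"
  obtains C where "C > 0"
    "\<And>(f :: 'a::euclidean_space \<Rightarrow> ennreal) x t s. f \<in> borel_measurable borel \<Longrightarrow> 0 < s \<Longrightarrow> s < t \<Longrightarrow>
      kern_conv d (\<lambda>y. kern_conv d f y s) x (t - s)
       \<le> ennreal C * kern_conv d f x t"
proof -
  obtain C where C: "C > 0" "\<And>(x::'a) t s. 0 < s \<Longrightarrow> s < t \<Longrightarrow>
      kern_conv d (\<lambda>y. ennreal (kern d y s)) x (t - s) \<le> ennreal (C * kern d x t)"
    using kern_convolution_le[OF d, where 'a='a] by blast
  have "kern_conv d (\<lambda>y. kern_conv d f y s) x (t - s)
       \<le> ennreal C * kern_conv d f x t"
    if f[measurable]: "f \<in> borel_measurable borel" and s: "0 < s" "s < t" for f :: "'a \<Rightarrow> ennreal" and x t s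
  proof -
    have "kern_conv d (\<lambda>y. kern_conv d f y s) x (t - s)
      = (\<integral>\<^sup>+y. (\<integral>\<^sup>+z. ennreal (kern d (x - y) (t - s)) * (ennreal (kern d (y - z) s) * f z) \<partial>lborel) \<partial>lborel)"
      by (simp add: nn_integral_cmult)
    also have "\<dots> = (\<integral>\<^sup>+z. kern_conv d (\<lambda>y. (ennreal (kern d (y - z) s) * f z)) x (t - s) \<partial>lborel)"
      by (rule lborel_pair.Fubini') measurable
    also have "\<dots> \<le> (\<integral>\<^sup>+z. ennreal C * (ennreal (kern d (x - z) t) * f z) \<partial>lborel)"
    proof (rule nn_integral_mono)
      fix z
      have "kern_conv d (\<lambda>y. ennreal (kern d (y - z) s)) x (t - s)
          = (\<integral>\<^sup>+y. ennreal (kern d (x - (z + y)) (t - s)) * ennreal (kern d ((z + y) - z) s) \<partial>lborel)"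
        by (rule nn_integral_lborel_shift[symmetric]) measurable
      also have "\<dots> \<le> ennreal (C * kern d (x - z) t)"
        using C(2)[OF s, of "x - z"] by (simp add: algebra_simps)
      finally have "kern_conv d (\<lambda>y. ennreal (kern d (y - z) s)) x (t - s) * f z
          \<le> ennreal (C * kern d (x - z) t) * f z" by (rule mult_right_mono) simp
      then show "kern_conv d (\<lambda>y. (ennreal (kern d (y - z) s) * f z)) x (t - s)
          \<le> ennreal C * (ennreal (kern d (x - z) t) * f z)"
        using C(1) s by (simp add: nn_integral_multc[symmetric] mult.assoc ennreal_mult' kern_nonneg)
    qed
    also have "\<dots> = ennreal C * kern_conv d f x t"
      by (rule nn_integral_cmult) measurable
    finally show ?thesis .
  qed
  then show ?thesis using C(1) that by blast
qed

text \<open>\<open>\<Psi>\<close> is the inverse of w h(w). \<open>\<eta>\<close> and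
  \<open>H\<close> need only be upper bounds, for the supremum of w^(p-1) / h(w) and for its time
  integral, so that each case can supply explicit expressions. The condition on
  \<open>\<eta>\<close> is stated without division.\<close>

locale mean_bound =
  fixes d p \<delta> :: real and \<phi> :: "real ^ 'n::finite \<Rightarrow> real" and h \<Psi> m \<eta> H :: "real \<Rightarrow> real" and T :: ennreal
  assumes \<phi>: "\<phi> \<in> borel_measurable lebesgue" and hm: "h \<in> borel_measurable borel"
    and \<Psi>m: "\<Psi> \<in> borel_measurable borel" and \<eta>m: "\<eta> \<in> borel_measurable borel"
    and hmono: "\<And>v w. 0 \<le> v \<Longrightarrow> v \<le> w \<Longrightarrow> h v \<le> h w" and hpos: "\<And>w. 0 < w \<Longrightarrow> 0 < h w" and h0: "0 \<le> h 0"
    and \<Psi>: "\<And>z. 0 \<le> z \<Longrightarrow> 0 \<le> \<Psi> z \<and> \<Psi> z * h (\<Psi> z) = z"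
    and mbdd: "\<And>\<tau>. 0 < \<tau> \<Longrightarrow> \<exists>B. \<forall>s. \<tau> < s \<longrightarrow> ennreal s < T \<longrightarrow> m s \<le> B"
    and m0: "\<And>t. 0 < t \<Longrightarrow> ennreal t < T \<Longrightarrow> 0 \<le> m t \<and> 0 \<le> H t \<and> 0 \<le> \<eta> t"
    and Zle: "\<And>x t. 0 < t \<Longrightarrow> ennreal t < T \<Longrightarrow>
       (\<integral>\<^sup>+y. ennreal (kern d (x - y) t) * ennreal (\<bar>\<phi> y\<bar> * h \<bar>\<phi> y\<bar>) \<partial>lebesgue) \<le> ennreal (m t * h (m t))"
    and \<eta>: "\<And>w t. 0 < t \<Longrightarrow> ennreal t < T \<Longrightarrow> 0 < w \<Longrightarrow> w \<le> m t \<Longrightarrow> w powr (p - 1) \<le> h w * \<eta> t"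
    and H: "\<And>t. 0 < t \<Longrightarrow> ennreal t < T \<Longrightarrow> (\<integral>\<^sup>+s\<in>{0<..<t}. ennreal (\<eta> s) \<partial>lborel) \<le> ennreal (H t)"
    and small: "\<And>t. 0 < t \<Longrightarrow> ennreal t < T \<Longrightarrow> h (m t) * H t \<le> \<delta>"

abbreviation has_solution_below ::
  "real \<Rightarrow> real \<Rightarrow> (real ^ 'n::finite \<Rightarrow> real) \<Rightarrow> ennreal \<Rightarrow> (real \<Rightarrow> real) \<Rightarrow> bool" where
  "has_solution_below d p \<phi> T b \<equiv>
    \<exists>u. is_solution d p \<phi> T u \<and> (\<forall>x t. 0 < t \<longrightarrow> ennreal t < T \<longrightarrow> \<bar>u x t\<bar> \<le> b t)"

text \<open>What matters is the order of quantifiers: \<open>\<delta>\<close> and \<open>A\<close>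
  are chosen before the datum, \<open>h\<close> and \<open>T\<close>, so the thresholds of the three
  cases depend on the exponents and the dimension only.\<close>

theorem ex_solution_of_mean_bound:
  fixes d p :: real
  assumes d: "d > 0" and p: "p > 1"
  obtains \<delta> A where "\<delta> > 0" "A > 0"
    "\<And>(\<phi> :: real ^ 'n::finite \<Rightarrow> real) h \<Psi> m \<eta> H T. mean_bound d p \<delta> \<phi> h \<Psi> m \<eta> H T \<Longrightarrow>
      has_solution_below d p \<phi> T (\<lambda>t. A * m t)"
proof -
  define \<kappa> where "\<kappa> = kern_mass d TYPE(real ^ 'n)"
  have \<kappa>: "\<kappa> \<ge> 0" by (simp add: \<kappa>_def kern_mass_nonneg)
  obtain c where c: "c > 0" "\<And>(x :: real ^ 'n) t. t > 0 \<Longrightarrow> \<bar>G d x t\<bar> \<le> c * kern d x t"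
    using G_le_kern[OF d, where 'n='n] by blast
  obtain C where C: "C > 0" "\<And>(f :: real ^ 'n \<Rightarrow> ennreal) x t s. f \<in> borel_measurable borel \<Longrightarrow> 0 < s \<Longrightarrow> s < t \<Longrightarrow>
      kern_conv d (\<lambda>y. kern_conv d f y s) x (t - s)
       \<le> ennreal C * kern_conv d f x t"
    using kern_semigroup_le[OF d, where 'a="real ^ 'n"] by blast
  interpret dominated_kernel d c "G d :: real ^ 'n \<Rightarrow> real \<Rightarrow> real"
    using d c continuous_on_G[OF d] by unfold_locales auto
  \<comment> \<open>The linear part turns out to be at most \<open>c * (\<kappa> + 1) * W\<close>,
    which suggests the weight \<open>V = a * W\<close>.\<close>
  define a where "a = c * (\<kappa> + 1)"
  have a: "a > 0" using c \<kappa> by (simp add: a_def)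
  \<comment> \<open>Rescaling \<open>W\<close> to \<open>a * W\<close> changes the constant of the
    Duhamel estimate from \<open>C * \<delta>\<close> to
    \<open>a powr (p - 1) * C * \<delta>\<close>; this value makes the contraction condition an
    equality.\<close>
  define \<delta> where "\<delta> = 1 / (2 * c * p * 2 powr p * a powr (p - 1) * C)"
  have \<delta>: "\<delta> > 0" using c p a C by (simp add: \<delta>_def)
  show ?thesis
  proof (rule that[of \<delta> "2 * a"])
    fix \<phi> :: "real ^ 'n \<Rightarrow> real" and h \<Psi> m \<eta> H :: "real \<Rightarrow> real" and T :: ennreal
    assume "mean_bound d p \<delta> \<phi> h \<Psi> m \<eta> H T"
    then interpret mean_bound d p \<delta> \<phi> h \<Psi> m \<eta> H T .
    note [measurable] = hm \<Psi>m \<eta>m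
    obtain \<phi>' where \<phi>'[measurable]: "\<phi>' \<in> borel_measurable borel" and ae: "AE y in lborel. \<phi> y = \<phi>' y"
      using completion_ex_borel_measurable_real[OF \<phi>] by auto
    have hnn: "0 \<le> h w" if "0 \<le> w" for w using hmono[of 0 w] h0 that by simp
    define \<Phi> where "\<Phi> y = ennreal (\<bar>\<phi>' y\<bar> * h \<bar>\<phi>' y\<bar>)" for y
    have [measurable]: "\<Phi> \<in> borel_measurable borel" unfolding \<Phi>_def by measurable
    define Z where "Z x t = kern_conv d \<Phi> x t" for x t
    define W where "W x t = \<Psi> (enn2real (Z x t))" for x t
    have Z_le: "Z x t \<le> ennreal (m t * h (m t))" if "0 < t" "ennreal t < T" for x t
    proof -
      have "Z x t = kern_conv d (\<lambda>y. ennreal (\<bar>\<phi> y\<bar> * h \<bar>\<phi> y\<bar>)) x t"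
        unfolding Z_def \<Phi>_def using ae by (intro nn_integral_cong_AE) auto
      then show ?thesis using Zle[OF that] by (simp add: nn_integral_completion)
    qed
    have Z_eq: "Z x t = ennreal (W x t * h (W x t))" "W x t \<ge> 0" if "0 < t" "ennreal t < T" for x t
    proof -
      have "Z x t < top" using Z_le[OF that] by (rule order.strict_trans1) simp
      then show "Z x t = ennreal (W x t * h (W x t))" "W x t \<ge> 0"
        using \<Psi>[of "enn2real (Z x t)"] by (simp_all add: W_def)
    qed
    have W_le: "W x t \<le> m t" if t: "0 < t" "ennreal t < T" for x t
    proof (rule ccontr)
      assume "\<not> W x t \<le> m t"
      then have less: "m t < W x t" by simp
      have mt: "m t \<ge> 0" using m0[OF t] by simp
      have "m t * h (m t) \<le> m t * h (W x t)" using mt less by (intro mult_left_mono hmono) auto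
      also have "\<dots> < W x t * h (W x t)" using less mt by (intro mult_strict_right_mono hpos) auto
      also have "\<dots> \<le> m t * h (m t)"
        using Z_le[OF t, of x] Z_eq[OF t, of x] mt hnn by (subst (asm) Z_eq(1)[OF t]) (simp add: ennreal_le_iff)
      finally show False by simp
    qed
    have W_meas[measurable]: "st_measurable W"
      unfolding W_def Z_def by measurable
    have lin: "kern_conv d (\<lambda>y. ennreal \<bar>\<phi>' y\<bar>) x t \<le> ennreal ((\<kappa> + 1) * W x t)"
      if t: "0 < t" "ennreal t < T" for x t
    proof (cases "W x t = 0")
      \<comment> \<open>Treated apart because \<open>h 0\<close> may vanish: positivity of the
        kernel forces the datum to be 0 almost everywhere.\<close>
      case True
      then have "Z x t = 0" using Z_eq(1)[OF t, of x] by simp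
      then have "AE y in lborel. ennreal (kern d (x - y) t) * \<Phi> y = 0"
        unfolding Z_def by (subst (asm) nn_integral_0_iff_AE) auto
      then have "AE y in lborel. ennreal (kern d (x - y) t) * ennreal \<bar>\<phi>' y\<bar> = 0"
      proof eventually_elim
        case (elim y)
        have "kern d (x - y) t > 0" using t by (intro kern_pos)
        then have "\<bar>\<phi>' y\<bar> * h \<bar>\<phi>' y\<bar> \<le> 0" using elim by (simp add: \<Phi>_def ennreal_eq_0_iff)
        moreover have "\<bar>\<phi>' y\<bar> * h \<bar>\<phi>' y\<bar> > 0" if "\<phi>' y \<noteq> 0"
          using that by (intro mult_pos_pos hpos) auto
        ultimately have "\<phi>' y = 0" by force
        then show ?case by simp
      qed
      then have "kern_conv d (\<lambda>y. ennreal \<bar>\<phi>' y\<bar>) x t = 0"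
        by (subst nn_integral_0_iff_AE) auto
      then show ?thesis by simp
    next
      case False
      define w where "w = W x t"
      have w: "w > 0" using False Z_eq(2)[OF t, of x] by (simp add: w_def)
      have hw: "h w > 0" using hpos[OF w] .
      \<comment> \<open>The substitute for Jensen's inequality. Where the datum exceeds
        \<open>w\<close>, monotonicity gives \<open>h \<bar>\<phi>' y\<bar> \<ge> h w\<close>.
        Integration against the kernel yields \<open>\<kappa> * w + Z / h w\<close>, that is
        \<open>(\<kappa> + 1) * w\<close>.\<close>
      have pt: "\<bar>\<phi>' y\<bar> \<le> w + (1 / h w) * (\<bar>\<phi>' y\<bar> * h \<bar>\<phi>' y\<bar>)" for y
      proof (cases "\<bar>\<phi>' y\<bar> \<le> w")
        case True
        then show ?thesis using hw hnn[of "\<bar>\<phi>' y\<bar>"] by (simp add: add_increasing2)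
      next
        case False
        have "\<bar>\<phi>' y\<bar> * 1 \<le> \<bar>\<phi>' y\<bar> * ((1 / h w) * h \<bar>\<phi>' y\<bar>)"
          using hmono[of w "\<bar>\<phi>' y\<bar>"] w hw False by (intro mult_left_mono) (auto simp: field_simps)
        then show ?thesis using w by (simp add: mult_ac)
      qed
      have "kern_conv d (\<lambda>y. ennreal \<bar>\<phi>' y\<bar>) x t
        \<le> (\<integral>\<^sup>+y. ennreal w * ennreal (kern d (x - y) t) + ennreal (1 / h w) * (ennreal (kern d (x - y) t) * \<Phi> y) \<partial>lborel)"
      proof (rule nn_integral_mono)
        fix y
        have "ennreal (kern d (x - y) t) * ennreal \<bar>\<phi>' y\<bar> \<le> ennreal (kern d (x - y) t) * ennreal (w + (1 / h w) * (\<bar>\<phi>' y\<bar> * h \<bar>\<phi>' y\<bar>))"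
          using pt[of y] by (intro mult_left_mono ennreal_leI) auto
        also have "ennreal (w + (1 / h w) * (\<bar>\<phi>' y\<bar> * h \<bar>\<phi>' y\<bar>)) = ennreal w + ennreal (1 / h w) * \<Phi> y"
          unfolding \<Phi>_def using w hw hnn[of "\<bar>\<phi>' y\<bar>"]
          by (subst ennreal_plus) (auto simp: ennreal_mult'[symmetric])
        finally show "ennreal (kern d (x - y) t) * ennreal \<bar>\<phi>' y\<bar>
          \<le> ennreal w * ennreal (kern d (x - y) t) + ennreal (1 / h w) * (ennreal (kern d (x - y) t) * \<Phi> y)"
          by (simp add: distrib_left mult_ac)
      qed
      also have "\<dots> = ennreal w * ennreal \<kappa> + ennreal (1 / h w) * Z x t"
        using d t by (simp add: nn_integral_add nn_integral_cmult nn_integral_kern_diff Z_def \<kappa>_def)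
      also have "Z x t = ennreal (w * h w)" using Z_eq(1)[OF t] by (simp add: w_def)
      also have "ennreal w * ennreal \<kappa> + ennreal (1 / h w) * ennreal (w * h w) = ennreal ((\<kappa> + 1) * w)"
        using w hw \<kappa> by (simp add: ennreal_mult'[symmetric] ennreal_plus[symmetric] algebra_simps del: ennreal_plus)
      finally show ?thesis by (simp add: w_def)
    qed
    have non: "duhK (\<lambda>y s. W y s powr p) x t \<le> ennreal (C * \<delta> * W x t)" if t: "0 < t" "ennreal t < T" for x t
    proof -
      have sT: "ennreal s < T" if "s < t" for s
        using order.strict_trans1[OF ennreal_leI[of s t] t(2)] that by simp
      have "duhK (\<lambda>y s. W y s powr p) x t \<le> (\<integral>\<^sup>+s. ennreal C * Z x t * (ennreal (\<eta> s) * indicator {0<..<t} s) \<partial>lborel)"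
        unfolding duhK_def
      proof (rule nn_integral_mono)
        fix s
        show "kern_conv d (\<lambda>y. ennreal (W y s powr p)) x (t - s) * indicator {0<..<t} s
            \<le> ennreal C * Z x t * (ennreal (\<eta> s) * indicator {0<..<t} s)"
        proof (cases "s \<in> {0<..<t}")
          case True
          then have s: "0 < s" "s < t" "ennreal s < T" using sT by auto
          have "ennreal (W y s powr p) \<le> ennreal (\<eta> s) * Z y s" for y
          proof (cases "W y s = 0")
            case False
            then have w: "W y s > 0" using Z_eq(2)[OF s(1,3), of y] by simp
            have "W y s powr p = W y s * W y s powr (p - 1)" using w by (simp add: powr_diff)
            also have "\<dots> \<le> W y s * (h (W y s) * \<eta> s)"
              using w by (intro mult_left_mono \<eta> s W_le) auto
            finally have "ennreal (W y s powr p) \<le> ennreal (\<eta> s * (W y s * h (W y s)))"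
              by (intro ennreal_leI) (simp add: mult_ac)
            then show ?thesis using m0[OF s(1,3)] by (simp add: ennreal_mult' Z_eq(1)[OF s(1,3)])
          qed simp
          then have "kern_conv d (\<lambda>y. ennreal (W y s powr p)) x (t - s)
              \<le> (\<integral>\<^sup>+y. ennreal (\<eta> s) * (ennreal (kern d (x - y) (t - s)) * Z y s) \<partial>lborel)"
            by (intro nn_integral_mono) (metis mult.left_commute mult_left_mono zero_le)
          also have "\<dots> = ennreal (\<eta> s) * kern_conv d (\<lambda>y. Z y s) x (t - s)"
            unfolding Z_def by (rule nn_integral_cmult) measurable
          also have "\<dots> \<le> ennreal (\<eta> s) * (ennreal C * Z x t)"
            unfolding Z_def using s by (intro mult_left_mono C) auto
          finally show ?thesis using True by (simp add: mult_ac)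
        qed simp
      qed
      also have "\<dots> = ennreal C * Z x t * (\<integral>\<^sup>+s\<in>{0<..<t}. ennreal (\<eta> s) \<partial>lborel)"
        by (rule nn_integral_cmult) measurable
      also have "\<dots> \<le> ennreal C * Z x t * ennreal (H t)"
        by (intro mult_left_mono H t) simp
      also have "\<dots> = ennreal (C * (W x t * h (W x t)) * H t)"
        using C(1) m0[OF t] Z_eq[OF t, of x] hnn by (simp add: ennreal_mult'[symmetric])
      also have "\<dots> \<le> ennreal (C * \<delta> * W x t)"
      proof (rule ennreal_leI)
        have "h (W x t) * H t \<le> h (m t) * H t"
          using m0[OF t] by (intro mult_right_mono hmono Z_eq W_le t) auto
        also have "\<dots> \<le> \<delta>" by (rule small[OF t])
        finally have "(C * W x t) * (h (W x t) * H t) \<le> (C * W x t) * \<delta>"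
          using C(1) Z_eq(2)[OF t, of x] by (intro mult_left_mono) auto
        then show "C * (W x t * h (W x t)) * H t \<le> C * \<delta> * W x t" by (simp add: mult_ac)
      qed
      finally show ?thesis .
    qed
    define V where "V x t = a * W x t" for x t
    have "\<exists>u. st_measurable u \<and>
      continuous_on (UNIV \<times> {t. 0 < t \<and> ennreal t < T}) (\<lambda>(x, t). u x t) \<and>
      (\<forall>x t. 0 < t \<longrightarrow> ennreal t < T \<longrightarrow> \<bar>u x t\<bar> \<le> 2 * V x t \<and>
        duhK (\<lambda>y s. \<bar>u y s\<bar> powr p) x t < \<infinity> \<and>
        u x t = linpart \<phi>' x t + duh (\<lambda>y s. \<bar>u y s\<bar> powr p) x t)"
    proof (rule ex_fixed_point[OF p \<phi>', where \<delta> = "a powr (p - 1) * C * \<delta>"])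
      show "st_measurable V"
        unfolding V_def by measurable
      show "0 \<le> V x t" if "0 < t" "ennreal t < T" for x t
        using Z_eq(2)[OF that] a by (simp add: V_def)
      show "ennreal c * kern_conv d (\<lambda>y. ennreal \<bar>\<phi>' y\<bar>) x t \<le> ennreal (V x t)"
        if t: "0 < t" "ennreal t < T" for x t
      proof -
        have "ennreal c * kern_conv d (\<lambda>y. ennreal \<bar>\<phi>' y\<bar>) x t \<le> ennreal c * ennreal ((\<kappa> + 1) * W x t)"
          by (intro mult_left_mono lin t) simp
        also have "\<dots> = ennreal (V x t)"
          using c(1) \<kappa> Z_eq(2)[OF t] by (simp add: ennreal_mult'[symmetric] V_def a_def mult_ac)
        finally show ?thesis .
      qed
      show "duhK (\<lambda>y s. V y s powr p) x t \<le> ennreal (a powr (p - 1) * C * \<delta> * V x t)"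
        if t: "0 < t" "ennreal t < T" for x t
      proof -
        have "duhK (\<lambda>y s. V y s powr p) x t \<le> ennreal (a powr p) * duhK (\<lambda>y s. W y s powr p) x t"
        proof (rule duhK_mono)
          fix y s assume s: "0 < s" "s < t"
          then have "W y s \<ge> 0" using order.strict_trans1[OF ennreal_leI[of s t] t(2)] by (intro Z_eq) auto
          then show "V y s powr p \<le> a powr p * W y s powr p" using a by (simp add: V_def powr_mult)
        qed simp_all
        also have "\<dots> \<le> ennreal (a powr p) * ennreal (C * \<delta> * W x t)"
          by (intro mult_left_mono non t) simp
        also have "\<dots> = ennreal (a powr p * (C * \<delta> * W x t))"
          by (rule ennreal_mult'[symmetric]) simp
        also have "a powr p * (C * \<delta> * W x t) = a powr (p - 1) * C * \<delta> * V x t"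
          using a by (simp add: V_def powr_diff)
        finally show ?thesis .
      qed
      show "0 \<le> a powr (p - 1) * C * \<delta>" using C(1) \<delta> by simp
      show "c * p * 2 powr p * (a powr (p - 1) * C * \<delta>) \<le> 1 / 2"
        using c(1) p a C(1) by (simp add: \<delta>_def field_simps)
      show "\<exists>B. \<forall>y s. \<tau> < s \<longrightarrow> ennreal s < T \<longrightarrow> V y s \<le> B" if \<tau>: "0 < \<tau>" for \<tau>
      proof -
        obtain B where B: "\<And>s. \<tau> < s \<Longrightarrow> ennreal s < T \<Longrightarrow> m s \<le> B" using mbdd[OF \<tau>] by blast
        have "V y s \<le> a * B" if "\<tau> < s" "ennreal s < T" for y s
          unfolding V_def using that \<tau> a by (intro mult_left_mono order_trans[OF W_le B]) auto
        then show ?thesis by blast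
      qed
    qed
    then obtain u where um[measurable]: "st_measurable u"
      and ucont: "continuous_on (UNIV \<times> {t. 0 < t \<and> ennreal t < T}) (\<lambda>(x, t). u x t)"
      and u: "\<And>x t. 0 < t \<Longrightarrow> ennreal t < T \<Longrightarrow> \<bar>u x t\<bar> \<le> 2 * V x t"
        "\<And>x t. 0 < t \<Longrightarrow> ennreal t < T \<Longrightarrow> duhK (\<lambda>y s. \<bar>u y s\<bar> powr p) x t < \<infinity>"
        "\<And>x t. 0 < t \<Longrightarrow> ennreal t < T \<Longrightarrow> u x t = linpart \<phi>' x t + duh (\<lambda>y s. \<bar>u y s\<bar> powr p) x t"
      by blast
    have u_le: "\<bar>u x t\<bar> \<le> 2 * a * m t" if "0 < t" "ennreal t < T" for x t
    proof -
      have "2 * a * W x t \<le> 2 * a * m t" using a by (intro mult_left_mono W_le that) auto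
      then show ?thesis using u(1)[OF that, of x] by (simp add: V_def)
    qed
    have "is_solution d p \<phi> T u"
      unfolding is_solution_def Let_def
    proof (intro conjI allI impI)
      fix \<tau> :: real assume \<tau>: "0 < \<tau>" "ennreal \<tau> < T"
      obtain B where B: "\<And>s. \<tau> < s \<Longrightarrow> ennreal s < T \<Longrightarrow> m s \<le> B" using mbdd[OF \<tau>(1)] by blast
      have "\<bar>u x t\<bar> \<le> 2 * a * B" if "\<tau> < t" "ennreal t < T" for x t
        using u_le[of t x] B[OF that] that \<tau> a by (smt (verit) mult_left_mono)
      then show "bounded ((\<lambda>(x, t). u x t) ` (UNIV \<times> {t. \<tau> < t \<and> ennreal t < T}))"
        by (auto intro!: boundedI[of _ "2 * a * B"])
      show "continuous_on (UNIV \<times> {t. \<tau> < t \<and> ennreal t < T}) (\<lambda>(x, t). u x t)"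
        by (rule continuous_on_subset[OF ucont]) (use \<tau> in auto)
    next
      fix x t assume t: "0 < t" "ennreal t < T"
      have fm: "st_measurable (\<lambda>y s. \<bar>u y s\<bar> powr p)" by measurable
      have ffin: "duhK (\<lambda>y s. \<bar>\<bar>u y s\<bar> powr p\<bar>) x t < \<infinity>" using u(2)[OF t] by simp
      have fbdd: "\<exists>B. \<forall>y. \<bar>\<bar>u y s\<bar> powr p\<bar> \<le> B" if s: "0 < s" "s < t" for s
      proof -
        have "ennreal s < T" using order.strict_trans1[OF ennreal_leI[of s t] t(2)] s by simp
        then have "\<bar>u y s\<bar> powr p \<le> (2 * a * m s) powr p" for y
          using s p by (intro powr_mono2 u_le) auto
        then show ?thesis by auto
      qed
      have linf: "kern_conv d (\<lambda>y. ennreal \<bar>\<phi>' y\<bar>) x t < \<infinity>"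
        using lin[OF t, of x] by (rule order.strict_trans1) simp
      note I = solution_integrals[OF t(1) \<phi> \<phi>' ae linf fm ffin fbdd]
      show "integrable lebesgue (\<lambda>y. G d (x - y) t * \<phi> y)" by (rule I(1))
      show "\<forall>s\<in>{0<..<t}. integrable lebesgue (\<lambda>y. G d (x - y) (t - s) * \<bar>u y s\<bar> powr p)"
        using I(3) by blast
      show "set_integrable lebesgue {0<..<t} (\<lambda>s. LINT y|lebesgue. G d (x - y) (t - s) * \<bar>u y s\<bar> powr p)"
        by (rule I(4))
      show "u x t = (LINT y|lebesgue. G d (x - y) t * \<phi> y) +
          (LINT s:{0<..<t}|lebesgue. LINT y|lebesgue. G d (x - y) (t - s) * \<bar>u y s\<bar> powr p)"
        using u(3)[OF t, of x] I(2) I(5) by simp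
    qed
    then show "has_solution_below d p \<phi> T (\<lambda>t. 2 * a * m t)"
      using u_le by blast
  qed (use \<delta> a in auto)
qed

section \<open>The three cases\<close>

text \<open>Since \<open>\<eta>\<close> may blow up at 0, the fundamental theorem is used on
  \<open>[t / (n + 1), t]\<close> and followed by monotone convergence; the lower boundary term is
  dropped by its sign.\<close>

lemma nn_integral_deriv_le:
  fixes H \<eta> :: "real \<Rightarrow> real"
  assumes t: "t > 0" and [measurable]: "\<eta> \<in> borel_measurable borel"
    and H: "\<And>s. 0 < s \<Longrightarrow> s \<le> t \<Longrightarrow> (H has_real_derivative \<eta> s) (at s)"
    and pos: "\<And>s. 0 < s \<Longrightarrow> s \<le> t \<Longrightarrow> \<eta> s \<ge> 0 \<and> H s \<ge> 0"
  shows "(\<integral>\<^sup>+s\<in>{0<..<t}. ennreal (\<eta> s) \<partial>lborel) \<le> ennreal (H t)"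
proof -
  define a where "a n = t / (real n + 1)" for n
  have a: "0 < a n" "a n \<le> t" for n using t by (auto simp: a_def field_simps)
  have a_mono: "a n \<le> a m" if "m \<le> n" for m n
    using t that by (simp add: a_def frac_le)
  let ?f = "\<lambda>n s. ennreal (\<eta> s) * indicator {a n..t} s"
  have "ennreal (\<eta> s) * indicator {0<..<t} s \<le> (SUP n. ?f n s)" for s
  proof (cases "s \<in> {0<..<t}")
    case True
    obtain n where "t / s < real n" using reals_Archimedean2 by blast
    then have "a n \<le> s" using True t by (simp add: a_def field_simps)
    then have "ennreal (\<eta> s) * indicator {0<..<t} s \<le> ?f n s" using True by simp
    then show ?thesis by (rule SUP_upper2[OF UNIV_I])
  qed simp
  then have "(\<integral>\<^sup>+s\<in>{0<..<t}. ennreal (\<eta> s) \<partial>lborel) \<le> (\<integral>\<^sup>+s. (SUP n. ?f n s) \<partial>lborel)"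
    by (intro nn_integral_mono) auto
  also have "\<dots> = (SUP n. \<integral>\<^sup>+s. ?f n s \<partial>lborel)"
  proof (rule nn_integral_monotone_convergence_SUP)
    show "incseq ?f"
      using a_mono by (auto simp: incseq_def le_fun_def indicator_def intro: order_trans)
  qed measurable
  also have "\<dots> \<le> ennreal (H t)"
  proof (rule SUP_least)
    fix n
    have "(\<integral>\<^sup>+s. ?f n s \<partial>lborel) = ennreal (H t - H (a n))"
      using a[of n] H pos by (intro nn_integral_FTC_Icc) auto
    also have "\<dots> \<le> ennreal (H t)" using a[of n] pos[of "a n"] by (intro ennreal_leI) auto
    finally show "(\<integral>\<^sup>+s. ?f n s \<partial>lborel) \<le> ennreal (H t)" .
  qed
  finally show ?thesis .
qed

lemma nn_integral_powr_le:
  assumes t: "t > 0" and b: "b < 1" and K: "K \<ge> 0"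
  shows "(\<integral>\<^sup>+s\<in>{0<..<t}. ennreal (K * s powr - b) \<partial>lborel) \<le> ennreal (K * t powr (1 - b) / (1 - b))"
proof (rule nn_integral_deriv_le[OF t, where H = "\<lambda>s. K * s powr (1 - b) / (1 - b)"])
  show "((\<lambda>s. K * s powr (1 - b) / (1 - b)) has_real_derivative K * s powr - b) (at s)" if "0 < s" for s
    using that b by (auto intro!: derivative_eq_intros)
qed (use b K in auto)

section \<open>Ball means\<close>

lemma emeasure_lebesgue_ball:
  assumes "r \<ge> 0"
  shows "emeasure lebesgue (ball (x::real ^ 'n::finite) r) = ennreal (unit_ball_vol (real CARD('n)) * r ^ CARD('n))"
  using emeasure_ball[OF assms, of x] by simp

lemma ball_mean_alt:
  assumes r: "r > 0"
  shows "ball_mean f (x::real ^ 'n::finite) r =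
    (\<integral>\<^sup>+y\<in>ball x r. ennreal (f y) \<partial>lebesgue) * ennreal (1 / (unit_ball_vol (real CARD('n)) * r ^ CARD('n)))"
proof -
  have "unit_ball_vol (real CARD('n)) * r ^ CARD('n) > 0" using r by simp
  then show ?thesis
    unfolding ball_mean_def emeasure_lebesgue_ball[OF less_imp_le[OF r]] divide_ennreal_def
    by (subst inverse_ennreal) (auto simp: divide_inverse)
qed

text \<open>Only the volume ratio is lost. This matters when means are controlled at one radius
  alone, as for r0 < 1.\<close>

lemma ball_mean_le_scale:
  fixes x :: "real ^ 'n::finite"
  assumes r: "0 < r" "r \<le> R"
  shows "ball_mean f x r \<le> ennreal ((R / r) ^ CARD('n)) * ball_mean f x R"
proof -
  let ?v = "unit_ball_vol (real CARD('n))"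
  have v: "?v > 0" by simp
  have "(\<integral>\<^sup>+y\<in>ball x r. ennreal (f y) \<partial>lebesgue) \<le> (\<integral>\<^sup>+y\<in>ball x R. ennreal (f y) \<partial>lebesgue)"
    using r by (intro nn_integral_mono) (auto simp: indicator_def)
  then have "ball_mean f x r \<le> (\<integral>\<^sup>+y\<in>ball x R. ennreal (f y) \<partial>lebesgue) * ennreal (1 / (?v * r ^ CARD('n)))"
    unfolding ball_mean_alt[OF r(1)] by (rule mult_right_mono) simp
  also have "1 / (?v * r ^ CARD('n)) = (R / r) ^ CARD('n) * (1 / (?v * R ^ CARD('n)))"
    using r v by (simp add: field_simps)
  also have "ennreal \<dots> = ennreal ((R / r) ^ CARD('n)) * ennreal (1 / (?v * R ^ CARD('n)))"
    using r by (intro ennreal_mult') auto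
  finally show ?thesis using r by (simp add: ball_mean_alt mult_ac)
qed

text \<open>It serves to lower the exponent of the mean by splitting at a level and, with
  \<open>a = 0\<close>, to undo the normalisation inside \<open>Phi\<close>.\<close>

lemma ball_mean_le_affine:
  fixes x :: "real ^ 'n::finite"
  assumes r: "r > 0" and ab: "a \<ge> 0" "b \<ge> 0" and le: "\<And>y. f y \<le> a + b * g y"
    and g: "\<And>y. g y \<ge> 0" and gm[measurable]: "g \<in> borel_measurable lebesgue"
  shows "ball_mean f x r \<le> ennreal a + ennreal b * ball_mean g x r"
proof -
  let ?v = "unit_ball_vol (real CARD('n)) * r ^ CARD('n)"
  have v: "?v > 0" using r by simp
  have ball[measurable]: "ball x r \<in> sets lebesgue" by simp
  have gi[measurable]: "(\<lambda>y. ennreal (g y) * indicator (ball x r) y) \<in> borel_measurable lebesgue"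
    by (intro borel_measurable_times_ennreal borel_measurable_indicator ball measurable_compose[OF gm measurable_ennreal])
  have "(\<integral>\<^sup>+y\<in>ball x r. ennreal (f y) \<partial>lebesgue)
      \<le> (\<integral>\<^sup>+y. ennreal a * indicator (ball x r) y + ennreal b * (ennreal (g y) * indicator (ball x r) y) \<partial>lebesgue)"
  proof (rule nn_integral_mono)
    fix y
    have "ennreal (f y) \<le> ennreal (a + b * g y)" by (intro ennreal_leI le)
    also have "\<dots> = ennreal a + ennreal b * ennreal (g y)" using ab g[of y] by (simp add: ennreal_mult')
    finally show "ennreal (f y) * indicator (ball x r) y
      \<le> ennreal a * indicator (ball x r) y + ennreal b * (ennreal (g y) * indicator (ball x r) y)"
      by (auto simp: indicator_def)
  qed
  also have "\<dots> = (\<integral>\<^sup>+y. ennreal a * indicator (ball x r) y \<partial>lebesgue) + (\<integral>\<^sup>+y. ennreal b * (ennreal (g y) * indicator (ball x r) y) \<partial>lebesgue)"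
    by (rule nn_integral_add) (use gi in \<open>auto intro!: borel_measurable_times_ennreal borel_measurable_indicator ball\<close>)
  also have "(\<integral>\<^sup>+y. ennreal a * indicator (ball x r) y \<partial>lebesgue) = ennreal (a * ?v)"
    using ab r by (subst nn_integral_cmult_indicator[OF ball]) (simp add: emeasure_lebesgue_ball[OF less_imp_le[OF r]] ennreal_mult' del: emeasure_completion)
  also have "(\<integral>\<^sup>+y. ennreal b * (ennreal (g y) * indicator (ball x r) y) \<partial>lebesgue) = ennreal b * (\<integral>\<^sup>+y\<in>ball x r. ennreal (g y) \<partial>lebesgue)"
    by (rule nn_integral_cmult[OF gi])
  finally have "ball_mean f x r \<le> (ennreal (a * ?v) + ennreal b * (\<integral>\<^sup>+y\<in>ball x r. ennreal (g y) \<partial>lebesgue)) * ennreal (1 / ?v)"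
    unfolding ball_mean_alt[OF r] by (rule mult_right_mono) simp
  also have "\<dots> = ennreal (a * ?v) * ennreal (1 / ?v) + ennreal b * ball_mean g x r"
    unfolding ball_mean_alt[OF r] by (simp add: distrib_right mult.assoc)
  also have "ennreal (a * ?v) * ennreal (1 / ?v) = ennreal a"
  proof -
    have "a * w * (1 / w) = a" if "w > 0" for w using that by simp
    from this[OF v] show ?thesis using ab v by (subst ennreal_mult'[symmetric]) auto
  qed
  finally show ?thesis .
qed

lemma kern_ball_mean_le:
  assumes d: "d > 0"
  obtains C where "C > 0"
    "\<And>(f :: real ^ 'n::finite \<Rightarrow> real) x t B. f \<in> borel_measurable lebesgue \<Longrightarrow> t > 0 \<Longrightarrow>
      (\<And>z. ball_mean f z (t powr (1 / d)) \<le> B) \<Longrightarrow>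
      (\<integral>\<^sup>+y. ennreal (kern d (x - y) t) * ennreal (f y) \<partial>lebesgue) \<le> ennreal C * B"
proof -
  obtain C where C: "C > 0"
    "\<And>(f :: real ^ 'n \<Rightarrow> ennreal) x t B. f \<in> borel_measurable borel \<Longrightarrow> t > 0 \<Longrightarrow>
      (\<And>z. (\<integral>\<^sup>+y\<in>ball z (t powr (1 / d)). f y \<partial>lborel) / emeasure lborel (ball z (t powr (1 / d))) \<le> B) \<Longrightarrow>
      kern_conv d f x t \<le> ennreal C * B"
    using kern_average_le[OF d, where 'a="real ^ 'n"] by blast
  have "(\<integral>\<^sup>+y. ennreal (kern d (x - y) t) * ennreal (f y) \<partial>lebesgue) \<le> ennreal C * B"
    if f: "f \<in> borel_measurable lebesgue" and t: "t > 0" and B: "\<And>z. ball_mean f z (t powr (1 / d)) \<le> B"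
    for f :: "real ^ 'n \<Rightarrow> real" and x t B
  proof -
    obtain f' where [measurable]: "f' \<in> borel_measurable borel" and ae: "AE y in lborel. f y = f' y"
      using completion_ex_borel_measurable_real[OF f] by auto
    have "(\<integral>\<^sup>+y. ennreal (kern d (x - y) t) * ennreal (f y) \<partial>lebesgue) = kern_conv d (\<lambda>y. ennreal (f' y)) x t"
      unfolding nn_integral_completion using ae by (intro nn_integral_cong_AE) auto
    also have "\<dots> \<le> ennreal C * B"
    proof (rule C(2)[OF _ t])
      fix z :: "real ^ 'n"
      have "(\<integral>\<^sup>+y\<in>ball z (t powr (1 / d)). ennreal (f' y) \<partial>lborel) = (\<integral>\<^sup>+y\<in>ball z (t powr (1 / d)). ennreal (f y) \<partial>lborel)"
        using ae by (intro nn_integral_cong_AE) auto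
      then show "(\<integral>\<^sup>+y\<in>ball z (t powr (1 / d)). ennreal (f' y) \<partial>lborel) / emeasure lborel (ball z (t powr (1 / d))) \<le> B"
        using B[of z] by (simp add: ball_mean_def nn_integral_completion)
    qed measurable
    finally show ?thesis .
  qed
  then show ?thesis using C(1) that by blast
qed

lemma locally_integrable_measurable:
  assumes "locally_integrable (\<phi> :: real ^ 'n::finite \<Rightarrow> real)"
  shows "\<phi> \<in> borel_measurable lebesgue"
proof (rule borel_measurable_LIMSEQ_real)
  fix x :: "real ^ 'n"
  obtain k where k: "norm x \<le> real k" using real_arch_simple by blast
  have "eventually (\<lambda>n. indicator (cball 0 (real n)) x *\<^sub>R \<phi> x = \<phi> x) sequentially"
    using eventually_ge_at_top[of k] by eventually_elim (use k in auto)
  then show "(\<lambda>n. indicator (cball 0 (real n)) x *\<^sub>R \<phi> x) \<longlonglongrightarrow> \<phi> x"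
    by (rule tendsto_eventually)
next
  fix n
  have "\<phi> absolutely_integrable_on cball 0 (real n)"
    using assms by (simp add: locally_integrable_def)
  then show "(\<lambda>x. indicator (cball 0 (real n)) x *\<^sub>R \<phi> x) \<in> borel_measurable lebesgue"
    unfolding set_integrable_def by (rule borel_measurable_integrable)
qed

text \<open>The mean is known at the single radius \<open>T powr (1 / d)\<close>, and the volume
  ratio for smaller balls produces the rate t^(-N/d). Its natural prefactor \<gamma> T^(N/d - a) is
  unbounded as T tends to 0, since N/d < a. A constant independent of T is obtained by fixing one
  admissible time for the given datum; if there is none, nothing is to be shown.\<close>

lemma subcritical:
  fixes N d p r0 :: real
  assumes N: "N = real CARD('n::finite)"
    and d: "d > 0" and p: "p > 1"
    and r0: "r0 = N * (p - 1) / d" and r1: "r0 < 1"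
  shows "\<exists>\<gamma>>0. \<forall>\<phi> :: real ^ 'n \<Rightarrow> real. locally_integrable \<phi> \<longrightarrow>
         (\<exists>C>0. \<forall>T>0.
           (SUP x. ball_mean (\<lambda>y. \<bar>\<phi> y\<bar>) x (T powr (1 / d)))
             \<le> ennreal (\<gamma> * T powr (- N / (d * r0))) \<longrightarrow>
           (\<exists>u. is_solution d p \<phi> (ennreal T) u \<and>
             (\<forall>x. \<forall>t\<in>{0<..<T}. \<bar>u x t\<bar> \<le> C * t powr (- N / d))))"
proof -
  obtain \<delta> A where \<delta>: "\<delta> > 0" and A: "A > 0" and sol:
    "\<And>(\<phi> :: real ^ 'n \<Rightarrow> real) h \<Psi> m \<eta> H T. mean_bound d p \<delta> \<phi> h \<Psi> m \<eta> H T \<Longrightarrow>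
      has_solution_below d p \<phi> T (\<lambda>t. A * m t)"
    using ex_solution_of_mean_bound[OF d p, where 'n='n] by blast
  obtain K where K: "K > 0"
    "\<And>(f :: real ^ 'n::finite \<Rightarrow> real) x t B. f \<in> borel_measurable lebesgue \<Longrightarrow> t > 0 \<Longrightarrow>
      (\<And>z. ball_mean f z (t powr (1 / d)) \<le> B) \<Longrightarrow>
      (\<integral>\<^sup>+y. ennreal (kern d (x - y) t) * ennreal (f y) \<partial>lebesgue) \<le> ennreal K * B"
    using kern_ball_mean_le[OF d, where 'n='n] by blast
  have N0: "N > 0" by (simp add: N)
  define a where "a = 1 / (p - 1)"
  have a: "a > 0" using p by (simp add: a_def)
  have ap: "a * (p - 1) = 1" using p by (simp add: a_def)
  have Np: "(N / d) * (p - 1) = r0" by (simp add: r0)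
  have ea: "- N / (d * r0) = - a" using N0 d p by (simp add: r0 a_def)
  have b: "N / d - a < 0"
  proof -
    have "(N / d - a) * (p - 1) < 0" using r1 Np ap by (simp add: left_diff_distrib)
    then show ?thesis using p by (simp add: mult_less_0_iff)
  qed
  \<comment> \<open>Solves \<open>(K * \<gamma>) powr (p - 1) = \<delta> * (1 - r0)\<close>, the
    smallness condition once the powers of \<open>T\<close> have cancelled.\<close>
  define \<gamma> where "\<gamma> = (\<delta> * (1 - r0)) powr a / K"
  have \<gamma>: "\<gamma> > 0" using \<delta> r1 K by (simp add: \<gamma>_def)
  have \<gamma>p: "(K * \<gamma>) powr (p - 1) = \<delta> * (1 - r0)"
    using K(1) \<delta> r1 ap by (simp add: \<gamma>_def powr_powr)
  have mean_scale: "ball_mean f x (t powr (1 / d)) \<le> ennreal ((T / t) powr (N / d)) * ball_mean f x (T powr (1 / d))"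
    if "0 < t" "t \<le> T" for f and x :: "real ^ 'n" and t T
  proof -
    have "t powr (1 / d) \<le> T powr (1 / d)" using that d by (intro powr_mono2) auto
    moreover have "(T powr (1 / d) / t powr (1 / d)) ^ CARD('n) = (T / t) powr (N / d)"
      using that by (simp add: powr_divide[symmetric] powr_realpow[symmetric] powr_powr N)
    ultimately show ?thesis using ball_mean_le_scale[of "t powr (1 / d)" "T powr (1 / d)" f x] that by simp
  qed
  \<comment> \<open>The prefactor \<open>Q\<close> is kept separate from \<open>T\<close>, so that a
    bound inherited from a larger admissible time can be inserted.\<close>
  have core: "\<exists>u. is_solution d p \<phi> (ennreal T) u \<and> (\<forall>x. \<forall>t\<in>{0<..<T}. \<bar>u x t\<bar> \<le> A * K * Q * t powr (- N / d))"
    if \<phi>: "locally_integrable \<phi>" and T: "T > 0" and Q: "Q \<ge> 0"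
      and mean: "\<And>x. ball_mean (\<lambda>y. \<bar>\<phi> y\<bar>) x (T powr (1 / d)) \<le> ennreal (Q * T powr (- N / d))"
      and sm: "(K * Q) powr (p - 1) * T powr (1 - r0) / (1 - r0) \<le> \<delta>"
    for \<phi> :: "real ^ 'n \<Rightarrow> real" and T Q
  proof -
    note \<phi>m = locally_integrable_measurable[OF \<phi>]
    define m where "m t = K * Q * t powr (- N / d)" for t
    have "has_solution_below d p \<phi> (ennreal T) (\<lambda>t. A * m t)"
    proof (rule sol[where h = "\<lambda>_. 1" and \<Psi> = "\<lambda>z. z" and \<eta> = "\<lambda>t. (K * Q) powr (p - 1) * t powr - r0"
          and H = "\<lambda>t. (K * Q) powr (p - 1) * t powr (1 - r0) / (1 - r0)"], unfold_locales)
      fix \<tau> :: real assume \<tau>: "0 < \<tau>"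
      have "m s \<le> K * Q * \<tau> powr (- N / d)" if "\<tau> < s" for s
        unfolding m_def using that \<tau> K(1) Q N0 d by (intro mult_left_mono powr_mono2') auto
      then show "\<exists>B. \<forall>s. \<tau> < s \<longrightarrow> ennreal s < ennreal T \<longrightarrow> m s \<le> B" by blast
    next
      fix x :: "real ^ 'n" and t assume t: "0 < t" "ennreal t < ennreal T"
      then have tT: "t \<le> T" by (simp add: ennreal_less_iff)
      have "ball_mean (\<lambda>y. \<bar>\<phi> y\<bar>) z (t powr (1 / d)) \<le> ennreal (Q * t powr (- N / d))" for z
      proof -
        have "ball_mean (\<lambda>y. \<bar>\<phi> y\<bar>) z (t powr (1 / d)) \<le> ennreal ((T / t) powr (N / d)) * ennreal (Q * T powr (- N / d))"
          by (rule order_trans[OF mean_scale[OF t(1) tT]]) (intro mult_left_mono mean, simp)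
        also have "\<dots> = ennreal ((T / t) powr (N / d) * (Q * T powr (- N / d)))"
          by (rule ennreal_mult'[symmetric]) simp
        also have "(T / t) powr (N / d) * (Q * T powr (- N / d)) = Q * t powr (- N / d)"
          using T t by (simp add: powr_divide powr_minus field_simps)
        finally show ?thesis .
      qed
      from K(2)[OF _ t(1) this, of x] \<phi>m
      have "(\<integral>\<^sup>+y. ennreal (kern d (x - y) t) * ennreal \<bar>\<phi> y\<bar> \<partial>lebesgue) \<le> ennreal K * ennreal (Q * t powr (- N / d))"
        by simp
      also have "\<dots> = ennreal (m t * 1)"
        using K(1) Q by (simp add: m_def ennreal_mult'[symmetric] mult_ac)
      finally show "(\<integral>\<^sup>+y. ennreal (kern d (x - y) t) * ennreal (\<bar>\<phi> y\<bar> * 1) \<partial>lebesgue) \<le> ennreal (m t * 1)" by simp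
    next
      fix w t :: real assume t: "0 < t" and w: "0 < w" "w \<le> m t"
      have "w powr (p - 1) \<le> m t powr (p - 1)" using w p by (intro powr_mono2) auto
      also have "\<dots> = (K * Q) powr (p - 1) * t powr - r0"
        using K(1) Q t Np by (simp add: m_def powr_mult powr_powr mult.assoc)
      finally show "w powr (p - 1) \<le> 1 * ((K * Q) powr (p - 1) * t powr - r0)" by simp
    next
      fix t assume t: "0 < t" "ennreal t < ennreal T"
      then have tT: "t \<le> T" by (simp add: ennreal_less_iff)
      show "(\<integral>\<^sup>+s\<in>{0<..<t}. ennreal ((K * Q) powr (p - 1) * s powr - r0) \<partial>lborel) \<le> ennreal ((K * Q) powr (p - 1) * t powr (1 - r0) / (1 - r0))"
        by (rule nn_integral_powr_le) (use t r1 in auto)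
      have "(K * Q) powr (p - 1) * t powr (1 - r0) / (1 - r0) \<le> (K * Q) powr (p - 1) * T powr (1 - r0) / (1 - r0)"
        using t tT r1 by (intro divide_right_mono mult_left_mono powr_mono2) auto
      then show "1 * ((K * Q) powr (p - 1) * t powr (1 - r0) / (1 - r0)) \<le> \<delta>" using sm by simp
    qed (use K(1) Q r1 \<phi>m in \<open>auto simp: m_def\<close>)
    then show ?thesis using T by (auto simp: m_def ennreal_less_iff mult.assoc)
  qed
  show ?thesis
  proof (rule exI[of _ \<gamma>], intro conjI \<gamma> allI impI)
    fix \<phi> :: "real ^ 'n \<Rightarrow> real"
    assume \<phi>: "locally_integrable \<phi>"
    define adm where "adm T \<longleftrightarrow> (SUP x. ball_mean (\<lambda>y. \<bar>\<phi> y\<bar>) x (T powr (1 / d))) \<le> ennreal (\<gamma> * T powr - a)" for T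
    have adm: "ball_mean (\<lambda>y. \<bar>\<phi> y\<bar>) x (T powr (1 / d)) \<le> ennreal (\<gamma> * T powr - a)" if "adm T" for x T
      using that unfolding adm_def by (rule order_trans[OF SUP_upper[OF UNIV_I]])
    show "\<exists>C>0. \<forall>T>0. (SUP x. ball_mean (\<lambda>y. \<bar>\<phi> y\<bar>) x (T powr (1 / d))) \<le> ennreal (\<gamma> * T powr (- N / (d * r0))) \<longrightarrow>
       (\<exists>u. is_solution d p \<phi> (ennreal T) u \<and> (\<forall>x. \<forall>t\<in>{0<..<T}. \<bar>u x t\<bar> \<le> C * t powr (- N / d)))"
    proof (cases "\<exists>T0>0. adm T0")
      case False
      then show ?thesis unfolding ea by (intro exI[of _ 1]) (auto simp: adm_def)
    next
      case True
      then obtain T0 where T0: "T0 > 0" "adm T0" by blast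
      define C where "C = A * K * \<gamma> * T0 powr (N / d - a)"
      have "\<exists>u. is_solution d p \<phi> (ennreal T) u \<and> (\<forall>x. \<forall>t\<in>{0<..<T}. \<bar>u x t\<bar> \<le> C * t powr (- N / d))"
        if T: "T > 0" "adm T" for T
      proof -
        \<comment> \<open>For \<open>T \<le> T0\<close> the mean bound is inherited from
          \<open>T0\<close>, otherwise the one at \<open>T\<close> is used. The exponent is
          negative, so \<open>Q\<close> never exceeds its value for \<open>T0\<close>.\<close>
        define Q where "Q = \<gamma> * (max T T0) powr (N / d - a)"
        have Q: "Q \<ge> 0" using \<gamma> by (simp add: Q_def)
        have QC: "A * K * Q \<le> C"
        proof -
          have "(max T T0) powr (N / d - a) \<le> T0 powr (N / d - a)"
            using T0 b by (intro powr_mono2') auto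
          then have "(A * K * \<gamma>) * (max T T0) powr (N / d - a) \<le> (A * K * \<gamma>) * T0 powr (N / d - a)"
            using A K(1) \<gamma> by (intro mult_left_mono) auto
          then show ?thesis by (simp add: Q_def C_def mult_ac)
        qed
        have "\<exists>u. is_solution d p \<phi> (ennreal T) u \<and> (\<forall>x. \<forall>t\<in>{0<..<T}. \<bar>u x t\<bar> \<le> A * K * Q * t powr (- N / d))"
        proof (rule core[OF \<phi> T(1) Q])
          fix x :: "real ^ 'n"
          show "ball_mean (\<lambda>y. \<bar>\<phi> y\<bar>) x (T powr (1 / d)) \<le> ennreal (Q * T powr (- N / d))"
          proof (cases "T \<le> T0")
            case True
            have "ball_mean (\<lambda>y. \<bar>\<phi> y\<bar>) x (T powr (1 / d)) \<le> ennreal ((T0 / T) powr (N / d)) * ennreal (\<gamma> * T0 powr - a)"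
              by (rule order_trans[OF mean_scale[OF T(1) True]]) (intro mult_left_mono adm T0, simp)
            also have "\<dots> = ennreal ((T0 / T) powr (N / d) * (\<gamma> * T0 powr - a))"
              by (rule ennreal_mult'[symmetric]) simp
            also have "(T0 / T) powr (N / d) * (\<gamma> * T0 powr - a) = Q * T powr (- N / d)"
              using T T0 True by (simp add: Q_def max_absorb2 powr_divide powr_minus powr_diff field_simps)
            finally show ?thesis .
          next
            case False
            then have "Q * T powr (- N / d) = \<gamma> * T powr - a"
              using T T0 by (simp add: Q_def max_absorb1 powr_minus powr_diff field_simps)
            then show ?thesis using adm[OF T(2), of x] by simp
          qed
          have "(K * Q) powr (p - 1) = (K * \<gamma>) powr (p - 1) * (max T T0) powr (r0 - 1)"
          proof -
            have "(N / d - a) * (p - 1) = r0 - 1" using Np ap by (simp add: left_diff_distrib)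
            moreover have "K * Q = (K * \<gamma>) * (max T T0) powr (N / d - a)" by (simp add: Q_def)
            ultimately show ?thesis using K(1) \<gamma> by (simp only: powr_mult powr_powr)
          qed
          then have "(K * Q) powr (p - 1) * T powr (1 - r0) / (1 - r0) = \<delta> * ((max T T0) powr (r0 - 1) * T powr (1 - r0))"
            unfolding \<gamma>p using r1 by simp
          also have "\<dots> \<le> \<delta> * (T powr (r0 - 1) * T powr (1 - r0))"
            using \<delta> T r1 by (intro mult_left_mono mult_right_mono powr_mono2') auto
          also have "\<dots> = \<delta>" using T by (simp add: powr_add[symmetric])
          finally show "(K * Q) powr (p - 1) * T powr (1 - r0) / (1 - r0) \<le> \<delta>" .
        qed
        then show ?thesis using QC by (meson mult_right_mono order_trans powr_ge_zero)
      qed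
      moreover have "C > 0" using A K(1) \<gamma> T0 by (simp add: C_def)
      ultimately show ?thesis unfolding ea by (intro exI[of _ C]) (auto simp: adm_def)
    qed
  qed
qed

text \<open>The profile t^(-1/(p-1)) is scale invariant: in the smallness condition all powers of t
  cancel, which admits T = \<infinity>. The constant obtained is \<open>A * k * \<gamma>\<close>,
  the same for all data.\<close>

lemma supercritical:
  fixes N d p r0 q :: real
  assumes N: "N = real CARD('n::finite)"
    and d: "d > 0" and p: "p > 1"
    and r0: "r0 = N * (p - 1) / d" and q: "q > 1"
  shows "\<exists>\<gamma>>0. \<forall>\<phi> :: real ^ 'n \<Rightarrow> real. locally_integrable \<phi> \<longrightarrow>
         (\<exists>C>0. \<forall>T>0.
           (SUP x. SUP \<sigma>\<in>{\<sigma>. 0 < \<sigma> \<and> ennreal \<sigma> < extend_top (\<lambda>a. a powr (1 / d)) T}.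
              ennreal (\<sigma> powr (N / r0)) *
              extend_top (\<lambda>a. a powr (1 / q)) (ball_mean (\<lambda>y. \<bar>\<phi> y\<bar> powr q) x \<sigma>))
             \<le> ennreal \<gamma> \<longrightarrow>
           (\<exists>u. is_solution d p \<phi> T u \<and>
             (\<forall>x. \<forall>t>0. ennreal t < T \<longrightarrow> \<bar>u x t\<bar> \<le> C * t powr (- N / (d * r0)))))"
proof -
  obtain \<delta> A where \<delta>: "\<delta> > 0" and A: "A > 0" and sol:
    "\<And>(\<phi> :: real ^ 'n \<Rightarrow> real) h \<Psi> m \<eta> H T. mean_bound d p \<delta> \<phi> h \<Psi> m \<eta> H T \<Longrightarrow>
      has_solution_below d p \<phi> T (\<lambda>t. A * m t)"
    using ex_solution_of_mean_bound[OF d p, where 'n='n] by blast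
  obtain K where K: "K > 0"
    "\<And>(f :: real ^ 'n::finite \<Rightarrow> real) x t B. f \<in> borel_measurable lebesgue \<Longrightarrow> t > 0 \<Longrightarrow>
      (\<And>z. ball_mean f z (t powr (1 / d)) \<le> B) \<Longrightarrow>
      (\<integral>\<^sup>+y. ennreal (kern d (x - y) t) * ennreal (f y) \<partial>lebesgue) \<le> ennreal K * B"
    using kern_ball_mean_le[OF d, where 'n='n] by blast
  have N0: "N > 0" by (simp add: N)
  define a where "a = 1 / (p - 1)"
  have a: "a > 0" using p by (simp add: a_def)
  have ap: "a * (p - 1) = 1" using p by (simp add: a_def)
  have ea: "- N / (d * r0) = - a" "N / r0 = a * d" using N0 d p by (simp_all add: r0 a_def)
  \<comment> \<open>by interpolation the hypothesis is inherited by smaller exponents, so \<open>q\<close> may be taken below \<open>p\<close>\<close>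
  define q' where "q' = min q ((1 + p) / 2)"
  have q': "q' > 1" "q' < p" "q' \<le> q" using q p by (auto simp: q'_def min_def)
  \<comment> \<open>The order of the singularity of \<open>\<eta>\<close> at time 0; it is below 1
    because \<open>q' > 1\<close>.\<close>
  define b where "b = a * (p - q')"
  have "a * (p - q') < a * (p - 1)" using a q' by (intro mult_strict_left_mono) auto
  then have b: "b < 1" by (simp add: b_def ap)
  \<comment> \<open>The 2 stems from the splitting in the interpolation below, \<open>K\<close> from
    the averaging bound for the kernel.\<close>
  define k where "k = (2 * K) powr (1 / q')"
  have k: "k > 0" "k powr q' = 2 * K" using K(1) q' by (simp_all add: k_def powr_powr)
  define \<gamma> where "\<gamma> = (\<delta> * (1 - b)) powr a / k"
  have \<gamma>: "\<gamma> > 0" using \<delta> b k by (simp add: \<gamma>_def)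
  have \<gamma>p: "(k * \<gamma>) powr (p - 1) = \<delta> * (1 - b)"
    using k \<delta> b ap by (simp add: \<gamma>_def powr_powr)
  define m where "m t = k * \<gamma> * t powr - a" for t
  have core: "has_solution_below d p \<phi> T (\<lambda>t. A * m t)"
    if \<phi>: "locally_integrable \<phi>" and T: "T > 0"
      and hyp: "(SUP x. SUP \<sigma>\<in>{\<sigma>. 0 < \<sigma> \<and> ennreal \<sigma> < extend_top (\<lambda>a. a powr (1 / d)) T}.
              ennreal (\<sigma> powr (N / r0)) * extend_top (\<lambda>a. a powr (1 / q)) (ball_mean (\<lambda>y. \<bar>\<phi> y\<bar> powr q) x \<sigma>)) \<le> ennreal \<gamma>"
    for \<phi> :: "real ^ 'n \<Rightarrow> real" and T
  proof -
    note \<phi>m = locally_integrable_measurable[OF \<phi>]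
    have mean: "ball_mean (\<lambda>y. \<bar>\<phi> y\<bar> powr q') x (t powr (1 / d)) \<le> ennreal (2 * (\<gamma> * t powr - a) powr q')"
      if t: "0 < t" "ennreal t < T" for x t
    proof -
      define \<sigma> where "\<sigma> = t powr (1 / d)"
      have \<sigma>: "\<sigma> > 0" using t by (simp add: \<sigma>_def)
      have \<sigma>T: "ennreal \<sigma> < extend_top (\<lambda>a. a powr (1 / d)) T"
      proof (cases T)
        case (real r)
        then have "t < r" using t by (simp add: ennreal_less_iff)
        then have "\<sigma> < r powr (1 / d)" unfolding \<sigma>_def using t d by (intro powr_less_mono2) auto
        then show ?thesis using real \<sigma> by (simp add: extend_top_def ennreal_less_iff)
      qed (simp add: extend_top_def)
      have "ennreal (\<sigma> powr (N / r0)) * extend_top (\<lambda>a. a powr (1 / q)) (ball_mean (\<lambda>y. \<bar>\<phi> y\<bar> powr q) x \<sigma>)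
         \<le> (SUP \<sigma>\<in>{\<sigma>. 0 < \<sigma> \<and> ennreal \<sigma> < extend_top (\<lambda>a. a powr (1 / d)) T}.
              ennreal (\<sigma> powr (N / r0)) * extend_top (\<lambda>a. a powr (1 / q)) (ball_mean (\<lambda>y. \<bar>\<phi> y\<bar> powr q) x \<sigma>))"
        by (rule SUP_upper) (use \<sigma> \<sigma>T in auto)
      also have "\<dots> \<le> ennreal \<gamma>"
        by (rule order_trans[OF _ hyp]) (rule SUP_upper, simp)
      finally have le: "ennreal (\<sigma> powr (N / r0)) * extend_top (\<lambda>a. a powr (1 / q)) (ball_mean (\<lambda>y. \<bar>\<phi> y\<bar> powr q) x \<sigma>) \<le> ennreal \<gamma>" .
      have "\<sigma> powr (N / r0) > 0" using \<sigma> by simp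
      \<comment> \<open>An infinite mean stays infinite under \<open>extend_top\<close> and under a
        positive factor.\<close>
      then have fin: "ball_mean (\<lambda>y. \<bar>\<phi> y\<bar> powr q) x \<sigma> \<noteq> top"
        using le by (auto simp: extend_top_def ennreal_mult_top top_unique)
      define z where "z = enn2real (ball_mean (\<lambda>y. \<bar>\<phi> y\<bar> powr q) x \<sigma>)"
      have z: "ball_mean (\<lambda>y. \<bar>\<phi> y\<bar> powr q) x \<sigma> = ennreal z" "z \<ge> 0"
        using fin by (simp_all add: z_def top.not_eq_extremum)
      define l where "l = \<gamma> * t powr - a"
      have l: "l > 0" using \<gamma> t by (simp add: l_def)
      have "\<sigma> powr (N / r0) * z powr (1 / q) \<le> \<gamma>"
        using le \<gamma> z unfolding extend_top_def by (simp add: ennreal_mult'[symmetric] ennreal_le_iff)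
      moreover have "\<sigma> powr (N / r0) = t powr a"
        unfolding ea using t d by (simp add: \<sigma>_def powr_powr)
      ultimately have "z powr (1 / q) \<le> l"
        using t by (simp add: l_def powr_minus field_simps)
      then have "(z powr (1 / q)) powr q \<le> l powr q" using q by (intro powr_mono2) auto
      then have zl: "z \<le> l powr q" using z q by (simp add: powr_powr)
      have "ball_mean (\<lambda>y. \<bar>\<phi> y\<bar> powr q') x \<sigma> \<le> ennreal (l powr q') + ennreal (l powr (q' - q)) * ball_mean (\<lambda>y. \<bar>\<phi> y\<bar> powr q) x \<sigma>"
      proof (rule ball_mean_le_affine[OF \<sigma>])
        \<comment> \<open>Interpolation by splitting at the level \<open>l\<close>, the expected
          size of the mean: each part then contributes \<open>l powr q'\<close>.\<close>
        show "\<bar>\<phi> y\<bar> powr q' \<le> l powr q' + l powr (q' - q) * \<bar>\<phi> y\<bar> powr q" for y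
        proof (cases "\<bar>\<phi> y\<bar> \<le> l")
          case True
          then have "\<bar>\<phi> y\<bar> powr q' \<le> l powr q'" using q' by (intro powr_mono2) auto
          then show ?thesis by (simp add: add_increasing2)
        next
          case False
          have "\<bar>\<phi> y\<bar> powr (q' - q) \<le> l powr (q' - q)" using False l q' by (intro powr_mono2') auto
          then have "\<bar>\<phi> y\<bar> powr (q' - q) * \<bar>\<phi> y\<bar> powr q \<le> l powr (q' - q) * \<bar>\<phi> y\<bar> powr q"
            by (rule mult_right_mono) simp
          then have "\<bar>\<phi> y\<bar> powr q' \<le> l powr (q' - q) * \<bar>\<phi> y\<bar> powr q" by (simp add: powr_add[symmetric])
          then show ?thesis by (simp add: add_increasing)
        qed
        show "(\<lambda>y. \<bar>\<phi> y\<bar> powr q) \<in> borel_measurable lebesgue" using \<phi>m by simp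
      qed auto
      also have "\<dots> = ennreal (l powr q' + l powr (q' - q) * z)"
        using z by (simp add: ennreal_mult'[symmetric] ennreal_plus[symmetric] del: ennreal_plus)
      also have "\<dots> \<le> ennreal (l powr q' + l powr (q' - q) * l powr q)"
        using zl by (intro ennreal_leI add_left_mono mult_left_mono) auto
      also have "l powr q' + l powr (q' - q) * l powr q = 2 * l powr q'"
        using l by (simp add: powr_add[symmetric])
      finally show ?thesis by (simp add: \<sigma>_def l_def)
    qed
    show ?thesis
    proof (rule sol[where h = "\<lambda>w. w powr (q' - 1)" and \<Psi> = "\<lambda>z. (max 0 z) powr (1 / q')"
        and \<eta> = "\<lambda>t. (k * \<gamma>) powr (p - q') * t powr - b"
        and H = "\<lambda>t. (k * \<gamma>) powr (p - q') * t powr (1 - b) / (1 - b)"], unfold_locales)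
      show "v powr (q' - 1) \<le> w powr (q' - 1)" if "0 \<le> v" "v \<le> w" for v w
        using that q' by (intro powr_mono2) auto
      show "0 \<le> max 0 z powr (1 / q') \<and> max 0 z powr (1 / q') * (max 0 z powr (1 / q')) powr (q' - 1) = z"
        if "0 \<le> z" for z
      proof -
        have "1 / q' + 1 / q' * (q' - 1) = 1" using q' by (simp add: field_simps)
        then have "z powr (1 / q') * (z powr (1 / q')) powr (q' - 1) = z powr 1"
          unfolding powr_powr powr_add[symmetric] by simp
        then show ?thesis using that by (simp add: max_absorb2)
      qed
      show "\<exists>B. \<forall>s. \<tau> < s \<longrightarrow> ennreal s < T \<longrightarrow> m s \<le> B" if \<tau>: "0 < \<tau>" for \<tau>
      proof -
        have "m s \<le> k * \<gamma> * \<tau> powr - a" if "\<tau> < s" for s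
          unfolding m_def using that \<tau> k \<gamma> a by (intro mult_left_mono powr_mono2') auto
        then show ?thesis by blast
      qed
    next
      fix x :: "real ^ 'n" and t assume t: "0 < t" "ennreal t < T"
      have mt: "m t > 0" using t k \<gamma> by (simp add: m_def)
      have "(\<integral>\<^sup>+y. ennreal (kern d (x - y) t) * ennreal (\<bar>\<phi> y\<bar> powr q') \<partial>lebesgue) \<le> ennreal K * ennreal (2 * (\<gamma> * t powr - a) powr q')"
        by (rule K(2)[OF _ t(1) mean[OF t]]) (use \<phi>m in simp)
      also have "\<dots> = ennreal (m t powr q')"
        using K(1) k \<gamma> t by (simp add: ennreal_mult'[symmetric] m_def powr_mult mult_ac)
      also have "m t powr q' = m t * m t powr (q' - 1)" using mt by (simp add: powr_diff)
      also have "(\<lambda>y. \<bar>\<phi> y\<bar> powr q') = (\<lambda>y. \<bar>\<phi> y\<bar> * \<bar>\<phi> y\<bar> powr (q' - 1))"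
      proof
        show "\<bar>\<phi> y\<bar> powr q' = \<bar>\<phi> y\<bar> * \<bar>\<phi> y\<bar> powr (q' - 1)" for y
          by (cases "\<phi> y = 0") (simp_all add: powr_diff)
      qed
      finally show "(\<integral>\<^sup>+y. ennreal (kern d (x - y) t) * ennreal (\<bar>\<phi> y\<bar> * \<bar>\<phi> y\<bar> powr (q' - 1)) \<partial>lebesgue) \<le> ennreal (m t * m t powr (q' - 1))"
        by meson
    next
      fix w t :: real assume t: "0 < t" and w: "0 < w" "w \<le> m t"
      \<comment> \<open>As \<open>q' < p\<close>, the remaining power is increasing and may be
        evaluated at \<open>m t\<close>.\<close>
      have "w powr (p - 1) = w powr (q' - 1) * w powr (p - q')" using w by (simp add: powr_add[symmetric])
      also have "\<dots> \<le> w powr (q' - 1) * m t powr (p - q')"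
        using w q' by (intro mult_left_mono powr_mono2) auto
      also have "m t powr (p - q') = (k * \<gamma>) powr (p - q') * t powr - b"
        using k \<gamma> t by (simp add: m_def powr_mult powr_powr b_def)
      finally show "w powr (p - 1) \<le> w powr (q' - 1) * ((k * \<gamma>) powr (p - q') * t powr - b)" .
    next
      fix t assume t: "0 < t" "ennreal t < T"
      show "(\<integral>\<^sup>+s\<in>{0<..<t}. ennreal ((k * \<gamma>) powr (p - q') * s powr - b) \<partial>lborel) \<le> ennreal ((k * \<gamma>) powr (p - q') * t powr (1 - b) / (1 - b))"
        by (rule nn_integral_powr_le) (use t b in auto)
      have "m t powr (q' - 1) = (k * \<gamma>) powr (q' - 1) * t powr (- a * (q' - 1))"
        using k \<gamma> t by (simp add: m_def powr_mult powr_powr)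
      then have "m t powr (q' - 1) * ((k * \<gamma>) powr (p - q') * t powr (1 - b) / (1 - b))
         = ((k * \<gamma>) powr (q' - 1) * (k * \<gamma>) powr (p - q')) * (t powr (- a * (q' - 1)) * t powr (1 - b)) / (1 - b)"
        by simp
      also have "(k * \<gamma>) powr (q' - 1) * (k * \<gamma>) powr (p - q') = (k * \<gamma>) powr (p - 1)"
        by (simp add: powr_add[symmetric])
      also have "t powr (- a * (q' - 1)) * t powr (1 - b) = t powr (- a * (q' - 1) + (1 - b))"
        by (simp only: powr_add)
      also have "- a * (q' - 1) + (1 - b) = 0"
        unfolding b_def using ap by (simp add: algebra_simps)
      finally show "m t powr (q' - 1) * ((k * \<gamma>) powr (p - q') * t powr (1 - b) / (1 - b)) \<le> \<delta>"
        using t b unfolding \<gamma>p by simp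
    qed (use k \<gamma> b \<phi>m in \<open>auto simp: m_def\<close>)
  qed
  show ?thesis
    unfolding ea(1)
  proof (rule exI[of _ \<gamma>], intro conjI \<gamma> allI impI, rule exI[of _ "A * k * \<gamma>"], intro conjI allI impI)
    show "A * k * \<gamma> > 0" using A k \<gamma> by simp
  next
    fix \<phi> :: "real ^ 'n \<Rightarrow> real" and T :: ennreal
    assume "locally_integrable \<phi>" "0 < T" "(SUP x. SUP \<sigma>\<in>{\<sigma>. 0 < \<sigma> \<and> ennreal \<sigma> < extend_top (\<lambda>a. a powr (1 / d)) T}.
              ennreal (\<sigma> powr (N / r0)) * extend_top (\<lambda>a. a powr (1 / q)) (ball_mean (\<lambda>y. \<bar>\<phi> y\<bar> powr q) x \<sigma>)) \<le> ennreal \<gamma>"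
    from core[OF this] show "\<exists>u. is_solution d p \<phi> T u \<and> (\<forall>x. \<forall>t>0. ennreal t < T \<longrightarrow> \<bar>u x t\<bar> \<le> A * k * \<gamma> * t powr - a)"
      by (simp add: m_def mult_ac)
  qed
qed

section \<open>Logarithmic estimates and the function Phi\<close>

lemma ln_exp_1_add_ge_1: "y \<ge> 0 \<Longrightarrow> ln (exp 1 + y) \<ge> (1 :: real)"
  using ln_le_cancel_iff[of "exp 1" "exp 1 + y"] by (simp add: add_pos_nonneg)

text \<open>Says without division that v^\<alpha> / ln(e + v)^\<beta> is almost increasing, with a
  gain when v \<le> \<gamma> \<rho>. With x = \<rho>/v one has ln(e + \<rho>) \<le> (1 + ln x) ln(e
  + v), and the \<beta>-th power of the first factor costs at most a multiple of x^(\<alpha>/2).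
  Half of the power x^\<alpha> pays for it, the other half gives \<gamma>^(\<alpha>/2), the source
  of smallness in the critical case.\<close>

lemma powr_ln_quasi_mono:
  fixes \<alpha> \<beta> :: real
  assumes \<alpha>: "\<alpha> > 0" and \<beta>: "\<beta> > 0"
  obtains K where "K > 0" "\<And>v \<rho> \<gamma>. 0 < v \<Longrightarrow> 0 < \<gamma> \<Longrightarrow> \<gamma> \<le> 1 \<Longrightarrow> v \<le> \<gamma> * \<rho> \<Longrightarrow>
    v powr \<alpha> * ln (exp 1 + \<rho>) powr \<beta> \<le> K * \<gamma> powr (\<alpha> / 2) * \<rho> powr \<alpha> * ln (exp 1 + v) powr \<beta>"
proof -
  define s where "s = \<alpha> / (2 * \<beta>)"
  have s: "s > 0" using \<alpha> \<beta> by (simp add: s_def)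
  define K where "K = (1 + 1 / s) powr \<beta>"
  have "v powr \<alpha> * ln (exp 1 + \<rho>) powr \<beta> \<le> K * \<gamma> powr (\<alpha> / 2) * \<rho> powr \<alpha> * ln (exp 1 + v) powr \<beta>"
    if v: "0 < v" and \<gamma>: "0 < \<gamma>" "\<gamma> \<le> 1" and le: "v \<le> \<gamma> * \<rho>" for v \<rho> \<gamma> :: real
  proof -
    define x where "x = \<rho> / v"
    have "\<gamma> * \<rho> > 0" using v le by simp
    then have \<rho>: "\<rho> > 0" using \<gamma> by (simp add: zero_less_mult_iff)
    have "1 / \<gamma> \<le> x" using v \<gamma> le by (simp add: x_def field_simps)
    moreover have "1 \<le> 1 / \<gamma>" using \<gamma> by simp
    ultimately have x: "x \<ge> 1 / \<gamma>" "x \<ge> 1" by auto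
    have \<rho>x: "\<rho> = x * v" using v by (simp add: x_def)
    have lv: "ln (exp 1 + v) \<ge> 1" using v by (intro ln_exp_1_add_ge_1) simp
    have "exp 1 + \<rho> \<le> x * (exp 1 + v)"
      using x by (simp add: \<rho>x distrib_left mult_le_cancel_right1)
    then have "ln (exp 1 + \<rho>) \<le> ln (x * (exp 1 + v))"
      using x v \<rho> by (subst ln_le_cancel_iff) (auto simp: add_pos_pos)
    also have "\<dots> = ln x + ln (exp 1 + v)"
      using x v by (intro ln_mult_pos) (auto simp: add_pos_pos)
    also have "\<dots> \<le> ln x * ln (exp 1 + v) + ln (exp 1 + v)"
      using x lv mult_left_mono[OF lv, of "ln x"] by simp
    also have "\<dots> = (1 + ln x) * ln (exp 1 + v)" by (simp add: algebra_simps)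
    also have "\<dots> \<le> ((1 + 1 / s) * x powr s) * ln (exp 1 + v)"
    proof (rule mult_right_mono)
      have "ln (x powr s) \<le> x powr s - 1" using x by (intro ln_le_minus_one) simp
      then have "s * ln x \<le> x powr s" using x by (simp add: ln_powr)
      then have "ln x \<le> x powr s / s" using s by (simp add: field_simps)
      moreover have "1 \<le> x powr s" using x s by (intro ge_one_powr_ge_zero) auto
      ultimately show "1 + ln x \<le> (1 + 1 / s) * x powr s" by (simp add: algebra_simps)
    qed (use lv in simp)
    finally have "ln (exp 1 + \<rho>) powr \<beta> \<le> (((1 + 1 / s) * x powr s) * ln (exp 1 + v)) powr \<beta>"
      using \<beta> ln_exp_1_add_ge_1[of \<rho>] \<rho> by (intro powr_mono2) auto
    also have "\<dots> = K * x powr (\<alpha> / 2) * ln (exp 1 + v) powr \<beta>"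
      using \<beta> s x lv by (simp add: K_def powr_mult powr_powr) (simp add: s_def)
    finally have "v powr \<alpha> * ln (exp 1 + \<rho>) powr \<beta> \<le> v powr \<alpha> * (K * x powr (\<alpha> / 2) * ln (exp 1 + v) powr \<beta>)"
      by (intro mult_left_mono) auto
    also have "\<dots> = K * \<rho> powr \<alpha> * x powr (- (\<alpha> / 2)) * ln (exp 1 + v) powr \<beta>"
    proof -
      have "\<rho> powr \<alpha> = x powr \<alpha> * v powr \<alpha>" using x v by (simp add: \<rho>x powr_mult)
      moreover have "x powr \<alpha> * x powr (- (\<alpha> / 2)) = x powr (\<alpha> / 2)"
        unfolding powr_add[symmetric] by simp
      ultimately show ?thesis by (simp add: mult_ac)
    qed
    also have "\<dots> \<le> K * \<rho> powr \<alpha> * \<gamma> powr (\<alpha> / 2) * ln (exp 1 + v) powr \<beta>"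
    proof (intro mult_right_mono mult_left_mono)
      have "x powr (- (\<alpha> / 2)) \<le> (1 / \<gamma>) powr (- (\<alpha> / 2))" using x \<alpha> \<gamma> by (intro powr_mono2') auto
      also have "\<dots> = \<gamma> powr (\<alpha> / 2)" using \<gamma> by (simp add: powr_divide powr_minus)
      finally show "x powr (- (\<alpha> / 2)) \<le> \<gamma> powr (\<alpha> / 2)" .
    qed (auto simp: K_def)
    finally show ?thesis by (simp add: mult_ac)
  qed
  moreover have "1 + 1 / s > 0" using s by (simp add: add_pos_pos)
  then have "K > 0" by (simp add: K_def)
  ultimately show ?thesis using that by blast
qed

text \<open>The logarithm on the right is \<open>ln (e + \<rho>)\<close> at the critical profile \<open>\<rho>\<close>, with \<open>y = 1 / s\<close>.\<close>

lemma ln_le_ln_rho: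
  fixes N d :: real
  assumes N: "N \<ge> 1" and d: "d > 0"
  obtains c where "c > 0" "\<And>y. y \<ge> 1 \<Longrightarrow>
    ln (exp 1 + y) \<le> c * ln (exp 1 + y powr N * ln (exp 1 + y) powr (- N / d))"
proof
  define c where "c = 6 + 2 * \<bar>ln (2 / d)\<bar> / d"
  show "c > 0" using d by (simp add: c_def add_pos_nonneg)
  fix y :: real assume y: "y \<ge> 1"
  define l where "l = ln (exp 1 + y)"
  define \<rho> where "\<rho> = y powr N * l powr (- N / d)"
  have l: "l \<ge> 1" using y by (simp add: l_def ln_exp_1_add_ge_1)
  have \<rho>: "\<rho> > 0" using y l by (simp add: \<rho>_def)
  have L: "ln (exp 1 + \<rho>) \<ge> 1" "ln \<rho> \<le> ln (exp 1 + \<rho>)"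
    using \<rho> ln_exp_1_add_ge_1[of \<rho>] ln_le_cancel_iff[of \<rho> "exp 1 + \<rho>"] by (auto simp: add_pos_pos)
  have "ln \<rho> = N * ln y + (- N / d) * ln l"
    using y l by (simp add: \<rho>_def ln_mult_pos ln_powr)
  then have lny: "ln y = ln \<rho> / N + ln l / d" using N d by (simp add: field_simps)
  have "exp 1 + y \<le> exp 2 * y"
  proof -
    have "exp 1 * 1 \<le> exp 1 * y" using y by (intro mult_left_mono) auto
    moreover have "exp (2::real) = exp 1 * exp 1" by (simp add: exp_add[symmetric])
    moreover have "(exp 1 + 1) * y \<le> (exp 1 * exp 1) * y"
    proof (rule mult_right_mono)
      have e: "exp (1::real) \<ge> 2" using exp_ge_add_one_self[of 1] by simp
      then have "2 * exp (1::real) \<le> exp 1 * exp 1" by (intro mult_right_mono) auto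
      then show "exp 1 + 1 \<le> exp 1 * exp (1::real)" using e by linarith
    qed (use y in simp)
    ultimately show ?thesis by (simp only: distrib_right mult_1_left mult_1_right)
  qed
  then have "l \<le> ln (exp 2 * y)" unfolding l_def using y by (subst ln_le_cancel_iff) (auto simp: add_pos_pos)
  also have "\<dots> = 2 + ln y" using y by (simp add: ln_mult_pos)
  finally have 1: "l \<le> 2 + ln \<rho> / N + ln l / d" by (simp add: lny)
  \<comment> \<open>Scaling by \<open>d / 2\<close> before using \<open>ln z \<le> z - 1\<close>
    bounds \<open>ln l / d\<close> by \<open>l / 2\<close> plus a constant, and the half is absorbed
    on the left.\<close>
  have "ln (d / 2 * l) \<le> d / 2 * l - 1" using d l by (intro ln_le_minus_one) simp
  moreover have "ln (d / 2 * l) = ln l - ln (2 / d)"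
    using d l by (simp add: ln_mult_pos ln_div)
  ultimately have "ln l \<le> d / 2 * l + \<bar>ln (2 / d)\<bar>" by linarith
  then have "ln l / d \<le> (d / 2 * l + \<bar>ln (2 / d)\<bar>) / d" using d by (intro divide_right_mono) auto
  also have "\<dots> = l / 2 + \<bar>ln (2 / d)\<bar> / d" using d by (simp add: add_divide_distrib)
  finally have 2: "l / 2 \<le> 2 + ln \<rho> / N + \<bar>ln (2 / d)\<bar> / d" using 1 by linarith
  have "ln \<rho> / N \<le> ln (exp 1 + \<rho>) / N" using L N by (intro divide_right_mono) auto
  also have "\<dots> \<le> ln (exp 1 + \<rho>) / 1" using L N by (intro divide_left_mono) auto
  finally have "ln \<rho> / N \<le> ln (exp 1 + \<rho>)" by simp
  then have "l \<le> 4 + 2 * (\<bar>ln (2 / d)\<bar> / d) + 2 * ln (exp 1 + \<rho>)" using 2 by linarith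
  then have "l \<le> (4 + 2 * \<bar>ln (2 / d)\<bar> / d) * 1 + 2 * ln (exp 1 + \<rho>)" by simp
  also have "\<dots> \<le> (4 + 2 * \<bar>ln (2 / d)\<bar> / d) * ln (exp 1 + \<rho>) + 2 * ln (exp 1 + \<rho>)"
    using L d by (intro add_right_mono mult_left_mono) auto
  also have "\<dots> = c * ln (exp 1 + \<rho>)" by (simp add: c_def algebra_simps)
  finally show "ln (exp 1 + y) \<le> c * ln (exp 1 + y powr N * ln (exp 1 + y) powr (- N / d))"
    by (simp add: l_def \<rho>_def)
qed

lemma Phi_strict_mono:
  assumes \<beta>: "\<beta> > 0" and v: "0 \<le> v" "v < w"
  shows "Phi \<beta> v < Phi \<beta> w"
proof -
  have "ln (exp 1 + v) \<le> ln (exp 1 + w)" using v by (subst ln_le_cancel_iff) (auto simp: add_pos_nonneg)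
  then have "ln (exp 1 + v) powr \<beta> \<le> ln (exp 1 + w) powr \<beta>"
    using \<beta> v ln_exp_1_add_ge_1[of v] by (intro powr_mono2) auto
  then have "v * ln (exp 1 + v) powr \<beta> \<le> v * ln (exp 1 + w) powr \<beta>"
    using v by (intro mult_left_mono)
  also have "\<dots> < w * ln (exp 1 + w) powr \<beta>"
    using v ln_exp_1_add_ge_1[of w] by (intro mult_strict_right_mono) auto
  finally show ?thesis by (simp add: Phi_def)
qed

lemma Phi_mono: "\<beta> > 0 \<Longrightarrow> 0 \<le> v \<Longrightarrow> v \<le> w \<Longrightarrow> Phi \<beta> v \<le> Phi \<beta> w"
  using Phi_strict_mono[of \<beta> v w] by (cases "v = w") auto

lemma Phi_ge: "\<beta> > 0 \<Longrightarrow> 0 \<le> w \<Longrightarrow> w \<le> Phi \<beta> w"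
  using mult_left_mono[of 1 "ln (exp 1 + w) powr \<beta>" w] ln_exp_1_add_ge_1[of w]
  by (simp add: Phi_def ge_one_powr_ge_zero)

text \<open>Strict monotonicity gives injectivity, and \<open>Phi \<beta> z \<ge> z\<close> provides
  the upper end for the intermediate value theorem; so the inverse is genuine on the whole
  half-line.\<close>

lemma Phi_Phi_inv:
  assumes \<beta>: "\<beta> > 0" and z: "z \<ge> 0"
  shows "0 \<le> Phi_inv \<beta> z" "Phi \<beta> (Phi_inv \<beta> z) = z"
proof -
  have inj: "inj_on (Phi \<beta>) {0..}"
    using Phi_strict_mono[OF \<beta>] by (intro linorder_inj_onI) (auto, force)
  have "\<exists>w\<ge>0. w \<le> z \<and> Phi \<beta> w = z"
  proof (rule IVT')
    show "Phi \<beta> 0 \<le> z" using z by (simp add: Phi_def)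
    show "z \<le> Phi \<beta> z" by (rule Phi_ge[OF \<beta> z])
    have "ln (exp 1 + x) > 0" if "x \<ge> 0" for x :: real using ln_exp_1_add_ge_1[OF that] by simp
    then show "continuous_on {0..z} (Phi \<beta>)"
      unfolding Phi_def by (intro continuous_intros) (force simp: add_pos_nonneg)+
  qed (rule z)
  then have im: "z \<in> Phi \<beta> ` {0..}" by force
  show "Phi \<beta> (Phi_inv \<beta> z) = z" unfolding Phi_inv_def by (rule f_the_inv_into_f[OF inj im])
  show "0 \<le> Phi_inv \<beta> z" using the_inv_into_into[OF inj im, of "{0..}"] by (simp add: Phi_inv_def)
qed

text \<open>A monotone function is Borel; \<open>max 0\<close> avoids negative arguments, at which
  the inverse is unspecified.\<close>

lemma Phi_inv_measurable:
  assumes \<beta>: "\<beta> > 0"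
  shows "(\<lambda>z. Phi_inv \<beta> (max 0 z)) \<in> borel_measurable borel"
proof (rule borel_measurable_mono, rule monoI)
  fix v w :: real assume "v \<le> w"
  show "Phi_inv \<beta> (max 0 v) \<le> Phi_inv \<beta> (max 0 w)"
  proof (rule ccontr)
    assume "\<not> ?thesis"
    then have "Phi \<beta> (Phi_inv \<beta> (max 0 w)) < Phi \<beta> (Phi_inv \<beta> (max 0 v))"
      by (intro Phi_strict_mono[OF \<beta>] Phi_Phi_inv[OF \<beta>]) auto
    then have "max 0 w < max 0 v" by (simp only: Phi_Phi_inv(2)[OF \<beta>] max.cobounded1)
    then show False using \<open>v \<le> w\<close> by linarith
  qed
qed

text \<open>Here \<open>l t\<close>, the logarithm of e + (T/t)^(1/d), stands for the logarithm in
  the claim. The profile makes \<open>\<eta>\<close> of order l^(-\<beta>-1) / t, whose time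
  integral is of order l^(-\<beta>), and \<open>h (m t)\<close> grows at most like l^\<beta>: the
  two compensate, and smallness comes from the factor \<open>\<gamma>'\<close> in the
  profile.\<close>

lemma critical:
  fixes N d p r0 \<beta> :: real
  assumes N: "N = real CARD('n::finite)"
    and d: "d > 0" and p: "p > 1"
    and r0: "r0 = N * (p - 1) / d" and r1: "r0 = 1" and \<beta>: "\<beta> > 0"
  shows "\<exists>\<gamma>>0. \<forall>\<phi> :: real ^ 'n \<Rightarrow> real. locally_integrable \<phi> \<longrightarrow>
         (\<exists>C>0. \<forall>T>0.
           (\<forall>\<sigma>\<in>{0<..<T powr (1 / d)}.
              (SUP x. extend_top (Phi_inv \<beta>)
                        (ball_mean (\<lambda>y. Phi \<beta> (T powr (N / d) * \<bar>\<phi> y\<bar>)) x \<sigma>))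
                \<le> ennreal (\<gamma> * rho N d (\<sigma> * T powr (- 1 / d)))) \<longrightarrow>
           (\<exists>u. is_solution d p \<phi> (ennreal T) u \<and>
             (\<forall>x. \<forall>t\<in>{0<..<T}.
                \<bar>u x t\<bar> \<le> C * t powr (- N / d) * \<bar>ln (t / (2 * T))\<bar> powr (- N / d))))"
proof -
  obtain \<delta> A where \<delta>: "\<delta> > 0" and A: "A > 0" and sol:
    "\<And>(\<phi> :: real ^ 'n \<Rightarrow> real) h \<Psi> m \<eta> H T. mean_bound d p \<delta> \<phi> h \<Psi> m \<eta> H T \<Longrightarrow>
      has_solution_below d p \<phi> T (\<lambda>t. A * m t)"
    using ex_solution_of_mean_bound[OF d p, where 'n='n] by blast
  obtain K0 where K0: "K0 > 0"
    "\<And>(f :: real ^ 'n::finite \<Rightarrow> real) x t B. f \<in> borel_measurable lebesgue \<Longrightarrow> t > 0 \<Longrightarrow>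
      (\<And>z. ball_mean f z (t powr (1 / d)) \<le> B) \<Longrightarrow>
      (\<integral>\<^sup>+y. ennreal (kern d (x - y) t) * ennreal (f y) \<partial>lebesgue) \<le> ennreal K0 * B"
    using kern_ball_mean_le[OF d, where 'n='n] by blast
  \<comment> \<open>With \<open>K \<ge> 1\<close> the constant can be moved inside:
    \<open>K * Phi \<beta> z \<le> Phi \<beta> (K * z)\<close>.\<close>
  define K where "K = max 1 K0"
  have K: "K \<ge> 1" "K0 \<le> K" by (auto simp: K_def)
  have "real 1 \<le> real CARD('n)" by (subst of_nat_le_iff) (simp add: Suc_leI)
  then have N1: "N \<ge> 1" by (simp add: N)
  have Npd: "N * (p - 1) = d" using r0 r1 d by (simp add: field_simps)
  define \<alpha> where "\<alpha> = p - 1"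
  have \<alpha>: "\<alpha> > 0" using p by (simp add: \<alpha>_def)
  have N\<alpha>: "N * \<alpha> = d" "N / d * \<alpha> = 1" using Npd d by (simp_all add: \<alpha>_def)
  obtain Q where Q: "Q > 0" "\<And>v \<rho> \<gamma>. 0 < v \<Longrightarrow> 0 < \<gamma> \<Longrightarrow> \<gamma> \<le> 1 \<Longrightarrow> v \<le> \<gamma> * \<rho> \<Longrightarrow>
    v powr \<alpha> * ln (exp 1 + \<rho>) powr \<beta> \<le> Q * \<gamma> powr (\<alpha> / 2) * \<rho> powr \<alpha> * ln (exp 1 + v) powr \<beta>"
    using powr_ln_quasi_mono[OF \<alpha> \<beta>] by blast
  obtain c where c: "c > 0" "\<And>y. y \<ge> 1 \<Longrightarrow> ln (exp 1 + y) \<le> c * ln (exp 1 + y powr N * ln (exp 1 + y) powr (- N / d))"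
    using ln_le_ln_rho[OF N1 d] by blast
  \<comment> \<open>\<open>d / \<beta>\<close> compensates the derivative of
    \<open>l powr - \<beta>\<close>, 4 the bound \<open>y / (exp 1 + y) \<ge> 1 / 4\<close> for
    \<open>y > 1\<close>; \<open>Q\<close> and \<open>c powr \<beta>\<close> are the losses in the
    two logarithmic comparisons.\<close>
  define D where "D = 4 * d / \<beta> * (Q * c powr \<beta>)"
  have D: "D > 0" using d \<beta> Q(1) c(1) by (simp add: D_def)
  \<comment> \<open>Chosen so that \<open>N powr \<beta> * D * \<gamma>' powr (\<alpha> / 2) \<le>
    \<delta>\<close>; the minimum with 1 is the hypothesis of quasi-monotonicity.\<close>
  define \<gamma>' where "\<gamma>' = min 1 ((\<delta> / (N powr \<beta> * D)) powr (2 / \<alpha>))"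
  have \<gamma>': "0 < \<gamma>'" "\<gamma>' \<le> 1" using \<delta> D N1 by (auto simp: \<gamma>'_def)
  define E where "E = D * \<gamma>' powr (\<alpha> / 2)"
  have E: "E > 0" using D \<gamma>' by (simp add: E_def)
  have NE: "N powr \<beta> * E \<le> \<delta>"
  proof -
    have "\<gamma>' powr (\<alpha> / 2) \<le> ((\<delta> / (N powr \<beta> * D)) powr (2 / \<alpha>)) powr (\<alpha> / 2)"
      using \<gamma>' \<alpha> by (intro powr_mono2) (auto simp: \<gamma>'_def)
    also have "\<dots> = \<delta> / (N powr \<beta> * D)" using \<alpha> \<delta> D N1 by (simp add: powr_powr)
    finally have "N powr \<beta> * D * \<gamma>' powr (\<alpha> / 2) \<le> N powr \<beta> * D * (\<delta> / (N powr \<beta> * D))"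
      using D by (intro mult_left_mono) auto
    then show ?thesis using D N1 by (simp add: E_def)
  qed
  define \<gamma> where "\<gamma> = \<gamma>' / K"
  have \<gamma>: "\<gamma> > 0" "K * \<gamma> = \<gamma>'" using \<gamma>' K by (auto simp: \<gamma>_def)
  \<comment> \<open>The last factor converts \<open>l t\<close> into the logarithm of the claim,
    which is at most \<open>(1 + d) * l t\<close>.\<close>
  define C where "C = A * \<gamma>' * (1 + d) powr (N / d)"
  have C: "C > 0" using A \<gamma>' d by (simp add: C_def)
  have core: "\<exists>u. is_solution d p \<phi> (ennreal T) u \<and> (\<forall>x. \<forall>t\<in>{0<..<T}.
                \<bar>u x t\<bar> \<le> C * t powr (- N / d) * \<bar>ln (t / (2 * T))\<bar> powr (- N / d))"
    if \<phi>: "locally_integrable \<phi>" and T: "T > 0"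
      and hyp: "\<And>\<sigma>. 0 < \<sigma> \<Longrightarrow> \<sigma> < T powr (1 / d) \<Longrightarrow>
         (SUP x. extend_top (Phi_inv \<beta>) (ball_mean (\<lambda>y. Phi \<beta> (T powr (N / d) * \<bar>\<phi> y\<bar>)) x \<sigma>))
                \<le> ennreal (\<gamma> * rho N d (\<sigma> * T powr (- 1 / d)))"
    for \<phi> :: "real ^ 'n \<Rightarrow> real" and T
  proof -
    note \<phi>m = locally_integrable_measurable[OF \<phi>]
    define S where "S = T powr (N / d)"
    have S: "S > 0" using T by (simp add: S_def)
    have S\<alpha>: "S powr \<alpha> = T" using T N\<alpha> by (simp add: S_def powr_powr)
    define y where "y t = (T / t) powr (1 / d)" for t
    define l where "l t = ln (exp 1 + y t)" for t
    define \<rho> where "\<rho> t = y t powr N * l t powr (- N / d)" for t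
    have y: "y t > 1" if "0 < t" "t < T" for t
      using that d by (auto simp: y_def intro!: gr_one_powr)
    have y1: "y t \<ge> 0" for t by (simp add: y_def)
    have l: "l t \<ge> 1" for t using y1[of t] by (simp add: l_def ln_exp_1_add_ge_1)
    have \<rho>: "\<rho> t > 0" if "0 < t" "t < T" for t
      using y[OF that] l[of t] by (simp add: \<rho>_def)
    have \<rho>_eq: "rho N d (t powr (1 / d) * T powr (- 1 / d)) = \<rho> t" if t: "0 < t" for t
    proof -
      have inv: "t powr (1 / d) * T powr (- 1 / d) = 1 / y t"
        using t T by (simp add: y_def powr_divide powr_minus_divide)
      have "(1 / y t) powr - N = y t powr N" using t T by (simp add: y_def powr_divide powr_minus)
      then show ?thesis unfolding inv by (simp add: rho_def \<rho>_def l_def)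
    qed
    have \<rho>_le: "\<rho> t \<le> y t powr N" for t
    proof -
      have "l t powr (- N / d) \<le> 1 powr (- N / d)" using l[of t] N1 d by (intro powr_mono2') auto
      then show ?thesis unfolding \<rho>_def by (simp add: mult_left_le)
    qed
    define m where "m t = \<gamma>' * \<rho> t / S" for t
    define h where "h w = ln (exp 1 + S * w) powr \<beta>" for w
    have wh: "w * h w = Phi \<beta> (S * w) / S" for w using S by (simp add: h_def Phi_def)
    have mean: "ball_mean (\<lambda>y. \<bar>\<phi> y\<bar> * h \<bar>\<phi> y\<bar>) x (t powr (1 / d)) \<le> ennreal (Phi \<beta> (\<gamma> * \<rho> t) / S)"
      if t: "0 < t" "t < T" for x t
    proof -
      define \<sigma> where "\<sigma> = t powr (1 / d)"
      have \<sigma>: "0 < \<sigma>" "\<sigma> < T powr (1 / d)" using t d by (auto simp: \<sigma>_def intro!: powr_less_mono2)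
      let ?B = "ball_mean (\<lambda>y. Phi \<beta> (S * \<bar>\<phi> y\<bar>)) x \<sigma>"
      have "extend_top (Phi_inv \<beta>) ?B \<le> (SUP x. extend_top (Phi_inv \<beta>) (ball_mean (\<lambda>y. Phi \<beta> (S * \<bar>\<phi> y\<bar>)) x \<sigma>))"
        by (rule SUP_upper) simp
      also have "\<dots> \<le> ennreal (\<gamma> * rho N d (\<sigma> * T powr (- 1 / d)))"
        unfolding S_def by (rule hyp[OF \<sigma>])
      also have "rho N d (\<sigma> * T powr (- 1 / d)) = \<rho> t" unfolding \<sigma>_def by (rule \<rho>_eq[OF t(1)])
      finally have le: "extend_top (Phi_inv \<beta>) ?B \<le> ennreal (\<gamma> * \<rho> t)" .
      have "?B \<noteq> top" using le by (auto simp: extend_top_def top_unique)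
      then obtain z where z: "?B = ennreal z" "z \<ge> 0" by (cases ?B) auto
      have "Phi_inv \<beta> z \<le> \<gamma> * \<rho> t"
        using le z \<gamma> \<rho>[OF t] by (simp add: extend_top_def ennreal_le_iff)
      then have "Phi \<beta> (Phi_inv \<beta> z) \<le> Phi \<beta> (\<gamma> * \<rho> t)"
        by (intro Phi_mono[OF \<beta>] Phi_Phi_inv[OF \<beta> z(2)])
      then have zle: "z \<le> Phi \<beta> (\<gamma> * \<rho> t)" by (simp add: Phi_Phi_inv[OF \<beta> z(2)])
      have "ball_mean (\<lambda>y. \<bar>\<phi> y\<bar> * h \<bar>\<phi> y\<bar>) x \<sigma> \<le> ennreal 0 + ennreal (1 / S) * ?B"
      proof (rule ball_mean_le_affine[OF \<sigma>(1)])
        show "(\<lambda>y. Phi \<beta> (S * \<bar>\<phi> y\<bar>)) \<in> borel_measurable lebesgue"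
          using \<phi>m unfolding Phi_def by measurable
        show "0 \<le> Phi \<beta> (S * \<bar>\<phi> y\<bar>)" for y
          using S by (simp add: Phi_def)
      qed (use S wh in auto)
      also have "\<dots> = ennreal (z / S)" using S z by (simp add: ennreal_mult'[symmetric])
      also have "\<dots> \<le> ennreal (Phi \<beta> (\<gamma> * \<rho> t) / S)" using S zle by (intro ennreal_leI divide_right_mono) auto
      finally show ?thesis by (simp add: \<sigma>_def)
    qed
    have "has_solution_below d p \<phi> (ennreal T) (\<lambda>t. A * m t)"
    \<comment> \<open>\<open>\<eta>\<close> is designed as the exact derivative of \<open>H\<close>:
      the factor \<open>y t / (exp 1 + y t)\<close> is what differentiating \<open>l\<close>
      produces.\<close>
    proof (rule sol[where h = h and \<Psi> = "\<lambda>z. Phi_inv \<beta> (max 0 (S * z)) / S"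
        and \<eta> = "\<lambda>t. E * (\<beta> / d * (l t powr (- \<beta> - 1) * (y t / (exp 1 + y t)) / t))"
        and H = "\<lambda>t. E * l t powr - \<beta>"], unfold_locales)
      show "\<phi> \<in> borel_measurable lebesgue" by (rule \<phi>m)
      show "h \<in> borel_measurable borel" unfolding h_def by measurable
      show "(\<lambda>z. Phi_inv \<beta> (max 0 (S * z)) / S) \<in> borel_measurable borel"
        using measurable_compose[OF _ Phi_inv_measurable[OF \<beta>], of "\<lambda>z. S * z" borel] by simp
      show "(\<lambda>t. E * (\<beta> / d * (l t powr (- \<beta> - 1) * (y t / (exp 1 + y t)) / t))) \<in> borel_measurable borel"
        unfolding l_def y_def by measurable
      have ln1: "ln (exp 1 + S * w) \<ge> 1" if "w \<ge> 0" for w using that S by (simp add: ln_exp_1_add_ge_1)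
      show hmono: "h v \<le> h w" if "0 \<le> v" "v \<le> w" for v w
      proof -
        have "ln (exp 1 + S * v) \<le> ln (exp 1 + S * w)"
          using that S by (subst ln_le_cancel_iff) (auto simp: add_pos_nonneg)
        then show ?thesis unfolding h_def using \<beta> ln1[OF that(1)] by (intro powr_mono2) auto
      qed
      show "0 < h w" if "0 < w" for w using ln1[of w] that by (simp add: h_def)
      show "0 \<le> h 0" by (simp add: h_def)
      show "0 \<le> Phi_inv \<beta> (max 0 (S * z)) / S \<and>
         Phi_inv \<beta> (max 0 (S * z)) / S * h (Phi_inv \<beta> (max 0 (S * z)) / S) = z" if "0 \<le> z" for z
      proof -
        have "0 \<le> S * z" using that S by simp
        then show ?thesis unfolding wh using S Phi_Phi_inv[OF \<beta>, of "S * z"] by (simp add: max_absorb2)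
      qed
      show "\<exists>B. \<forall>s. \<tau> < s \<longrightarrow> ennreal s < ennreal T \<longrightarrow> m s \<le> B" if \<tau>: "0 < \<tau>" for \<tau>
      proof -
        have "m s \<le> \<gamma>' * ((T / \<tau>) powr (1 / d)) powr N / S" if "\<tau> < s" for s
        proof -
          have "T / s \<le> T / \<tau>" using that \<tau> T by (intro divide_left_mono) auto
          then have "y s \<le> (T / \<tau>) powr (1 / d)"
            unfolding y_def using that \<tau> T d by (intro powr_mono2) auto
          then have "\<rho> s \<le> ((T / \<tau>) powr (1 / d)) powr N"
            using N1 y1 by (intro order_trans[OF \<rho>_le] powr_mono2) auto
          then show ?thesis unfolding m_def using \<gamma>' S by (intro divide_right_mono mult_left_mono) auto
        qed
        then show ?thesis by blast
      qed
    next
      fix t assume "0 < t" "ennreal t < ennreal T"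
      then have t: "0 < t" "t < T" by (simp_all add: ennreal_less_iff)
      show "0 \<le> m t \<and> 0 \<le> E * l t powr - \<beta> \<and> 0 \<le> E * (\<beta> / d * (l t powr (- \<beta> - 1) * (y t / (exp 1 + y t)) / t))"
        using \<gamma>' \<rho>[OF t] S E \<beta> d y[OF t] t by (simp add: m_def add_nonneg_nonneg)
    next
      fix x :: "real ^ 'n" and t assume "0 < t" "ennreal t < ennreal T"
      then have t: "0 < t" "t < T" by (simp_all add: ennreal_less_iff)
      have \<gamma>\<rho>: "\<gamma> * \<rho> t \<ge> 0" using \<gamma> \<rho>[OF t] by simp
      have "(\<integral>\<^sup>+y. ennreal (kern d (x - y) t) * ennreal (\<bar>\<phi> y\<bar> * h \<bar>\<phi> y\<bar>) \<partial>lebesgue) \<le> ennreal K0 * ennreal (Phi \<beta> (\<gamma> * \<rho> t) / S)"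
      proof (rule K0(2)[OF _ t(1) mean[OF t]])
        show "(\<lambda>y. \<bar>\<phi> y\<bar> * h \<bar>\<phi> y\<bar>) \<in> borel_measurable lebesgue"
          using \<phi>m unfolding h_def by measurable
      qed
      also have "\<dots> = ennreal (K0 * (Phi \<beta> (\<gamma> * \<rho> t) / S))"
        using K0(1) by (intro ennreal_mult'[symmetric]) simp
      also have "\<dots> \<le> ennreal (Phi \<beta> (\<gamma>' * \<rho> t) / S)"
      proof (rule ennreal_leI)
        have ln2: "ln (exp 1 + \<gamma> * \<rho> t) \<le> ln (exp 1 + \<gamma>' * \<rho> t)"
        proof -
          have "1 * (\<gamma> * \<rho> t) \<le> K * (\<gamma> * \<rho> t)" using K \<gamma>\<rho> by (intro mult_right_mono) auto
          then have "\<gamma> * \<rho> t \<le> \<gamma>' * \<rho> t" by (simp add: \<gamma>(2)[symmetric] mult.assoc)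
          then show ?thesis using \<gamma>\<rho> by (subst ln_le_cancel_iff) (auto simp: add_pos_nonneg)
        qed
        have "K0 * Phi \<beta> (\<gamma> * \<rho> t) \<le> K * Phi \<beta> (\<gamma> * \<rho> t)"
          using K \<gamma>\<rho> by (intro mult_right_mono) (auto simp: Phi_def)
        also have "\<dots> = (\<gamma>' * \<rho> t) * ln (exp 1 + \<gamma> * \<rho> t) powr \<beta>"
          by (simp add: Phi_def \<gamma>(2)[symmetric])
        also have "\<dots> \<le> (\<gamma>' * \<rho> t) * ln (exp 1 + \<gamma>' * \<rho> t) powr \<beta>"
          using ln2 \<beta> \<gamma>' \<rho>[OF t] ln_exp_1_add_ge_1[OF \<gamma>\<rho>] by (intro mult_left_mono powr_mono2) auto
        finally have "K0 * Phi \<beta> (\<gamma> * \<rho> t) \<le> Phi \<beta> (\<gamma>' * \<rho> t)" by (simp add: Phi_def)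
        then show "K0 * (Phi \<beta> (\<gamma> * \<rho> t) / S) \<le> Phi \<beta> (\<gamma>' * \<rho> t) / S"
          using S by (simp add: divide_right_mono)
      qed
      also have "Phi \<beta> (\<gamma>' * \<rho> t) / S = m t * h (m t)" using S by (simp add: wh) (simp add: m_def)
      finally show "(\<integral>\<^sup>+y. ennreal (kern d (x - y) t) * ennreal (\<bar>\<phi> y\<bar> * h \<bar>\<phi> y\<bar>) \<partial>lebesgue) \<le> ennreal (m t * h (m t))" .
    next
      fix w t assume "0 < t" "ennreal t < ennreal T" and w: "0 < w" "w \<le> m t"
      then have t: "0 < t" "t < T" by (simp_all add: ennreal_less_iff)
      have v: "0 < S * w" "S * w \<le> \<gamma>' * \<rho> t" using w S by (auto simp: m_def field_simps)
      have lr: "l t \<le> c * ln (exp 1 + \<rho> t)"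
        using c(2)[of "y t"] y[OF t] by (simp add: l_def \<rho>_def)
      have lrp: "ln (exp 1 + \<rho> t) \<ge> 1" using \<rho>[OF t] by (simp add: ln_exp_1_add_ge_1)
      \<comment> \<open>Criticality enters here: \<open>N * \<alpha> = d\<close> leaves
        \<open>1 / t\<close> with one logarithm in the denominator, and the extra
        \<open>l t powr - \<beta>\<close> makes it integrable at 0.\<close>
      have y\<alpha>: "\<rho> t powr \<alpha> = T / t / l t"
      proof -
        have "1 / d * N * \<alpha> = N / d * \<alpha>" "- N / d * \<alpha> = - (N / d * \<alpha>)" by simp_all
        then have "1 / d * N * \<alpha> = 1" "- N / d * \<alpha> = - 1" unfolding N\<alpha>(2) by blast+
        then have "(y t powr N) powr \<alpha> = T / t" "(l t powr (- N / d)) powr \<alpha> = 1 / l t"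
          unfolding y_def powr_powr using t l[of t] by (simp_all add: powr_minus_divide)
        then show ?thesis by (simp add: \<rho>_def powr_mult)
      qed
      have "l t powr \<beta> \<le> (c * ln (exp 1 + \<rho> t)) powr \<beta>" using lr l[of t] \<beta> by (intro powr_mono2) auto
      also have "\<dots> = c powr \<beta> * ln (exp 1 + \<rho> t) powr \<beta>" using c(1) lrp by (simp add: powr_mult)
      finally have "(S * w) powr \<alpha> * l t powr \<beta> \<le> (S * w) powr \<alpha> * (c powr \<beta> * ln (exp 1 + \<rho> t) powr \<beta>)"
        by (intro mult_left_mono) auto
      also have "\<dots> = c powr \<beta> * ((S * w) powr \<alpha> * ln (exp 1 + \<rho> t) powr \<beta>)" by simp
      also have "\<dots> \<le> c powr \<beta> * (Q * \<gamma>' powr (\<alpha> / 2) * \<rho> t powr \<alpha> * ln (exp 1 + S * w) powr \<beta>)"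
        by (intro mult_left_mono Q v \<gamma>') simp
      also have "\<dots> = (Q * c powr \<beta>) * \<gamma>' powr (\<alpha> / 2) * (T / t / l t) * h w"
        by (simp add: y\<alpha> h_def mult_ac)
      also have "(S * w) powr \<alpha> = T * w powr \<alpha>" using S w S\<alpha> by (simp add: powr_mult)
      finally have main: "T * w powr \<alpha> * l t powr \<beta> \<le> (Q * c powr \<beta>) * \<gamma>' powr (\<alpha> / 2) * (T / t / l t) * h w" .
      have lb: "l t powr - \<beta> * l t powr \<beta> = 1" using l[of t] by (simp add: powr_add[symmetric])
      have hw: "h w \<ge> 0" by (simp add: h_def)
      have "w powr \<alpha> = (T * w powr \<alpha> * l t powr \<beta>) * (l t powr - \<beta> / T)"
        using T lb by (simp add: mult_ac)
      also have "\<dots> \<le> ((Q * c powr \<beta>) * \<gamma>' powr (\<alpha> / 2) * (T / t / l t) * h w) * (l t powr - \<beta> / T)"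
        using main T by (intro mult_right_mono) auto
      also have "\<dots> = h w * ((Q * c powr \<beta>) * \<gamma>' powr (\<alpha> / 2) * (l t powr (- \<beta> - 1) / t))"
        using T l[of t] by (simp add: powr_diff mult_ac)
      also have "(Q * c powr \<beta>) * \<gamma>' powr (\<alpha> / 2) = E * (\<beta> / d * (1 / 4))"
        using \<beta> d by (simp add: E_def D_def)
      also have "h w * (E * (\<beta> / d * (1 / 4)) * (l t powr (- \<beta> - 1) / t))
          \<le> h w * (E * (\<beta> / d * (y t / (exp 1 + y t))) * (l t powr (- \<beta> - 1) / t))"
      proof (intro mult_left_mono mult_right_mono)
        have "exp 1 \<le> 3 * y t" using y[OF t] exp_le by linarith
        then have "exp 1 + y t \<le> 4 * y t" by simp
        then show "1 / 4 \<le> y t / (exp 1 + y t)" using y[OF t] by (simp add: field_simps add_pos_pos)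
      qed (use E \<beta> d t hw in auto)
      finally show "w powr (p - 1) \<le> h w * (E * (\<beta> / d * (l t powr (- \<beta> - 1) * (y t / (exp 1 + y t)) / t)))"
        by (simp add: \<alpha>_def mult_ac)
    next
      fix t assume "0 < t" "ennreal t < ennreal T"
      then have t: "0 < t" "t < T" by (simp_all add: ennreal_less_iff)
      show "(\<integral>\<^sup>+s\<in>{0<..<t}. ennreal (E * (\<beta> / d * (l s powr (- \<beta> - 1) * (y s / (exp 1 + y s)) / s))) \<partial>lborel) \<le> ennreal (E * l t powr - \<beta>)"
      proof (rule nn_integral_deriv_le[OF t(1)])
        show "(\<lambda>t. E * (\<beta> / d * (l t powr (- \<beta> - 1) * (y t / (exp 1 + y t)) / t))) \<in> borel_measurable borel"
          unfolding l_def y_def by measurable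
        show "0 \<le> E * (\<beta> / d * (l s powr (- \<beta> - 1) * (y s / (exp 1 + y s)) / s)) \<and> 0 \<le> E * l s powr - \<beta>"
          if "0 < s" "s \<le> t" for s
          using that E \<beta> d y1[of s] by (simp add: add_nonneg_nonneg)
        show "((\<lambda>t. E * l t powr - \<beta>) has_real_derivative E * (\<beta> / d * (l s powr (- \<beta> - 1) * (y s / (exp 1 + y s)) / s))) (at s)"
          if s: "0 < s" "s \<le> t" for s
        proof -
          have "((\<lambda>s. T / s) has_real_derivative - (T / s\<^sup>2)) (at s)"
            using s by (auto intro!: derivative_eq_intros simp: power2_eq_square)
          moreover have "T / s > 0" using T s by simp
          ultimately have "(y has_real_derivative (1 / d) * (T / s) powr (1 / d - 1) * - (T / s\<^sup>2)) (at s)"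
            unfolding y_def by (intro DERIV_chain2[of "\<lambda>u. u powr (1 / d)"] has_real_derivative_powr)
          moreover have "(1 / d) * (T / s) powr (1 / d - 1) * - (T / s\<^sup>2) = - (y s / (d * s))"
            using s T by (simp add: y_def powr_diff power2_eq_square)
          ultimately have y': "(y has_real_derivative - (y s / (d * s))) (at s)" by simp
          have ey: "exp 1 + y s > 0" using y1[of s] by (simp add: add_pos_nonneg)
          have l': "(l has_real_derivative (- (y s / (d * s))) / (exp 1 + y s)) (at s)"
            unfolding l_def using ey by (auto intro!: derivative_eq_intros y')
          have "l s > 0" using l[of s] by simp
          then have "((\<lambda>s. l s powr - \<beta>) has_real_derivative (- \<beta> * l s powr (- \<beta> - 1)) * ((- (y s / (d * s))) / (exp 1 + y s))) (at s)"
            by (intro DERIV_chain2[of "\<lambda>u. u powr - \<beta>"] has_real_derivative_powr l')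
          from DERIV_cmult[OF this, of E] show ?thesis
            by (simp add: mult_ac)
        qed
      qed
      \<comment> \<open>\<open>\<rho> t \<le> y t powr N\<close> and, as \<open>N \<ge> 1\<close>,
        \<open>exp 1 + y t powr N \<le> (exp 1 + y t) powr N\<close>; the resulting
        \<open>l t powr \<beta>\<close> cancels against \<open>H\<close>.\<close>
      have "h (m t) \<le> (N * l t) powr \<beta>"
        unfolding h_def
      proof (rule powr_mono2)
        have Sm: "S * m t = \<gamma>' * \<rho> t" using S by (simp add: m_def)
        have nn: "0 \<le> \<gamma>' * \<rho> t" using \<gamma>' \<rho>[OF t] by simp
        show "0 \<le> ln (exp 1 + S * m t)" unfolding Sm using ln_exp_1_add_ge_1[OF nn] by simp
        have "\<gamma>' * \<rho> t \<le> 1 * y t powr N" using \<gamma>' \<rho>[OF t] \<rho>_le[of t] by (intro mult_mono) auto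
        moreover have "exp 1 + y t powr N \<le> (exp 1 + y t) powr N"
        proof -

          have "exp 1 * 1 + y t * y t powr (N - 1) \<le> exp 1 * (exp 1 + y t) powr (N - 1) + y t * (exp 1 + y t) powr (N - 1)"
          proof (intro add_mono mult_left_mono)
            have "exp 1 + y t \<ge> 1" using y[OF t] by (simp add: add_increasing)
            then show "1 \<le> (exp 1 + y t) powr (N - 1)" using N1 by (intro ge_one_powr_ge_zero) auto
            show "y t powr (N - 1) \<le> (exp 1 + y t) powr (N - 1)" using N1 y1[of t] by (intro powr_mono2) auto
          qed (use y1[of t] in auto)
          also have "\<dots> = (exp 1 + y t) * (exp 1 + y t) powr (N - 1)" by (simp add: distrib_right)
          also have "\<dots> = (exp 1 + y t) powr N" using y[OF t] by (simp add: powr_diff add_pos_pos)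
          also have "y t * y t powr (N - 1) = y t powr N" using y[OF t] by (simp add: powr_diff)
          finally show ?thesis by simp
        qed
        ultimately have "ln (exp 1 + \<gamma>' * \<rho> t) \<le> ln ((exp 1 + y t) powr N)"
          using nn add_pos_nonneg[OF exp_gt_zero[of 1] y1[of t]]
          by (subst ln_le_cancel_iff) (auto simp: add_pos_nonneg)
        also have "\<dots> = N * l t" using y[OF t] by (simp add: ln_powr l_def add_pos_pos)
        finally show "ln (exp 1 + S * m t) \<le> N * l t" unfolding Sm .
      qed (use \<beta> in simp)
      then have "h (m t) * (E * l t powr - \<beta>) \<le> (N * l t) powr \<beta> * (E * l t powr - \<beta>)"
        using E by (intro mult_right_mono) auto
      also have "\<dots> = N powr \<beta> * E"
        using N1 l[of t] by (simp add: powr_mult powr_minus)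
      also have "\<dots> \<le> \<delta>" by (rule NE)
      finally show "h (m t) * (E * l t powr - \<beta>) \<le> \<delta>" .
    qed
    then obtain u where u: "is_solution d p \<phi> (ennreal T) u"
      "\<And>x t. 0 < t \<Longrightarrow> t < T \<Longrightarrow> \<bar>u x t\<bar> \<le> A * m t" using T by (auto simp: ennreal_less_iff)
    have "A * m t \<le> C * t powr (- N / d) * \<bar>ln (t / (2 * T))\<bar> powr (- N / d)" if t: "0 < t" "t < T" for t
    proof -
      \<comment> \<open>The 2 keeps \<open>L\<close> away from 0 as \<open>t\<close> approaches
        \<open>T\<close>. Since \<open>ln 2 < 1 \<le> l t\<close> and
        \<open>ln (T / t) = d * ln (y t)\<close>, it is at most
        \<open>(1 + d) * l t\<close>.\<close>
      define L where "L = ln (2 * T / t)"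
      have "1 < T / t" using t by simp
      then have "ln (T / t) > 0" by simp
      have "ln (2 * T / t) = ln 2 + ln (T / t)" using ln_mult_pos[of 2 "T / t"] t T by simp
      moreover have "ln (T / t) = d * ln (y t)" using t T d by (simp add: y_def ln_powr)
      moreover have "ln (2::real) < 1" using ln_2_less_1 .
      moreover have "ln (y t) \<le> l t" unfolding l_def using y[OF t] by (subst ln_le_cancel_iff) (auto simp: add_pos_pos)
      then have "d * ln (y t) \<le> d * l t" using d by (intro mult_left_mono) auto
      moreover have "ln (2::real) > 0" by simp
      ultimately have L: "0 < L" "L \<le> (1 + d) * l t"
        using l[of t] \<open>ln (T / t) > 0\<close> unfolding L_def distrib_right mult_1 by linarith+
      have "ln (t / (2 * T)) = - L" using t T by (simp add: L_def ln_div)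
      then have absL: "\<bar>ln (t / (2 * T))\<bar> = L" using L by simp
      have "((1 + d) * l t) powr (- N / d) \<le> L powr (- N / d)" using L N1 d by (intro powr_mono2') auto
      then have "(1 + d) powr (- N / d) * l t powr (- N / d) \<le> L powr (- N / d)"
        using d l[of t] by (simp add: powr_mult)
      then have lL: "l t powr (- N / d) \<le> (1 + d) powr (N / d) * L powr (- N / d)"
        using powr_minus_mult_leD[of "1 + d" "N / d" "l t powr (- N / d)"] d by simp
      have yS: "y t powr N / S = t powr (- N / d)"
        using t T by (simp add: y_def S_def powr_powr powr_divide powr_minus field_simps)
      have "A * m t = A * \<gamma>' * (y t powr N / S) * l t powr (- N / d)"
        by (simp add: m_def \<rho>_def)
      also have "\<dots> = A * \<gamma>' * t powr (- N / d) * l t powr (- N / d)" unfolding yS ..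
      also have "\<dots> \<le> A * \<gamma>' * t powr (- N / d) * ((1 + d) powr (N / d) * L powr (- N / d))"
        using A \<gamma>' by (intro mult_left_mono lL) auto
      finally show ?thesis unfolding absL C_def by (simp add: mult_ac)
    qed
    from order_trans[OF u(2) this] show ?thesis
      using u(1) by (intro exI[of _ u]) (simp del: abs_minus_cancel)
  qed
  show ?thesis
    by (rule exI[of _ \<gamma>], intro conjI \<gamma> allI impI, rule exI[of _ C], intro conjI C allI impI, rule core) auto
qed

theorem theorem7p1:
  fixes N d p r0 :: real
  assumes N: "N = real CARD('n::finite)"
    and d: "d > 0" and p: "p > 1"
    and r0: "r0 = N * (p - 1) / d"
  shows
    "(r0 < 1 \<longrightarrow>
       (\<exists>\<gamma>>0. \<forall>\<phi> :: real ^ 'n \<Rightarrow> real. locally_integrable \<phi> \<longrightarrow>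
         (\<exists>C>0. \<forall>T>0.
           (SUP x. ball_mean (\<lambda>y. \<bar>\<phi> y\<bar>) x (T powr (1 / d)))
             \<le> ennreal (\<gamma> * T powr (- N / (d * r0))) \<longrightarrow>
           (\<exists>u. is_solution d p \<phi> (ennreal T) u \<and>
             (\<forall>x. \<forall>t\<in>{0<..<T}. \<bar>u x t\<bar> \<le> C * t powr (- N / d))))))
     \<and>
     (r0 > 1 \<longrightarrow>
       (\<forall>q>1. \<exists>\<gamma>>0. \<forall>\<phi> :: real ^ 'n \<Rightarrow> real. locally_integrable \<phi> \<longrightarrow>
         (\<exists>C>0. \<forall>T>0.
           (SUP x. SUP \<sigma>\<in>{\<sigma>. 0 < \<sigma> \<and> ennreal \<sigma> < extend_top (\<lambda>a. a powr (1 / d)) T}.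
              ennreal (\<sigma> powr (N / r0)) *
              extend_top (\<lambda>a. a powr (1 / q)) (ball_mean (\<lambda>y. \<bar>\<phi> y\<bar> powr q) x \<sigma>))
             \<le> ennreal \<gamma> \<longrightarrow>
           (\<exists>u. is_solution d p \<phi> T u \<and>
             (\<forall>x. \<forall>t>0. ennreal t < T \<longrightarrow> \<bar>u x t\<bar> \<le> C * t powr (- N / (d * r0)))))))
     \<and>
     (r0 = 1 \<longrightarrow>
       (\<forall>\<beta>>0. \<exists>\<gamma>>0. \<forall>\<phi> :: real ^ 'n \<Rightarrow> real. locally_integrable \<phi> \<longrightarrow>
         (\<exists>C>0. \<forall>T>0.
           (\<forall>\<sigma>\<in>{0<..<T powr (1 / d)}.
              (SUP x. extend_top (Phi_inv \<beta>)
                        (ball_mean (\<lambda>y. Phi \<beta> (T powr (N / d) * \<bar>\<phi> y\<bar>)) x \<sigma>))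
                \<le> ennreal (\<gamma> * rho N d (\<sigma> * T powr (- 1 / d)))) \<longrightarrow>
           (\<exists>u. is_solution d p \<phi> (ennreal T) u \<and>
             (\<forall>x. \<forall>t\<in>{0<..<T}.
                \<bar>u x t\<bar> \<le> C * t powr (- N / d) * \<bar>ln (t / (2 * T))\<bar> powr (- N / d))))))"
  using subcritical[OF N d p r0] supercritical[OF N d p r0] critical[OF N d p r0] by (intro conjI impI allI)

end
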